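(* Let $N\ge1$. For every $p\in[1,\infty]$ there exists a constant $C=C(p,N)>0$ such that, for every constant vector $a\in\mathbb{R}^N$, every $F\in C^1(\mathbb{R})$ with $F(0)=0$ and every $u_0\in L^1(\mathbb{R}^N)\cap L^\infty(\mathbb{R}^N)$, the solution $u$ of $$u_t-\Delta u=a\cdot\nabla\bigl(F(u)\bigr)\ \text{ in }\mathbb{R}^N\times(0,\infty),\qquad u(0)=u_0,$$ satisfies $$\|u(t)\|_p\le C\|u_0\|_1\,t^{-\frac N2\left(1-\frac1p\right)}\qquad\forall t>0.$$
   Context: $\|\cdot\|_p$ denotes the norm of $L^p(\mathbb{R}^N)$. The solution is the unique one in $C([0,\infty);L^1(\mathbb{R}^N))\cap L^\infty(\mathbb{R}^N\times(0,\infty))$; equivalently it satisfies the integral equation $u(t)=G(t)*u_0+\int_0^t a\cdot\nabla G(t-s)*F(u(s))\,ds$, where $G(x,t)=(4\pi t)^{-N/2}\exp(-|x|^2/(4t))$ and $*$ is convolution in the space variable. It also belongs to $C((0,\infty);W^{2,p}(\mathbb{R}^N))\cap C^1((0,\infty);L^p(\mathbb{R}^N))$ for all $p\in(1,\infty)$. *)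

theory Defs
  imports "HOL-Probability.Essential_Supremum"
begin

(* The norm takes the value \<infinity> (and not a junk real) when f is not in L^p. *)
definition Lp_norm :: "ennreal \<Rightarrow> 'a measure \<Rightarrow> ('a \<Rightarrow> real) \<Rightarrow> ennreal" where
  "Lp_norm p M f =
     (if p = \<infinity> then esssup M (\<lambda>x. ennreal \<bar>f x\<bar>)
      else let I = (\<integral>\<^sup>+ x. ennreal (\<bar>f x\<bar> powr enn2real p) \<partial>M)
           in if I = \<infinity> then \<infinity> else ennreal (enn2real I powr (1 / enn2real p)))"

(* Functions represent their classes modulo equality almost everywhere; over lborel every
   class of Lebesgue measurable functions has a Borel measurable representative. *)
definition Lp :: "ennreal \<Rightarrow> 'a measure \<Rightarrow> ('a \<Rightarrow> real) set" where
  "Lp p M = {f \<in> borel_measurable M. Lp_norm p M f < \<infinity>}"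

definition heat_kernel :: "real \<Rightarrow> real ^ 'n \<Rightarrow> real" where
  "heat_kernel t x =
     (4 * pi * t) powr (- real CARD('n) / 2) * exp (- (norm x)\<^sup>2 / (4 * t))"

(* a \<bullet> \<nabla>G(x,t), as the directional derivative of G(.,t) at x along a *)
definition grad_heat_kernel :: "real ^ 'n \<Rightarrow> real \<Rightarrow> real ^ 'n \<Rightarrow> real" where
  "grad_heat_kernel a t x = frechet_derivative (heat_kernel t) (at x) a"

definition conv :: "(real ^ 'n \<Rightarrow> real) \<Rightarrow> (real ^ 'n \<Rightarrow> real) \<Rightarrow> real ^ 'n \<Rightarrow> real" where
  "conv f g x = (\<integral>y. f (x - y) * g y \<partial>lborel)"

(* u \<in> C([0,\<infinity>); L^1(R^N)); the time comes first: u t is the function u(.,t). *)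
definition continuous_L1 :: "(real \<Rightarrow> real ^ 'n \<Rightarrow> real) \<Rightarrow> bool" where
  "continuous_L1 u \<longleftrightarrow>
     (\<forall>t\<ge>0. u t \<in> Lp 1 lborel) \<and>
     (\<forall>t\<ge>0. ((\<lambda>s. Lp_norm 1 lborel (\<lambda>x. u s x - u t x)) \<longlongrightarrow> 0) (at t within {0..}))"

(* The solution of u_t - \<Delta>u = a \<bullet> \<nabla>(F(u)), u(0) = u0, in the class
   C([0,\<infinity>); L^1(R^N)) \<inter> L^\<infinity>(R^N \<times> (0,\<infinity>)): the equation is read in its integral form
     u(t) = G(t) * u0 + \<integral>_0^t a \<bullet> \<nabla>G(t-s) * F(u(s)) ds,   t > 0,
   as an identity between functions of x, almost everywhere.  For u in this class and F
   of class C^1, the integrals converge absolutely for every x. *)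
definition convection_diffusion_solution ::
  "real ^ 'n \<Rightarrow> (real \<Rightarrow> real) \<Rightarrow> (real ^ 'n \<Rightarrow> real) \<Rightarrow> (real \<Rightarrow> real ^ 'n \<Rightarrow> real) \<Rightarrow> bool" where
  "convection_diffusion_solution a F u0 u \<longleftrightarrow>
     continuous_L1 u \<and>
     (\<lambda>(x, t). u t x) \<in> Lp \<infinity> (restrict_space lborel (UNIV \<times> {0<..})) \<and>
     (AE x in lborel. u 0 x = u0 x) \<and>
     (\<forall>t>0. AE x in lborel.
        u t x = conv (heat_kernel t) u0 x +
          (LBINT s:{0<..<t}. conv (grad_heat_kernel a (t - s)) (\<lambda>y. F (u s y)) x))"

end

(*
  Work with the mild formulation regularised by the heat semigroup at a small time \<epsilon>.  For a smooth
  entropy \<Phi>, the convection term does not contribute to the evolution of the integral of \<Phi>(u) up to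
  errors that vanish with the time step and \<epsilon>, because \<Phi>''(w) F(w) (a \<bullet> \<nabla>w) is an exact derivative.
  Hence the integral of \<Phi>(u) decays at least as fast as under the heat flow alone, independently of a
  and F.  Nash's inequality, in the form of a convexity property of the norms of heat (n h) v, turns
  this into a smoothing estimate from L^m to L^(2m) whose constant does not depend on m, and Moser's
  iteration over m = 2^k gives the bound for p = \<infinity>.  The case p = 1 comes from a smooth approximation
  of the absolute value, and the remaining p by interpolation.
*)
theory Submission
  imports Defs "HOL-Probability.Probability"
begin

subsection \<open>Convolution of bounded integrable functions\<close>

text \<open>Any direct estimate of the convection term carries |a|, the Lipschitz constant
  \<open>L\<close> and the bound \<open>M\<close>, while the constant must be free of them; so these
  may occur only in errors that tend to 0. The solution class offers no time derivative and no
  spatial smoothness, hence an entropy is not differentiated along u: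
  \<open>heat \<epsilon> (u t)\<close> is compared over a time step h with the pure heat flow.
  Taylor's formula leaves two errors. The quadratic one is of order h^(3/2) for fixed \<epsilon>,
  against about 1/h steps. In the linear one the source is replaced by F of the heat flow, which
  makes the exact derivative appear; the replacement error is small in L^2 but multiplied by a
  gradient, which is not small. The loss of squared L^2 norm in one heat step
  (\<open>heat_defect\<close>) controls h times the squared gradient, and its sum over all steps is
  bounded by the same step inequality for the quadratic entropy. The defect also replaces the
  Dirichlet integral in Nash's inequality, so no weak derivatives enter. With exponents 2^k,
  Jensen's inequality is an iterated quadratic case and the entropies of the iteration are
  polynomials.\<close>

lemma lborel_distr_reflect: "distr lborel borel (\<lambda>x. a - x) = (lborel :: 'a::euclidean_space measure)"
  using lborel_affine[of "-1" a] by (simp add: density_1)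

lemma integrable_reflect:
  fixes f :: "'a::euclidean_space \<Rightarrow> real"
  assumes "integrable lborel f"
  shows "integrable lborel (\<lambda>x. f (a - x))"
proof -
  have [measurable]: "f \<in> borel_measurable borel" using assms by auto
  show ?thesis
    using assms by (subst (asm) lborel_distr_reflect[of a, symmetric]) (simp add: integrable_distr_eq)
qed

lemma integral_reflect:
  fixes f :: "'a::euclidean_space \<Rightarrow> real"
  assumes [measurable]: "f \<in> borel_measurable borel"
  shows "(LBINT x. f (a - x)) = (LBINT x. f x)"
  by (subst (2) lborel_distr_reflect[of a, symmetric]) (simp add: integral_distr)

lemma integrable_translate:
  fixes f :: "'a::euclidean_space \<Rightarrow> real"
  assumes "integrable lborel f"
  shows "integrable lborel (\<lambda>x. f (x + a))"
proof -
  have [measurable]: "f \<in> borel_measurable borel" using assms by auto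
  show ?thesis
    using assms by (subst (asm) lborel_distr_plus[of a, symmetric]) (simp add: integrable_distr_eq add.commute)
qed

lemma integral_translate:
  fixes f :: "'a::euclidean_space \<Rightarrow> real"
  assumes [measurable]: "f \<in> borel_measurable borel"
  shows "(LBINT x. f (x + a)) = (LBINT x. f x)"
  by (subst (2) lborel_distr_plus[of a, symmetric]) (simp add: integral_distr add.commute)

lemma nn_integral_translate:
  fixes f :: "'a::euclidean_space \<Rightarrow> ennreal"
  assumes [measurable]: "f \<in> borel_measurable borel"
  shows "(\<integral>\<^sup>+x. f (x + a) \<partial>lborel) = (\<integral>\<^sup>+x. f x \<partial>lborel)"
  by (subst (2) lborel_distr_plus[of a, symmetric]) (simp add: nn_integral_distr add.commute)

text \<open>L^1 and L^\<infinity> together, with the bound at every point rather than almost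
  everywhere, so that convolutions, products and powers are integrable without exceptional sets. The
  kernels at positive times and all regularised functions belong to this class.\<close>

definition bdd_integrable :: "('a::euclidean_space \<Rightarrow> real) \<Rightarrow> bool" where
  "bdd_integrable f \<longleftrightarrow> integrable lborel f \<and> (\<exists>B. \<forall>x. \<bar>f x\<bar> \<le> B)"

lemma bdd_integrableD:
  assumes "bdd_integrable f"
  shows "integrable lborel f" "f \<in> borel_measurable borel"
  using assms by (auto simp: bdd_integrable_def)

lemma bdd_integrable_bound:
  assumes "bdd_integrable f"
  obtains B where "0 \<le> B" "\<And>x. \<bar>f x\<bar> \<le> B"
proof -
  from assms obtain B where "\<And>x. \<bar>f x\<bar> \<le> B" by (auto simp: bdd_integrable_def)
  then show ?thesis using that[of "\<bar>B\<bar>"] by (meson abs_ge_self abs_ge_zero order_trans)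
qed

lemma bdd_integrable_dominated:
  assumes f: "bdd_integrable f" and g: "g \<in> borel_measurable borel"
    and le: "\<And>x. \<bar>g x\<bar> \<le> c * \<bar>f x\<bar>"
  shows "bdd_integrable g"
proof -
  obtain B where B: "\<And>x. \<bar>f x\<bar> \<le> B" using f by (rule bdd_integrable_bound) auto
  have "\<bar>g x\<bar> \<le> \<bar>c\<bar> * B" for x
    using le[of x] B[of x]
    by (meson abs_ge_self abs_ge_zero mult_mono order_trans)
  moreover have "integrable lborel g"
    by (rule Bochner_Integration.integrable_bound[of _ "\<lambda>x. c * \<bar>f x\<bar>"])
      (use f g le in \<open>auto simp: bdd_integrable_def intro!: AE_I2 order_trans[OF le]\<close>)
  ultimately show ?thesis by (auto simp: bdd_integrable_def)
qed

lemma integrable_mult_bounded: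
  fixes f g :: "'a::euclidean_space \<Rightarrow> real"
  assumes f: "integrable lborel f" and g: "g \<in> borel_measurable borel" and B: "\<And>x. \<bar>g x\<bar> \<le> B"
  shows "integrable lborel (\<lambda>x. g x * f x)"
  by (rule Bochner_Integration.integrable_bound[of _ "\<lambda>x. B * \<bar>f x\<bar>"])
    (use f g B in \<open>auto simp: abs_mult intro!: AE_I2 mult_right_mono order_trans[OF B]\<close>)

lemma bdd_integrable_mult_bounded:
  assumes f: "bdd_integrable f" and g: "g \<in> borel_measurable borel" and B: "\<And>x. \<bar>g x\<bar> \<le> B"
  shows "bdd_integrable (\<lambda>x. g x * f x)"
  by (rule bdd_integrable_dominated[OF f, of _ B])
    (use bdd_integrableD[OF f] g B in \<open>auto simp: abs_mult intro!: mult_right_mono\<close>)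

lemma bdd_integrable_add [intro]:
  assumes "bdd_integrable f" "bdd_integrable g"
  shows "bdd_integrable (\<lambda>x. f x + g x)"
proof -
  obtain A B where "\<And>x. \<bar>f x\<bar> \<le> A" "\<And>x. \<bar>g x\<bar> \<le> B"
    using assms by (auto simp: bdd_integrable_def)
  then have "\<bar>f x + g x\<bar> \<le> A + B" for x by (meson abs_triangle_ineq add_mono order_trans)
  with assms show ?thesis by (auto simp: bdd_integrable_def)
qed

lemma bdd_integrable_cmult [intro]: "bdd_integrable f \<Longrightarrow> bdd_integrable (\<lambda>x. c * f x)"
  by (rule bdd_integrable_dominated[of f _ "\<bar>c\<bar>"]) (auto simp: abs_mult dest: bdd_integrableD)

lemma bdd_integrable_diff [intro]:
  "bdd_integrable f \<Longrightarrow> bdd_integrable g \<Longrightarrow> bdd_integrable (\<lambda>x. f x - g x)"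
  using bdd_integrable_add[of f "\<lambda>x. - 1 * g x"] bdd_integrable_cmult[of g "-1"] by simp

lemma bdd_integrable_abs [intro]: "bdd_integrable f \<Longrightarrow> bdd_integrable (\<lambda>x. \<bar>f x\<bar>)"
  by (rule bdd_integrable_dominated[of f _ 1]) (auto dest: bdd_integrableD)

lemma bdd_integrable_mult [intro]:
  assumes "bdd_integrable f" "bdd_integrable g"
  shows "bdd_integrable (\<lambda>x. f x * g x)"
  using assms(1) by (rule bdd_integrable_bound)
    (use assms bdd_integrable_mult_bounded[of g f] bdd_integrableD[of f] in auto)

lemma bdd_integrable_power [intro]:
  assumes "bdd_integrable f" "0 < m"
  shows "bdd_integrable (\<lambda>x. f x ^ m)"
  using assms(2)
proof (induction m rule: nat_induct_non_zero)
  case (Suc n)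
  then show ?case using bdd_integrable_mult[OF assms(1), of "\<lambda>x. f x ^ n"] by simp
qed (use assms in auto)

lemma bdd_integrable_reflect: "bdd_integrable f \<Longrightarrow> bdd_integrable (\<lambda>x. f (a - x))"
  by (auto simp: bdd_integrable_def intro: integrable_reflect)

text \<open>Tonelli with x integrated first: translation invariance leaves the product of the two
  L^1 norms. The Fubini arguments for convolutions rest on this.\<close>

lemma integrable_conv_prod:
  fixes k f :: "real^'n \<Rightarrow> real"
  assumes k: "integrable lborel k" and f: "integrable lborel f"
  shows "integrable (lborel \<Otimes>\<^sub>M lborel) (\<lambda>(x, y). k (x - y) * f y)"
proof (rule integrableI_bounded)
  have [measurable]: "k \<in> borel_measurable borel" "f \<in> borel_measurable borel"
    using k f by auto
  show "(\<lambda>(x, y). k (x - y) * f y) \<in> borel_measurable (lborel \<Otimes>\<^sub>M lborel)"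
    by (simp add: split_beta')
  have "(\<integral>\<^sup>+p. ennreal (norm (case p of (x, y) \<Rightarrow> k (x - y) * f y)) \<partial>(lborel \<Otimes>\<^sub>M lborel))
      = (\<integral>\<^sup>+y. \<integral>\<^sup>+x. ennreal \<bar>k (x - y)\<bar> * ennreal \<bar>f y\<bar> \<partial>lborel \<partial>lborel)"
    by (subst lborel_pair.nn_integral_snd[symmetric]) (simp_all add: abs_mult ennreal_mult split_beta')
  also have "\<dots> = (\<integral>\<^sup>+y. (\<integral>\<^sup>+x. ennreal \<bar>k x\<bar> \<partial>lborel) * ennreal \<bar>f y\<bar> \<partial>lborel)"
    using nn_integral_translate[of "\<lambda>x. ennreal \<bar>k x\<bar>" "- y" for y]
    by (simp add: nn_integral_multc)
  also have "\<dots> = (\<integral>\<^sup>+x. ennreal \<bar>k x\<bar> \<partial>lborel) * (\<integral>\<^sup>+y. ennreal \<bar>f y\<bar> \<partial>lborel)"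
    by (simp add: nn_integral_cmult)
  also have "\<dots> < \<infinity>"
    using k f by (auto simp: integrable_iff_bounded ennreal_mult_less_top)
  finally show "(\<integral>\<^sup>+p. ennreal (norm (case p of (x, y) \<Rightarrow> k (x - y) * f y)) \<partial>(lborel \<Otimes>\<^sub>M lborel)) < \<infinity>" .
qed

lemma conv_measurable [measurable]:
  assumes [measurable]: "k \<in> borel_measurable borel" "f \<in> borel_measurable borel"
  shows "conv k f \<in> borel_measurable borel"
  unfolding conv_def by measurable

lemma integrable_conv:
  assumes "integrable lborel k" "integrable lborel f"
  shows "integrable lborel (conv k f)"
  using lborel_pair.integrable_fst'[OF integrable_conv_prod[OF assms]]
  by (simp add: conv_def[abs_def])

lemma conv_integrable:
  assumes k: "bdd_integrable k" and f: "integrable lborel f"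
  shows "integrable lborel (\<lambda>y. k (x - y) * f y)"
proof -
  obtain B where "\<And>y. \<bar>k y\<bar> \<le> B" using k by (rule bdd_integrable_bound) auto
  then show ?thesis
    by (intro integrable_mult_bounded[OF f, of _ B]) (use bdd_integrableD[OF k] in auto)
qed

lemma conv_add:
  assumes "bdd_integrable k" "integrable lborel f" "integrable lborel g"
  shows "conv k (\<lambda>y. f y + g y) x = conv k f x + conv k g x"
  unfolding conv_def
  by (subst Bochner_Integration.integral_add[symmetric])
    (use assms in \<open>auto intro!: conv_integrable simp: distrib_left\<close>)

lemma conv_abs_le:
  assumes k: "bdd_integrable k" and f: "integrable lborel f" and B: "\<And>y. \<bar>k y\<bar> \<le> B"
  shows "\<bar>conv k f x\<bar> \<le> B * (LBINT y. \<bar>f y\<bar>)"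
proof -
  have "\<bar>conv k f x\<bar> \<le> (LBINT y. \<bar>k (x - y) * f y\<bar>)"
    unfolding conv_def by (rule integral_abs_bound)
  also have "\<dots> \<le> (LBINT y. B * \<bar>f y\<bar>)"
    by (rule integral_mono) (use B f integrable_abs[OF conv_integrable[OF k f], of x] in \<open>auto simp: abs_mult intro: mult_right_mono\<close>)
  finally show ?thesis by simp
qed

lemma conv_abs_le_sup:
  assumes k: "bdd_integrable k" and f: "integrable lborel f" and B: "\<And>y. \<bar>f y\<bar> \<le> B"
  shows "\<bar>conv k f x\<bar> \<le> B * (LBINT y. \<bar>k y\<bar>)"
proof -
  have [measurable]: "k \<in> borel_measurable borel" using bdd_integrableD[OF k] by auto
  have i: "integrable lborel (\<lambda>y. \<bar>k (x - y)\<bar>)"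
    using bdd_integrable_reflect[OF k, of x] by (auto dest: bdd_integrableD)
  have "\<bar>conv k f x\<bar> \<le> (LBINT y. \<bar>k (x - y) * f y\<bar>)"
    unfolding conv_def by (rule integral_abs_bound)
  also have "\<dots> \<le> (LBINT y. B * \<bar>k (x - y)\<bar>)"
    by (rule integral_mono)
      (use B i integrable_abs[OF conv_integrable[OF k f], of x] in \<open>auto simp: abs_mult mult.commute[of B] intro: mult_left_mono\<close>)
  also have "\<dots> = B * (LBINT y. \<bar>k y\<bar>)"
    using integral_reflect[of "\<lambda>y. \<bar>k y\<bar>" x] by simp
  finally show ?thesis .
qed

lemma conv_abs_le_conv:
  assumes k: "bdd_integrable k" and l: "bdd_integrable l"
    and f: "integrable lborel f" and g: "integrable lborel g"
    and "\<And>y. \<bar>k y\<bar> \<le> l y" "\<And>y. \<bar>f y\<bar> \<le> g y"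
  shows "\<bar>conv k f x\<bar> \<le> conv l g x"
proof -
  have "\<bar>conv k f x\<bar> \<le> (LBINT y. \<bar>k (x - y) * f y\<bar>)"
    unfolding conv_def by (rule integral_abs_bound)
  also have "\<dots> \<le> (LBINT y. l (x - y) * g y)"
  proof (rule integral_mono)
    show "\<bar>k (x - y) * f y\<bar> \<le> l (x - y) * g y" for y
      unfolding abs_mult by (rule mult_mono) (use assms(5)[of "x - y"] assms(6)[of y] in auto)
  qed (use conv_integrable[OF k f] conv_integrable[OF l g] in auto)
  finally show ?thesis by (simp add: conv_def)
qed

lemma bdd_integrable_conv [intro]:
  assumes k: "bdd_integrable k" and f: "integrable lborel f"
  shows "bdd_integrable (conv k f)"
proof -
  obtain B where B: "\<And>y. \<bar>k y\<bar> \<le> B" using k by (rule bdd_integrable_bound) auto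
  show ?thesis
    unfolding bdd_integrable_def
    using integrable_conv[OF bdd_integrableD(1)[OF k] f] conv_abs_le[OF k f B] by blast
qed

lemma integral_conv:
  fixes k f :: "real^'n \<Rightarrow> real"
  assumes k: "integrable lborel k" and f: "integrable lborel f"
  shows "(LBINT x. conv k f x) = (LBINT x. k x) * (LBINT x. f x)"
proof -
  have [measurable]: "k \<in> borel_measurable borel" using k by auto
  have "(LBINT x. conv k f x) = (LBINT y. (LBINT x. k (x - y) * f y))"
    unfolding conv_def using lborel_pair.Fubini_integral[OF integrable_conv_prod[OF k f]] by simp
  also have "\<dots> = (LBINT y. (LBINT x. k x) * f y)"
    using integral_translate[of k "- y" for y] by simp
  finally show ?thesis by simp
qed

lemma integral_conv_abs_le:
  fixes k f :: "real^'n \<Rightarrow> real"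
  assumes k: "bdd_integrable k" and f: "integrable lborel f"
  shows "(LBINT x. \<bar>conv k f x\<bar>) \<le> (LBINT x. \<bar>k x\<bar>) * (LBINT x. \<bar>f x\<bar>)"
proof -
  have "(LBINT x. \<bar>conv k f x\<bar>) \<le> (LBINT x. conv (\<lambda>x. \<bar>k x\<bar>) (\<lambda>x. \<bar>f x\<bar>) x)"
    by (rule integral_mono)
      (use k f in \<open>auto intro!: integrable_conv integrable_abs conv_abs_le_conv bdd_integrable_abs dest: bdd_integrableD\<close>)
  then show ?thesis
    using k f by (subst (asm) integral_conv) (auto dest: bdd_integrableD)
qed

text \<open>Fubini: the adjoint of convolution with k is convolution with the reflected kernel. The
  heat kernel is even, so the heat flow is self-adjoint.\<close>

lemma conv_adjoint:
  fixes k f g :: "real^'n \<Rightarrow> real"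
  assumes k: "bdd_integrable k" and f: "integrable lborel f" and g: "bdd_integrable g"
  shows "(LBINT x. g x * conv k f x) = (LBINT y. conv (\<lambda>z. k (- z)) g y * f y)"
proof -
  obtain B where B: "\<And>y. \<bar>g y\<bar> \<le> B" using g by (rule bdd_integrable_bound) auto
  have [measurable]: "k \<in> borel_measurable borel" "f \<in> borel_measurable borel" "g \<in> borel_measurable borel"
    using k f g by (auto dest: bdd_integrableD)
  have i: "integrable (lborel \<Otimes>\<^sub>M lborel) (\<lambda>(x, y). g x * (k (x - y) * f y))"
    by (rule Bochner_Integration.integrable_bound[of _ "\<lambda>(x, y). B * \<bar>k (x - y) * f y\<bar>"])
      (use integrable_abs[OF integrable_conv_prod[OF bdd_integrableD(1)[OF k] f]] B in
        \<open>auto simp: split_beta' abs_mult intro!: AE_I2 mult_right_mono order_trans[OF B]\<close>)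
  have "(LBINT x. g x * conv k f x) = (LBINT x. LBINT y. g x * (k (x - y) * f y))"
    by (simp add: conv_def)
  also have "\<dots> = (LBINT y. LBINT x. g x * (k (x - y) * f y))"
    using lborel_pair.Fubini_integral[OF i] by simp
  also have "\<dots> = (LBINT y. conv (\<lambda>z. k (- z)) g y * f y)"
    unfolding conv_def
    by (subst integral_mult_left_zero[symmetric]) (simp add: algebra_simps)
  finally show ?thesis .
qed

text \<open>Carries identities between kernels, in particular the semigroup law, over to the
  operators.\<close>

lemma conv_assoc:
  fixes k l f :: "real^'n \<Rightarrow> real"
  assumes k: "bdd_integrable k" and l: "integrable lborel l" and f: "integrable lborel f"
  shows "conv k (conv l f) x = conv (conv k l) f x"
proof -
  obtain B where B: "\<And>y. \<bar>k y\<bar> \<le> B" using k by (rule bdd_integrable_bound) auto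
  have [measurable]: "k \<in> borel_measurable borel" "f \<in> borel_measurable borel" "l \<in> borel_measurable borel"
    using k f l by (auto dest: bdd_integrableD)
  have i: "integrable (lborel \<Otimes>\<^sub>M lborel) (\<lambda>(y, z). k (x - y) * (l (y - z) * f z))"
    by (rule Bochner_Integration.integrable_bound[of _ "\<lambda>(y, z). B * \<bar>l (y - z) * f z\<bar>"])
      (use integrable_abs[OF integrable_conv_prod[OF l f]] B in
        \<open>auto simp: split_beta' abs_mult intro!: AE_I2 mult_right_mono order_trans[OF B]\<close>)
  have "conv k (conv l f) x = (LBINT y. LBINT z. k (x - y) * (l (y - z) * f z))"
    by (simp add: conv_def)
  also have "\<dots> = (LBINT z. LBINT y. k (x - y) * (l (y - z) * f z))"
    using lborel_pair.Fubini_integral[OF i] by simp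
  also have "\<dots> = (LBINT z. (LBINT y. k (x - y) * l (y - z)) * f z)"
    by (subst integral_mult_left_zero[symmetric]) (simp add: algebra_simps)
  also have "\<dots> = (LBINT z. conv k l (x - z) * f z)"
    unfolding conv_def
    using integral_translate[of "\<lambda>y. k (x - y) * l (y - z)" z for z]
    by (simp add: algebra_simps)
  finally show ?thesis by (simp add: conv_def)
qed

section \<open>Continuity and differentiation of convolutions\<close>

lemma continuous_conv:
  fixes k f :: "real^'n \<Rightarrow> real"
  assumes k: "bdd_integrable k" and c: "continuous_on UNIV k" and f: "integrable lborel f"
  shows "continuous_on UNIV (conv k f)"
proof -
  obtain B where B: "\<And>y. \<bar>k y\<bar> \<le> B" using k by (rule bdd_integrable_bound) auto
  have [measurable]: "k \<in> borel_measurable borel" "f \<in> borel_measurable borel"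
    using k f by (auto dest: bdd_integrableD)
  show ?thesis
    unfolding continuous_on_sequentially comp_def conv_def
  proof (safe)
    fix X :: "nat \<Rightarrow> real^'n" and x assume X: "X \<longlonglongrightarrow> x"
    show "(\<lambda>n. LBINT y. k (X n - y) * f y) \<longlonglongrightarrow> (LBINT y. k (x - y) * f y)"
    proof (rule integral_dominated_convergence[where w = "\<lambda>y. B * \<bar>f y\<bar>"])
      show "AE y in lborel. (\<lambda>n. k (X n - y) * f y) \<longlonglongrightarrow> k (x - y) * f y"
        by (intro AE_I2 tendsto_mult tendsto_const continuous_on_tendsto_compose[OF c] tendsto_diff X) auto
      show "AE y in lborel. norm (k (X n - y) * f y) \<le> B * \<bar>f y\<bar>" for n
        by (intro AE_I2) (use B in \<open>auto simp: abs_mult intro: mult_right_mono\<close>)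
    qed (use f in auto)
  qed
qed

text \<open>By the mean value inequality along the line, the difference quotients of k are bounded
  by the supremum of k', uniformly in h; a multiple of |f| therefore dominates and the limit passes
  under the integral.\<close>

lemma has_real_derivative_conv:
  fixes k k' f :: "real^'n \<Rightarrow> real"
  assumes k: "bdd_integrable k" and k': "bdd_integrable k'" and f: "integrable lborel f"
    and d: "\<And>x s. ((\<lambda>s. k (x + s *\<^sub>R a)) has_real_derivative k' (x + s *\<^sub>R a)) (at s)"
  shows "((\<lambda>s. conv k f (x + s *\<^sub>R a)) has_real_derivative conv k' f (x + s *\<^sub>R a)) (at s)"
proof -
  obtain B where B: "\<And>y. \<bar>k' y\<bar> \<le> B" using k' by (rule bdd_integrable_bound) auto
  have [measurable]: "k \<in> borel_measurable borel" "f \<in> borel_measurable borel" "k' \<in> borel_measurable borel"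
    using k k' f by (auto dest: bdd_integrableD)
  define q where "q h y = (k (x + (s + h) *\<^sub>R a - y) - k (x + s *\<^sub>R a - y)) / h" for h y
  have q_le: "\<bar>q h y\<bar> \<le> B" if "h \<noteq> 0" for h y
  proof -
    have "norm (k ((x - y) + (s + h) *\<^sub>R a) - k ((x - y) + s *\<^sub>R a)) \<le> B * norm ((s + h) - s)"
      by (rule field_differentiable_bound[of UNIV _ "\<lambda>s. k' ((x - y) + s *\<^sub>R a)"])
        (use d B in \<open>auto intro: has_field_derivative_at_within\<close>)
    then show ?thesis using that
      by (simp add: q_def algebra_simps divide_le_eq abs_divide)
  qed
  have q_lim: "((\<lambda>h. q h y) \<longlongrightarrow> k' (x + s *\<^sub>R a - y)) (at 0)" for y
    using d[of "x - y" s] unfolding DERIV_def q_def by (simp add: algebra_simps)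
  have quot: "(conv k f (x + (s + h) *\<^sub>R a) - conv k f (x + s *\<^sub>R a)) / h = (LBINT y. q h y * f y)" for h
    unfolding conv_def q_def
    by (subst Bochner_Integration.integral_diff[symmetric])
      (use k f in \<open>auto intro!: conv_integrable simp: left_diff_distrib simp flip: integral_divide_zero\<close>)
  have "((\<lambda>h. LBINT y. q h y * f y) \<longlongrightarrow> (LBINT y. k' (x + s *\<^sub>R a - y) * f y)) (at 0)"
    unfolding tendsto_at_iff_sequentially comp_def
  proof (safe)
    fix X :: "nat \<Rightarrow> real" assume X: "\<forall>i. X i \<in> UNIV - {0}" "X \<longlonglongrightarrow> 0"
    show "(\<lambda>n. LBINT y. q (X n) y * f y) \<longlonglongrightarrow> (LBINT y. k' (x + s *\<^sub>R a - y) * f y)"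
    proof (rule integral_dominated_convergence[where w = "\<lambda>y. B * \<bar>f y\<bar>"])
      show "AE y in lborel. (\<lambda>n. q (X n) y * f y) \<longlonglongrightarrow> k' (x + s *\<^sub>R a - y) * f y"
        using q_lim X by (intro AE_I2 tendsto_mult tendsto_const)
          (auto simp: tendsto_at_iff_sequentially comp_def)
      show "AE y in lborel. norm (q (X n) y * f y) \<le> B * \<bar>f y\<bar>" for n
        by (intro AE_I2) (use q_le X in \<open>auto simp: abs_mult intro: mult_right_mono\<close>)
    qed (use f in \<open>auto simp: q_def\<close>)
  qed
  then show ?thesis
    unfolding DERIV_def quot by (simp add: conv_def)
qed

text \<open>Translation invariance takes the place of vanishing boundary terms. Integrating k' over
  the segment from x to x + a gives k (x + a) - k x, whose integral over x is 0; exchanging the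
  integrals, each s in [0, 1] contributes the full integral of k'.\<close>

lemma integral_directional_derivative_eq_0:
  fixes k k' :: "real^'n \<Rightarrow> real"
  assumes k: "integrable lborel k" and k': "integrable lborel k'" and c: "continuous_on UNIV k'"
    and d: "\<And>x s. ((\<lambda>s. k (x + s *\<^sub>R a)) has_real_derivative k' (x + s *\<^sub>R a)) (at s)"
  shows "(LBINT x. k' x) = 0"
proof -
  have [measurable]: "k \<in> borel_measurable borel" "k' \<in> borel_measurable borel"
    using k k' by auto
  have ftc: "(LBINT s. indicator {0..1} s * k' (x + s *\<^sub>R a)) = k (x + a) - k x" for x
  proof -
    have "continuous_on {0..1} (\<lambda>s. k' (x + s *\<^sub>R a))"
      by (intro continuous_on_compose2[OF c] continuous_intros) auto
    then show ?thesis
      using integral_FTC_atLeastAtMost[of 0 1 "\<lambda>s. k (x + s *\<^sub>R a)" "\<lambda>s. k' (x + s *\<^sub>R a)"] d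
      by (simp add: has_field_derivative_at_within flip: has_real_derivative_iff_has_vector_derivative)
  qed
  have i: "integrable (lborel \<Otimes>\<^sub>M lborel) (\<lambda>(x, s). indicator {0..1} s * k' (x + s *\<^sub>R a))"
  proof (rule integrableI_bounded)
    have "(\<integral>\<^sup>+p. ennreal (norm (case p of (x, s) \<Rightarrow> indicator {0..1::real} s * k' (x + s *\<^sub>R a))) \<partial>(lborel \<Otimes>\<^sub>M lborel))
      = (\<integral>\<^sup>+s. \<integral>\<^sup>+x. indicator {0..1} s * ennreal \<bar>k' (x + s *\<^sub>R a)\<bar> \<partial>lborel \<partial>lborel)"
      by (subst lborel_pair.nn_integral_snd[symmetric])
        (auto simp: abs_mult ennreal_mult split_beta' ennreal_indicator intro!: nn_integral_cong split: split_indicator)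
    also have "\<dots> = (\<integral>\<^sup>+s. indicator {0..1::real} s * (\<integral>\<^sup>+x. ennreal \<bar>k' x\<bar> \<partial>lborel) \<partial>lborel)"
      using nn_integral_translate[of "\<lambda>x. ennreal \<bar>k' x\<bar>" "s *\<^sub>R a" for s]
      by (simp add: nn_integral_cmult)
    also have "\<dots> = (\<integral>\<^sup>+x. ennreal \<bar>k' x\<bar> \<partial>lborel)"
      by (simp add: nn_integral_multc)
    also have "\<dots> < \<infinity>"
      using k' by (auto simp: integrable_iff_bounded)
    finally show "(\<integral>\<^sup>+p. ennreal (norm (case p of (x, s) \<Rightarrow> indicator {0..1::real} s * k' (x + s *\<^sub>R a))) \<partial>(lborel \<Otimes>\<^sub>M lborel)) < \<infinity>" .
  qed (simp add: split_beta')
  have "0 = (LBINT x. k (x + a) - k x)"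
    using integral_translate[of k a] integrable_translate[OF k, of a] k by simp
  also have "\<dots> = (LBINT x. LBINT s. indicator {0..1} s * k' (x + s *\<^sub>R a))"
    by (simp add: ftc)
  also have "\<dots> = (LBINT s. LBINT x. indicator {0..1} s * k' (x + s *\<^sub>R a))"
    using lborel_pair.Fubini_integral[OF i] by simp
  also have "\<dots> = (LBINT s. indicator {0..1::real} s * (LBINT x. k' x))"
    using integral_translate[of k' "s *\<^sub>R a" for s] by simp
  also have "\<dots> = (LBINT x. k' x)" by simp
  finally show ?thesis by simp
qed

subsection \<open>The heat kernel\<close>

abbreviation heat :: "real \<Rightarrow> (real^'n \<Rightarrow> real) \<Rightarrow> real^'n \<Rightarrow> real" where
  "heat t \<equiv> conv (heat_kernel t)"

abbreviation grad_heat :: "real^'n \<Rightarrow> real \<Rightarrow> (real^'n \<Rightarrow> real) \<Rightarrow> real^'n \<Rightarrow> real" where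
  "grad_heat a t \<equiv> conv (grad_heat_kernel a t)"

lemma heat_kernel_measurable [measurable]: "heat_kernel t \<in> borel_measurable borel"
  unfolding heat_kernel_def[abs_def] by measurable

lemma heat_kernel_nonneg [simp]: "0 \<le> heat_kernel t x"
  by (simp add: heat_kernel_def)

lemma heat_kernel_minus [simp]: "heat_kernel t (- x) = heat_kernel t x"
  by (simp add: heat_kernel_def)

lemma heat_kernel_le:
  fixes x :: "real^'n"
  assumes "0 < t"
  shows "heat_kernel t x \<le> (4 * pi * t) powr (- real CARD('n) / 2)"
proof -
  have "exp (- (norm x)\<^sup>2 / (4 * t)) \<le> 1" using assms by (simp add: divide_nonpos_pos)
  then show ?thesis unfolding heat_kernel_def
    by (simp add: mult_left_le)
qed

lemma powr_minus_half: "0 < c \<Longrightarrow> (c :: real) powr (- (1 / 2)) = 1 / sqrt c"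
  using powr_minus[of c "1 / 2"] powr_half_sqrt[of c] by (metis divide_inverse mult_1 less_imp_le)

text \<open>The kernel is the centred Gaussian of variance 2 t in each coordinate, which reduces its
  total mass to the one-dimensional integral.\<close>

lemma heat_kernel_eq_prod:
  fixes x :: "real^'n"
  assumes t: "0 < t"
  shows "heat_kernel t x = (\<Prod>b\<in>Basis. normal_density 0 (sqrt (2 * t)) (x \<bullet> b))"
proof -
  have s: "(norm x)\<^sup>2 = (\<Sum>b\<in>Basis. (x \<bullet> b)\<^sup>2)"
    unfolding power2_norm_eq_inner by (subst euclidean_inner) (simp add: power2_eq_square)
  have "(1 / sqrt c) ^ k = c powr (- real k / 2)" if "0 < c" for c :: real and k
  proof -
    have "1 / sqrt c = c powr (- (1 / 2))"
      using powr_minus_half[OF that] by (rule sym)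
    moreover have "(c powr (- (1 / 2))) ^ k = c powr (- real k / 2)"
      using that by (subst powr_power) auto
    ultimately show ?thesis by (simp only:)
  qed
  from this[of "4 * pi * t" "CARD('n)"]
  have "(1 / sqrt (4 * pi * t)) ^ CARD('n) = (4 * pi * t) powr (- real CARD('n) / 2)"
    using t by simp
  moreover have "normal_density 0 (sqrt (2 * t)) y = 1 / sqrt (4 * pi * t) * exp (- y\<^sup>2 / (4 * t))" for y
    using t by (simp add: normal_density_def mult.left_commute[of pi])
  moreover have "(\<Sum>b\<in>Basis. - (x \<bullet> b)\<^sup>2 / (4 * t)) = - (norm x)\<^sup>2 / (4 * t)"
    by (simp add: s sum_negf sum_divide_distrib)
  ultimately show ?thesis
    by (simp only: heat_kernel_def prod.distrib finite_Basis flip: exp_sum) simp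
qed

lemma nn_integral_heat_kernel:
  assumes t: "0 < t"
  shows "(\<integral>\<^sup>+x. ennreal (heat_kernel t (x :: real^'n)) \<partial>lborel) = 1"
proof -
  have 1: "(\<integral>\<^sup>+x. ennreal (normal_density 0 (sqrt (2 * t)) x) \<partial>lborel) = 1"
    using t by (subst nn_integral_eq_integral) (auto simp: integral_normal_density)
  have "(\<integral>\<^sup>+x. ennreal (heat_kernel t (x :: real^'n)) \<partial>lborel) =
      (\<integral>\<^sup>+x. (\<Prod>b\<in>Basis. ennreal (normal_density 0 (sqrt (2 * t)) ((x :: real^'n) \<bullet> b))) \<partial>lborel)"
    using t by (simp add: heat_kernel_eq_prod prod_ennreal)
  also have "\<dots> = 1"
    by (subst nn_integral_lborel_prod) (simp_all add: 1)
  finally show ?thesis .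
qed

lemma bdd_integrable_heat_kernel [simp, intro]:
  assumes t: "0 < t"
  shows "bdd_integrable (heat_kernel t :: real^'n \<Rightarrow> real)"
  unfolding bdd_integrable_def
proof
  show "integrable lborel (heat_kernel t :: real^'n \<Rightarrow> real)"
    by (rule integrableI_bounded) (auto simp: nn_integral_heat_kernel[OF t])
  show "\<exists>B. \<forall>x :: real^'n. \<bar>heat_kernel t x\<bar> \<le> B"
    using heat_kernel_le[OF t] by auto
qed

lemma integral_heat_kernel [simp]:
  "0 < t \<Longrightarrow> (LBINT x. heat_kernel t (x :: real^'n)) = 1"
  using nn_integral_heat_kernel[of t, where 'n = 'n] by (subst integral_eq_nn_integral) auto

text \<open>Completing the square in y: the product is a Gaussian in y centred at t / (s + t) times
  x, with a factor that does not depend on y. Integrating it gives the semigroup law; integrating it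
  against a linear function gives the law for the gradient kernel.\<close>

lemma heat_kernel_mult:
  fixes x y :: "real^'n"
  assumes s: "0 < s" and t: "0 < t"
  shows "heat_kernel s (x - y) * heat_kernel t y =
    heat_kernel (s + t) x * heat_kernel (s * t / (s + t)) (y - (t / (s + t)) *\<^sub>R x)"
proof -
  define p where "p = - real CARD('n) / 2"
  have c: "(4 * pi * s) powr p * (4 * pi * t) powr p =
      (4 * pi * (s + t)) powr p * (4 * pi * (s * t / (s + t))) powr p"
  proof -
    have "s + t \<noteq> 0" using s t by simp
    then have "(4 * pi * s) * (4 * pi * t) = (4 * pi * (s + t)) * (4 * pi * (s * t / (s + t)))"
      by simp
    then show ?thesis using s t by (simp only: powr_mult[symmetric])
  qed
  have e: "- (norm (x - y))\<^sup>2 / (4 * s) + - (norm y)\<^sup>2 / (4 * t) =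
      - (norm x)\<^sup>2 / (4 * (s + t)) + - (norm (y - (t / (s + t)) *\<^sub>R x))\<^sup>2 / (4 * (s * t / (s + t)))"
    using s t
    unfolding power2_norm_eq_inner inner_diff_left inner_diff_right inner_scaleR_left inner_scaleR_right inner_commute[of y x]
    by (simp add: divide_simps) (simp add: algebra_simps power2_eq_square)
  show ?thesis
    unfolding heat_kernel_def p_def[symmetric]
    using arg_cong2[OF c arg_cong[OF e, of exp, unfolded exp_add], of "(*)"] by (simp only: mult_ac)
qed

lemma heat_heat_kernel:
  assumes s: "0 < s" and t: "0 < t"
  shows "heat s (heat_kernel t) = (heat_kernel (s + t) :: real^'n \<Rightarrow> real)"
proof
  fix x :: "real^'n"
  have p: "0 < s * t / (s + t)" using s t by simp
  show "heat s (heat_kernel t) x = heat_kernel (s + t) x"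
    using integral_translate[of "heat_kernel (s * t / (s + t))" "- ((t / (s + t)) *\<^sub>R x)"] p
    by (simp add: conv_def heat_kernel_mult[OF s t])
qed

lemma heat_heat:
  assumes "0 < s" "0 < t" "integrable lborel f"
  shows "heat s (heat t f) = heat (s + t) f"
  using assms by (auto simp: conv_assoc heat_heat_kernel bdd_integrableD(1) fun_eq_iff)

section \<open>The directional derivative of the heat kernel\<close>

lemma heat_kernel_has_derivative:
  fixes x :: "real^'n"
  assumes t: "0 < t"
  shows "(heat_kernel t has_derivative (\<lambda>h. - (h \<bullet> x) / (2 * t) * heat_kernel t x)) (at x)"
proof -
  have "((\<lambda>x. (- 1 / (4 * t)) * (x \<bullet> x)) has_derivative (\<lambda>h. (- 1 / (4 * t)) * (x \<bullet> h + h \<bullet> x))) (at x)"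
    by (intro has_derivative_mult_right has_derivative_inner has_derivative_ident)
  also have "(\<lambda>h. (- 1 / (4 * t)) * (x \<bullet> h + h \<bullet> x)) = (\<lambda>h. - (h \<bullet> x) / (2 * t))"
    using t by (auto simp: fun_eq_iff inner_commute[of x])
  finally have "((\<lambda>x. - (x \<bullet> x) / (4 * t)) has_derivative (\<lambda>h. - (h \<bullet> x) / (2 * t))) (at x)"
    by simp
  from has_derivative_mult_right[OF has_derivative_exp[OF this], of "(4 * pi * t) powr (- real CARD('n) / 2)"]
  show ?thesis
    unfolding heat_kernel_def[abs_def] power2_norm_eq_inner by (rule has_derivative_eq_rhs) (simp add: mult_ac)
qed

lemma grad_heat_kernel_eq:
  "0 < t \<Longrightarrow> grad_heat_kernel a t x = - (a \<bullet> x) / (2 * t) * heat_kernel t x"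
  unfolding grad_heat_kernel_def
  using frechet_derivative_at[OF heat_kernel_has_derivative[of t x]] by metis

lemma heat_kernel_has_real_derivative:
  assumes t: "0 < t"
  shows "((\<lambda>s. heat_kernel t (x + s *\<^sub>R a)) has_real_derivative grad_heat_kernel a t (x + s *\<^sub>R a)) (at s)"
proof -
  have "((\<lambda>s. heat_kernel t (x + s *\<^sub>R a)) has_derivative
      (\<lambda>h. - ((h *\<^sub>R a) \<bullet> (x + s *\<^sub>R a)) / (2 * t) * heat_kernel t (x + s *\<^sub>R a))) (at s)"
    by (rule has_derivative_compose[of "\<lambda>s. x + s *\<^sub>R a" "\<lambda>h. h *\<^sub>R a" s UNIV, OF _ heat_kernel_has_derivative[OF t]])
      (auto intro!: derivative_eq_intros)
  then show ?thesis
    by (rule has_derivative_imp_has_field_derivative) (simp add: grad_heat_kernel_eq[OF t])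
qed

lemma grad_heat_kernel_measurable [measurable]:
  assumes "0 < t"
  shows "grad_heat_kernel a t \<in> borel_measurable borel"
proof -
  have "grad_heat_kernel a t = (\<lambda>x. - (a \<bullet> x) / (2 * t) * heat_kernel t x)"
    using assms by (simp add: grad_heat_kernel_eq fun_eq_iff)
  then show ?thesis by simp
qed

lemma continuous_heat_kernel: "0 < t \<Longrightarrow> continuous_on UNIV (heat_kernel t)"
  by (intro continuous_at_imp_continuous_on ballI has_derivative_continuous[OF heat_kernel_has_derivative])

lemma continuous_grad_heat_kernel: "0 < t \<Longrightarrow> continuous_on UNIV (grad_heat_kernel a t)"
  by (subst continuous_on_cong[OF refl grad_heat_kernel_eq])
    (auto intro!: continuous_intros continuous_heat_kernel)

text \<open>Half of the Gaussian exponent absorbs the linear factor: with z = |x| / sqrt t, z/2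
  exp(-z^2/4) \<le> exp(-z^2/8). What remains is the heat kernel at time 2 t, and the change of
  normalisation produces 2^(N/2). All bounds for the gradient of the heat flow, with their
  singularity 1 / sqrt t, come from this domination.\<close>

lemma grad_heat_kernel_bound:
  fixes x :: "real^'n"
  assumes t: "0 < t"
  shows "\<bar>grad_heat_kernel a t x\<bar> \<le> 2 powr (real CARD('n) / 2) * norm a / sqrt t * heat_kernel (2 * t) x"
proof -
  define z where "z = norm x / sqrt t"
  have z: "0 \<le> z" "norm x = z * sqrt t" "(norm x)\<^sup>2 = z\<^sup>2 * t"
    using t by (auto simp: z_def power_divide)
  have "0 \<le> (z - 2)\<^sup>2" by simp
  then have "z / 2 \<le> 1 + z\<^sup>2 / 8" by (simp add: power2_eq_square algebra_simps)
  also have "\<dots> \<le> exp (z\<^sup>2 / 8)" by (rule exp_ge_add_one_self)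
  finally have "z / 2 * exp (- (z\<^sup>2 / 8)) \<le> 1" by (simp add: exp_minus field_simps)
  then have "z / 2 * exp (- (z\<^sup>2 / 8)) * exp (- (z\<^sup>2 / 8)) \<le> exp (- (z\<^sup>2 / 8))"
    by (simp add: mult_left_le_one_le)
  moreover have "exp (- (z\<^sup>2 / 8)) * exp (- (z\<^sup>2 / 8)) = exp (- (z\<^sup>2 / 4))"
    by (simp flip: exp_add)
  ultimately have e: "z / 2 * exp (- (z\<^sup>2 / 4)) \<le> exp (- (z\<^sup>2 / 8))"
    by (simp add: mult.assoc)
  have p: "(4 * pi * t) powr (- real CARD('n) / 2) =
      2 powr (real CARD('n) / 2) * (4 * pi * (2 * t)) powr (- real CARD('n) / 2)"
  proof -
    have "(4 * pi * (2 * t)) powr (- real CARD('n) / 2) =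
        2 powr (- (real CARD('n) / 2)) * (4 * pi * t) powr (- real CARD('n) / 2)"
      using t powr_mult[of 2 "4 * pi * t" "- real CARD('n) / 2"] by (simp add: mult_ac)
    then show ?thesis
      using powr_add[of 2 "real CARD('n) / 2" "- (real CARD('n) / 2)"] by (simp flip: mult.assoc)
  qed
  have "\<bar>grad_heat_kernel a t x\<bar> \<le> norm a * norm x / (2 * t) * heat_kernel t x"
    using t Cauchy_Schwarz_ineq2[of a x]
    by (auto simp: grad_heat_kernel_eq abs_mult intro!: mult_right_mono divide_right_mono)
  also have "\<dots> = norm a / sqrt t * (4 * pi * t) powr (- real CARD('n) / 2) * (z / 2 * exp (- (z\<^sup>2 / 4)))"
    using t real_sqrt_mult_self[of t] unfolding heat_kernel_def z(3) unfolding z(2) by (simp add: field_simps)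
  also have "\<dots> \<le> norm a / sqrt t * (4 * pi * t) powr (- real CARD('n) / 2) * exp (- (z\<^sup>2 / 8))"
    by (rule mult_left_mono[OF e]) (use t in auto)
  also have "\<dots> = 2 powr (real CARD('n) / 2) * norm a / sqrt t * heat_kernel (2 * t) x"
    unfolding p heat_kernel_def z(3) using t by simp
  finally show ?thesis .
qed

lemma bdd_integrable_grad_heat_kernel [simp, intro]:
  "0 < t \<Longrightarrow> bdd_integrable (grad_heat_kernel a t)"
  by (rule bdd_integrable_dominated[OF bdd_integrable_heat_kernel[of "2 * t"]])
    (auto intro: order_trans[OF grad_heat_kernel_bound])

lemma grad_heat_kernel_minus: "0 < t \<Longrightarrow> grad_heat_kernel a t (- x) = - grad_heat_kernel a t x"
  by (simp add: grad_heat_kernel_eq)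

lemma integral_grad_heat_kernel [simp]:
  assumes t: "0 < t"
  shows "(LBINT x. grad_heat_kernel a t x) = 0"
  using integral_reflect[of "grad_heat_kernel a t" 0] t by (simp add: grad_heat_kernel_minus)

text \<open>The integrand is a linear function times a Gaussian centred at
  \<open>c *\<^sub>R x\<close>. After recentring, the odd part integrates to 0 and the linear
  function evaluated at the centre remains.\<close>

lemma heat_grad_heat_kernel:
  fixes a :: "real^'n"
  assumes s: "0 < s" and t: "0 < t"
  shows "heat s (grad_heat_kernel a t) = grad_heat_kernel a (s + t)"
proof
  fix x :: "real^'n"
  define p where "p = s * t / (s + t)"
  have p: "0 < p" using s t by (simp add: p_def)
  define c where "c = t / (s + t)"
  let ?i = "\<lambda>y. heat_kernel (s + t) x * heat_kernel p (y + - (c *\<^sub>R x))"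
  have "heat s (grad_heat_kernel a t) x = (LBINT y. - (a \<bullet> y) / (2 * t) * ?i y)"
    using heat_kernel_mult[OF s t, of x] unfolding conv_def grad_heat_kernel_eq[OF t] p_def c_def
    by (intro Bochner_Integration.integral_cong) (auto simp: algebra_simps)
  also have "\<dots> = (LBINT y. - (a \<bullet> (y + c *\<^sub>R x)) / (2 * t) * ?i (y + c *\<^sub>R x))"
    by (rule integral_translate[symmetric]) measurable
  also have "\<dots> = (LBINT y. heat_kernel (s + t) x * (p / t) * grad_heat_kernel a p y
      - (a \<bullet> (c *\<^sub>R x)) / (2 * t) * heat_kernel (s + t) x * heat_kernel p y)"
    using p t by (intro Bochner_Integration.integral_cong)
      (auto simp: grad_heat_kernel_eq field_simps inner_add_right)
  also have "\<dots> = - (a \<bullet> (c *\<^sub>R x)) / (2 * t) * heat_kernel (s + t) x"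
    using p bdd_integrableD(1)[OF bdd_integrable_grad_heat_kernel[OF p, of a]]
      bdd_integrableD(1)[OF bdd_integrable_heat_kernel[OF p, where 'n = 'n]]
    by (subst Bochner_Integration.integral_diff) (auto intro!: integrable_mult_right simp del: integrable_mult_right_iff)
  also have "\<dots> = grad_heat_kernel a (s + t) x"
    using s t by (simp add: grad_heat_kernel_eq c_def)
  finally show "heat s (grad_heat_kernel a t) x = grad_heat_kernel a (s + t) x" .
qed

lemma heat_grad_heat:
  assumes "0 < s" "0 < t" "integrable lborel f"
  shows "heat s (grad_heat a t f) = grad_heat a (s + t) f"
  using assms by (auto simp: conv_assoc heat_grad_heat_kernel bdd_integrableD(1) fun_eq_iff)

subsection \<open>The heat semigroup\<close>

lemma bdd_integrable_heat [simp, intro]: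
  "0 < t \<Longrightarrow> integrable lborel f \<Longrightarrow> bdd_integrable (heat t f)"
  by (rule bdd_integrable_conv) auto

lemma bdd_integrable_grad_heat [simp, intro]:
  "0 < t \<Longrightarrow> integrable lborel f \<Longrightarrow> bdd_integrable (grad_heat a t f)"
  by (rule bdd_integrable_conv) auto

lemma heat_abs_le:
  "0 < t \<Longrightarrow> integrable lborel f \<Longrightarrow> (\<And>y. \<bar>f y\<bar> \<le> B) \<Longrightarrow> \<bar>heat t f x\<bar> \<le> B"
  using conv_abs_le_sup[of "heat_kernel t" f B x] by simp

lemma heat_abs_le_heat_abs:
  "0 < t \<Longrightarrow> integrable lborel f \<Longrightarrow> \<bar>heat t f x\<bar> \<le> heat t (\<lambda>y. \<bar>f y\<bar>) x"
  by (rule conv_abs_le_conv) auto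

lemma heat_const: "0 < t \<Longrightarrow> heat t (\<lambda>_. c) x = c"
  using integral_reflect[of "heat_kernel t" x] by (simp add: conv_def)

lemma integral_heat:
  "0 < t \<Longrightarrow> integrable lborel f \<Longrightarrow> (LBINT x. heat t f x) = (LBINT x. f x)"
  by (subst integral_conv) (auto intro!: bdd_integrableD(1))

lemma integral_heat_abs_le:
  "0 < t \<Longrightarrow> integrable lborel f \<Longrightarrow> (LBINT x. \<bar>heat t f x\<bar>) \<le> (LBINT x. \<bar>f x\<bar>)"
  using integral_conv_abs_le[of "heat_kernel t" f] by simp

lemma heat_abs_le_L1:
  fixes x :: "real^'n"
  assumes "0 < t" "integrable lborel f"
  shows "\<bar>heat t f x\<bar> \<le> (4 * pi * t) powr (- real CARD('n) / 2) * (LBINT y. \<bar>f y\<bar>)"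
  using assms heat_kernel_le by (intro conv_abs_le) auto

lemma heat_adjoint:
  assumes "0 < t" "integrable lborel f" "bdd_integrable g"
  shows "(LBINT x. g x * heat t f x) = (LBINT x. heat t g x * f x)"
  using conv_adjoint[of "heat_kernel t" f g] assms by simp

text \<open>Jensen's inequality: integrate the supporting line at \<open>heat t f x\<close> against the kernel.\<close>

lemma heat_jensen:
  assumes t: "0 < t" and f: "integrable lborel f" and \<Phi>f: "integrable lborel (\<lambda>y. \<Phi> (f y))"
    and supp: "\<And>y. \<Phi> (heat t f x) + d * (y - heat t f x) \<le> \<Phi> y"
  shows "\<Phi> (heat t f x) \<le> heat t (\<lambda>y. \<Phi> (f y)) x"
proof -
  have k: "integrable lborel (\<lambda>y. heat_kernel t (x - y))"
    using bdd_integrable_reflect[OF bdd_integrable_heat_kernel[OF t], of x] by (rule bdd_integrableD)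
  have k1: "(LBINT y. heat_kernel t (x - y)) = 1"
    using heat_const[OF t, of 1 x] by (simp add: conv_def)
  have i: "integrable lborel (\<lambda>y. heat_kernel t (x - y) * f y)"
      "integrable lborel (\<lambda>y. heat_kernel t (x - y) * \<Phi> (f y))"
    using t f \<Phi>f by (auto intro: conv_integrable)
  define c where "c = heat t f x"
  have "\<Phi> c = (\<Phi> c - d * c) * (LBINT y. heat_kernel t (x - y)) + d * (LBINT y. heat_kernel t (x - y) * f y)"
    unfolding k1 by (simp add: c_def conv_def algebra_simps)
  also have "\<dots> = (LBINT y. (\<Phi> c - d * c) * heat_kernel t (x - y) + d * (heat_kernel t (x - y) * f y))"
    using k i by simp
  also have "\<dots> \<le> (LBINT y. heat_kernel t (x - y) * \<Phi> (f y))"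
  proof (rule integral_mono)
    show "(\<Phi> c - d * c) * heat_kernel t (x - y) + d * (heat_kernel t (x - y) * f y) \<le> heat_kernel t (x - y) * \<Phi> (f y)" for y
      using mult_left_mono[OF supp[of "f y"], of "heat_kernel t (x - y)"] by (simp add: c_def algebra_simps)
  qed (use k i in auto)
  finally show ?thesis by (simp add: c_def conv_def)
qed

lemma heat_jensen_square:
  assumes t: "0 < t" and f: "bdd_integrable f"
  shows "(heat t f x)\<^sup>2 \<le> heat t (\<lambda>y. (f y)\<^sup>2) x"
proof (rule heat_jensen[where \<Phi> = "\<lambda>x. x\<^sup>2" and d = "2 * heat t f x"])
  fix y show "(heat t f x)\<^sup>2 + 2 * heat t f x * (y - heat t f x) \<le> y\<^sup>2"
    using sum_squares_ge_zero[of "y - heat t f x" 0] by (simp add: power2_eq_square algebra_simps)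
qed (use t f bdd_integrable_power[OF f, of 2] in \<open>auto dest: bdd_integrableD\<close>)

text \<open>Induction on k: square the inequality, then apply the quadratic case to
  |f|^(2^k).\<close>

lemma heat_jensen_power:
  assumes t: "0 < t" and f: "bdd_integrable f"
  shows "\<bar>heat t f x\<bar> ^ (2 ^ k) \<le> heat t (\<lambda>y. \<bar>f y\<bar> ^ (2 ^ k)) x"
proof (induction k)
  case 0
  then show ?case using heat_abs_le_heat_abs[OF t] f by (auto dest: bdd_integrableD)
next
  case (Suc k)
  have b: "bdd_integrable (\<lambda>y. \<bar>f y\<bar> ^ (2 ^ k))" using f by auto
  have "\<bar>heat t f x\<bar> ^ (2 ^ Suc k) = (\<bar>heat t f x\<bar> ^ (2 ^ k))\<^sup>2"
    unfolding power_Suc power_even_eq ..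
  also have "\<dots> \<le> (heat t (\<lambda>y. \<bar>f y\<bar> ^ (2 ^ k)) x)\<^sup>2"
    by (rule power_mono[OF Suc]) auto
  also have "\<dots> \<le> heat t (\<lambda>y. (\<bar>f y\<bar> ^ (2 ^ k))\<^sup>2) x"
    by (rule heat_jensen_square[OF t b])
  finally show ?case unfolding power_Suc power_even_eq .
qed

text \<open>A discrete substitute for 2 h times the Dirichlet integral of v, meaningful without
  derivatives. It controls the gradient of \<open>heat h v\<close> (\<open>grad_heat_defect\<close>)
  and drives Nash's inequality.\<close>

definition heat_defect :: "real \<Rightarrow> (real^'n \<Rightarrow> real) \<Rightarrow> real" where
  "heat_defect h v = (LBINT x. (v x)\<^sup>2) - (LBINT x. (heat h v x)\<^sup>2)"

lemma integral_heat_mult_heat: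
  assumes s: "0 < s" and t: "0 < t" and v: "bdd_integrable v"
  shows "(LBINT x. heat s v x * heat t v x) = (LBINT x. v x * heat (s + t) v x)"
proof -
  have i: "integrable lborel v" using v by (rule bdd_integrableD)
  have "(LBINT x. heat s v x * heat t v x) = (LBINT x. heat t (heat s v) x * v x)"
    using s t v i by (intro heat_adjoint) auto
  then show ?thesis
    using heat_heat[OF t s i] by (simp add: mult.commute[of "v _"] add.commute[of s])
qed

lemma heat_defect_eq:
  assumes h: "0 < h" and v: "bdd_integrable v"
  shows "heat_defect h v = (LBINT x. (v x)\<^sup>2) - (LBINT x. v x * heat (2 * h) v x)"
  using integral_heat_mult_heat[OF h h v] by (simp add: heat_defect_def power2_eq_square flip: mult_2)

text \<open>\<open>\<parallel>heat (n h) v\<parallel>\<^sup>2\<close> is convex in \<open>n\<close>, since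
  \<open>\<parallel>heat s v - heat (s + 2 h) v\<parallel>\<^sup>2 \<ge> 0\<close> is its second difference.\<close>

lemma heat_defect_antimono:
  assumes h: "0 < h" and v: "bdd_integrable v"
  shows "heat_defect h (heat h v) \<le> heat_defect h v"
proof -
  have i: "integrable lborel v" and b: "bdd_integrable (heat (2 * h) v)" "bdd_integrable (heat h v)"
    using h v by (auto dest: bdd_integrableD)
  have "0 \<le> (LBINT x. (v x - heat (2 * h) v x)\<^sup>2)" by simp
  also have "\<dots> = (LBINT x. (v x)\<^sup>2 - 2 * (v x * heat (2 * h) v x) + (heat (2 * h) v x)\<^sup>2)"
    by (simp add: power2_eq_square algebra_simps)
  also have "\<dots> = (LBINT x. (v x)\<^sup>2) - 2 * (LBINT x. v x * heat (2 * h) v x)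
      + (LBINT x. (heat (2 * h) v x)\<^sup>2)"
    using bdd_integrable_power[OF v, of 2] bdd_integrable_power[OF b(1), of 2] bdd_integrable_mult[OF v b(1)]
    by (subst Bochner_Integration.integral_add Bochner_Integration.integral_diff;
        (intro Bochner_Integration.integrable_diff)?; auto dest: bdd_integrableD)+
  finally show ?thesis
    using h v i integral_heat_mult_heat[OF h h v]
    by (simp add: heat_defect_def heat_heat power2_eq_square flip: mult_2)
qed

text \<open>The defects along the iterates do not increase, so each term of the telescoping sum is
  at most the first one.\<close>

lemma heat_defect_telescope:
  assumes h: "0 < h" and v: "bdd_integrable v"
  shows "(LBINT x. (v x)\<^sup>2) \<le> (LBINT x. (((heat h) ^^ n) v x)\<^sup>2) + real n * heat_defect h v"
proof -
  have b: "bdd_integrable (((heat h) ^^ n) v)" for n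
    using v h by (induction n) (auto dest: bdd_integrableD)
  have d: "heat_defect h (((heat h) ^^ n) v) \<le> heat_defect h v" for n
  proof (induction n)
    case (Suc n)
    then show ?case using heat_defect_antimono[OF h b[of n]] by simp
  qed simp
  show ?thesis
  proof (induction n)
    case (Suc n)
    then show ?case using d[of n] by (simp add: heat_defect_def[of _ "((heat h) ^^ n) v"] algebra_simps)
  qed simp
qed

lemma heat_iterate:
  assumes h: "0 < h" and v: "integrable lborel v"
  shows "((heat h) ^^ Suc n) v = heat (real (Suc n) * h) v"
proof (induction n)
  case (Suc n)
  have "((heat h) ^^ Suc (Suc n)) v = heat h (heat (real (Suc n) * h) v)"
    using Suc by simp
  also have "\<dots> = heat (h + real (Suc n) * h) v"
    using h by (intro heat_heat v) auto
  also have "h + real (Suc n) * h = real (Suc (Suc n)) * h"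
    by (simp add: algebra_simps)
  finally show ?case .
qed simp

text \<open>After the time n h, the smoothing of the heat flow from L^1 to L^\<infinity> bounds the
  L^2 norm by the L^1 norm; the loss on the way is at most n times the first defect. Optimising over
  n h would give the multiplicative form; here n stays free, to be matched with the time
  grid.\<close>

lemma nash_inequality:
  fixes v :: "real^'n \<Rightarrow> real"
  assumes h: "0 < h" and n: "0 < n" and v: "bdd_integrable v"
  shows "(LBINT x. (v x)\<^sup>2) \<le>
    (4 * pi * (real n * h)) powr (- real CARD('n) / 2) * (LBINT x. \<bar>v x\<bar>)\<^sup>2 + real n * heat_defect h v"
proof -
  define s where "s = real n * h"
  define c where "c = (4 * pi * s) powr (- real CARD('n) / 2) * (LBINT x. \<bar>v x\<bar>)"
  have s: "0 < s" using h n by (simp add: s_def)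
  have i: "integrable lborel v" using v by (auto dest: bdd_integrableD)
  have c: "\<bar>heat s v x\<bar> \<le> c" for x unfolding c_def by (rule heat_abs_le_L1[OF s i])
  have c0: "0 \<le> c" using c[of 0] by simp
  have "(LBINT x. (heat s v x)\<^sup>2) \<le> (LBINT x. c * \<bar>heat s v x\<bar>)"
  proof (rule integral_mono)
    show "integrable lborel (\<lambda>x. (heat s v x)\<^sup>2)"
      using bdd_integrable_power[OF bdd_integrable_heat[OF s i], of 2] by (auto dest: bdd_integrableD)
    show "(heat s v x)\<^sup>2 \<le> c * \<bar>heat s v x\<bar>" for x
      using mult_right_mono[OF c[of x], of "\<bar>heat s v x\<bar>"] by (simp add: power2_eq_square flip: abs_mult)
    show "integrable lborel (\<lambda>x. c * \<bar>heat s v x\<bar>)"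
      using bdd_integrable_heat[OF s i] by (auto dest: bdd_integrableD)
  qed
  also have "\<dots> \<le> c * (LBINT x. \<bar>v x\<bar>)"
    using mult_left_mono[OF integral_heat_abs_le[OF s i] c0] by simp
  finally have "(LBINT x. (heat s v x)\<^sup>2) \<le> (4 * pi * s) powr (- real CARD('n) / 2) * (LBINT x. \<bar>v x\<bar>)\<^sup>2"
    by (simp add: c_def power2_eq_square mult.assoc)
  moreover have "((heat h) ^^ n) v = heat s v"
    using heat_iterate[OF h i, of "n - 1"] n by (simp add: s_def)
  ultimately show ?thesis
    using heat_defect_telescope[OF h v, of n] by (simp add: s_def)
qed

lemma heat_square_diff:
  assumes t: "0 < t" and v: "bdd_integrable v"
  shows "heat t (\<lambda>y. (v y - c)\<^sup>2) x = heat t (\<lambda>y. (v y)\<^sup>2) x - 2 * c * heat t v x + c\<^sup>2"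
proof -
  let ?k = "\<lambda>y. heat_kernel t (x - y)"
  have i: "integrable lborel ?k" "integrable lborel (\<lambda>y. ?k y * v y)" "integrable lborel (\<lambda>y. ?k y * (v y)\<^sup>2)"
    using bdd_integrable_reflect[OF bdd_integrable_heat_kernel[OF t], of x]
      bdd_integrable_power[OF v, of 2] t v
    by (auto dest: bdd_integrableD intro!: conv_integrable)
  have k1: "(LBINT y. ?k y) = 1"
    using heat_const[OF t, of 1 x] by (simp add: conv_def)
  have "heat t (\<lambda>y. (v y - c)\<^sup>2) x = (LBINT y. ?k y * (v y)\<^sup>2 - 2 * c * (?k y * v y) + c\<^sup>2 * ?k y)"
    unfolding conv_def by (simp add: power2_eq_square algebra_simps)
  also have "\<dots> = heat t (\<lambda>y. (v y)\<^sup>2) x - 2 * c * heat t v x + c\<^sup>2 * (LBINT y. ?k y)"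
    using i by (simp add: conv_def)
  finally show ?thesis by (simp add: k1)
qed

text \<open>Expand the square: the kernel has mass 1, and the cross term is the inner product of v
  with \<open>heat (2 * h) v\<close>, that is, the squared norm of \<open>heat h v\<close>. The
  defect thus becomes a weighted integral of squared differences, which shows its sign and allows
  comparison with gradients.\<close>

lemma integral_heat_square_diff:
  assumes h: "0 < h" and v: "bdd_integrable v"
  shows "integrable lborel (\<lambda>x. heat (2 * h) (\<lambda>y. (v y - v x)\<^sup>2) x)"
    and "(LBINT x. heat (2 * h) (\<lambda>y. (v y - v x)\<^sup>2) x) = 2 * heat_defect h v"
proof -
  have h2: "0 < 2 * h" using h by simp
  have i: "integrable lborel v" "integrable lborel (\<lambda>x. (v x)\<^sup>2)"
      "integrable lborel (\<lambda>x. v x * heat (2 * h) v x)" "integrable lborel (heat (2 * h) (\<lambda>y. (v y)\<^sup>2))"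
    using bdd_integrable_power[OF v, of 2] bdd_integrable_mult[OF v, of "heat (2 * h) v"] v h2
    by (auto dest!: bdd_integrableD(1) intro!: bdd_integrableD(1)[OF bdd_integrable_heat])
  have eq: "heat (2 * h) (\<lambda>y. (v y - v x)\<^sup>2) x =
      heat (2 * h) (\<lambda>y. (v y)\<^sup>2) x - 2 * (v x * heat (2 * h) v x) + (v x)\<^sup>2" for x
    by (simp add: heat_square_diff[OF h2 v])
  show "integrable lborel (\<lambda>x. heat (2 * h) (\<lambda>y. (v y - v x)\<^sup>2) x)"
    unfolding eq using i by simp
  show "(LBINT x. heat (2 * h) (\<lambda>y. (v y - v x)\<^sup>2) x) = 2 * heat_defect h v"
    unfolding eq using i h2 by (simp add: heat_defect_eq[OF h v] integral_heat)
qed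

lemma heat_defect_nonneg:
  assumes "0 < h" "bdd_integrable v"
  shows "0 \<le> heat_defect h v"
proof -
  have "0 \<le> (LBINT x. heat (2 * h) (\<lambda>y. (v y - v x)\<^sup>2) x)"
    unfolding conv_def by (intro Bochner_Integration.integral_nonneg) auto
  then show ?thesis by (simp add: integral_heat_square_diff[OF assms])
qed

text \<open>The derivative kernel has mean zero, so it only sees the differences \<open>v y - v x\<close>.\<close>

lemma grad_heat_defect:
  fixes v :: "real^'n \<Rightarrow> real"
  assumes h: "0 < h" and v: "bdd_integrable v"
  shows "h * (LBINT x. (grad_heat a h v x)\<^sup>2) \<le> 2 ^ (CARD('n) + 1) * (norm a)\<^sup>2 * heat_defect h v"
proof -
  define c where "c = 2 powr (real CARD('n) / 2) * norm a / sqrt h"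
  have h2: "0 < 2 * h" using h by simp
  have i: "integrable lborel v" using v by (auto dest: bdd_integrableD)
  have bb: "bdd_integrable (\<lambda>z. c * heat_kernel (2 * h) z)" using h2 by auto
  have c0: "0 \<le> c" using h by (simp add: c_def)
  have pt: "(grad_heat a h v x)\<^sup>2 \<le> c\<^sup>2 * heat (2 * h) (\<lambda>y. (v y - v x)\<^sup>2) x" for x
  proof -
    let ?k = "\<lambda>y. grad_heat_kernel a h (x - y)" and ?l = "\<lambda>y. heat_kernel (2 * h) (x - y)"
    define A where "A = (LBINT y. ?l y * \<bar>v y - v x\<bar>)"
    have ik: "integrable lborel ?k" "integrable lborel ?l"
      using bdd_integrable_reflect[OF bdd_integrable_grad_heat_kernel[OF h, of a], of x]
        bdd_integrable_reflect[OF bdd_integrable_heat_kernel[OF h2], of x] by (auto dest: bdd_integrableD)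
    have k0: "(LBINT y. ?k y) = 0"
      using integral_reflect[of "grad_heat_kernel a h" x] h by simp
    have l1: "(LBINT y. ?l y) = 1"
      using heat_const[OF h2, of 1 x] by (simp add: conv_def)
    have ikv: "integrable lborel (\<lambda>y. ?k y * v y)" "integrable lborel (\<lambda>y. ?l y * v y)"
      using h h2 i by (auto intro: conv_integrable)
    have ikd: "integrable lborel (\<lambda>y. ?k y * (v y - v x))" "integrable lborel (\<lambda>y. ?l y * (v y - v x))"
      using ik ikv by (auto simp: right_diff_distrib)
    have ila: "integrable lborel (\<lambda>y. ?l y * \<bar>v y - v x\<bar>)"
      using integrable_abs[OF ikd(2)] by (simp add: abs_mult)
    have "grad_heat a h v x = (LBINT y. ?k y * (v y - v x))"
      using ik ikv k0 by (simp add: conv_def right_diff_distrib)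
    then have "\<bar>grad_heat a h v x\<bar> \<le> (LBINT y. \<bar>?k y * (v y - v x)\<bar>)"
      by (simp add: integral_abs_bound)
    also have "\<dots> \<le> (LBINT y. c * (?l y * \<bar>v y - v x\<bar>))"
    proof (rule integral_mono)
      show "\<bar>?k y * (v y - v x)\<bar> \<le> c * (?l y * \<bar>v y - v x\<bar>)" for y
        using mult_right_mono[OF grad_heat_kernel_bound[OF h, of a "x - y"], of "\<bar>v y - v x\<bar>"]
        by (simp add: c_def abs_mult mult.assoc)
    qed (use integrable_abs[OF ikd(1)] ila in auto)
    also have "\<dots> = c * A" by (simp add: A_def)
    finally have "(grad_heat a h v x)\<^sup>2 \<le> c\<^sup>2 * A\<^sup>2"
      using power_mono[of "\<bar>grad_heat a h v x\<bar>" "c * A" 2] by (simp add: power_mult_distrib)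
    \<comment> \<open>The variance of |v y - v x| under the probability density \<open>?l\<close> is
      nonnegative.\<close>
    moreover have "A\<^sup>2 \<le> heat (2 * h) (\<lambda>y. (v y - v x)\<^sup>2) x"
    proof -
      have "integrable lborel (\<lambda>y. ?l y * (v y)\<^sup>2)"
        using bdd_integrable_power[OF v, of 2] h2 by (auto intro!: conv_integrable dest: bdd_integrableD)
      then have "integrable lborel (\<lambda>y. ?l y * (v y)\<^sup>2 - 2 * v x * (?l y * v y) + (v x)\<^sup>2 * ?l y)"
        using ik ikv by simp
      then have isq: "integrable lborel (\<lambda>y. ?l y * (v y - v x)\<^sup>2)"
        by (simp add: power2_diff algebra_simps)
      have "0 \<le> (LBINT y. ?l y * (\<bar>v y - v x\<bar> - A)\<^sup>2)"
        by (intro Bochner_Integration.integral_nonneg) auto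
      also have "\<dots> = (LBINT y. ?l y * (v y - v x)\<^sup>2 - 2 * A * (?l y * \<bar>v y - v x\<bar>) + A\<^sup>2 * ?l y)"
        by (intro Bochner_Integration.integral_cong refl) (simp add: power2_diff algebra_simps)
      also have "\<dots> = heat (2 * h) (\<lambda>y. (v y - v x)\<^sup>2) x - 2 * A * A + A\<^sup>2"
        using isq ila ik by (simp add: l1 conv_def A_def)
      finally show ?thesis by (simp add: power2_eq_square)
    qed
    ultimately show ?thesis
      by (meson mult_left_mono order_trans zero_le_power2)
  qed
  have "(LBINT x. (grad_heat a h v x)\<^sup>2) \<le> (LBINT x. c\<^sup>2 * heat (2 * h) (\<lambda>y. (v y - v x)\<^sup>2) x)"
    by (rule integral_mono)
      (use pt integral_heat_square_diff(1)[OF h v] bdd_integrable_power[OF bdd_integrable_grad_heat[OF h i], of 2 a] in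
        \<open>auto dest: bdd_integrableD\<close>)
  also have "\<dots> = c\<^sup>2 * (2 * heat_defect h v)"
    using integral_heat_square_diff[OF h v] by simp
  finally have "h * (LBINT x. (grad_heat a h v x)\<^sup>2) \<le> h * (c\<^sup>2 * (2 * heat_defect h v))"
    using h by (simp add: mult_left_mono)
  also have "(2 powr (real CARD('n) / 2))\<^sup>2 = 2 ^ CARD('n)"
    by (simp add: power2_eq_square powr_realpow flip: powr_add)
  \<comment> \<open>The squared singularity 1 / sqrt h of the kernel bound cancels the factor h, so
    the constant is uniform in the time step.\<close>
  then have "h * c\<^sup>2 = 2 ^ CARD('n) * (norm a)\<^sup>2"
    using h by (simp only: c_def power_mult_distrib power_divide) simp
  then have "h * (c\<^sup>2 * (2 * heat_defect h v)) = 2 ^ (CARD('n) + 1) * (norm a)\<^sup>2 * heat_defect h v"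
    by (simp add: algebra_simps)
  finally show ?thesis .
qed

lemma grad_heat_abs_le:
  fixes f :: "real^'n \<Rightarrow> real"
  assumes t: "0 < t" and f: "integrable lborel f" and B: "\<And>y. \<bar>f y\<bar> \<le> B"
  shows "\<bar>grad_heat a t f x\<bar> \<le> 2 powr (real CARD('n) / 2) * norm a / sqrt t * B"
proof -
  have "\<bar>grad_heat a t f x\<bar> \<le> conv (\<lambda>z. 2 powr (real CARD('n) / 2) * norm a / sqrt t * heat_kernel (2 * t) z) (\<lambda>y. \<bar>f y\<bar>) x"
  proof (rule conv_abs_le_conv)
    show "bdd_integrable (\<lambda>z. 2 powr (real CARD('n) / 2) * norm a / sqrt t * heat_kernel (2 * t) (z :: real^'n))"
      using t by (intro bdd_integrable_cmult bdd_integrable_heat_kernel) auto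
    show "\<bar>grad_heat_kernel a t z\<bar> \<le> 2 powr (real CARD('n) / 2) * norm a / sqrt t * heat_kernel (2 * t) z" for z
      by (rule grad_heat_kernel_bound[OF t])
  qed (use t f in auto)
  also have "\<dots> = 2 powr (real CARD('n) / 2) * norm a / sqrt t * heat (2 * t) (\<lambda>y. \<bar>f y\<bar>) x"
    unfolding conv_def by (subst integral_mult_right_zero[symmetric]) (simp add: mult.assoc)
  also have "\<dots> \<le> 2 powr (real CARD('n) / 2) * norm a / sqrt t * B"
    using t f B heat_abs_le[of "2 * t" "\<lambda>y. \<bar>f y\<bar>" B x] by (intro mult_left_mono) auto
  finally show ?thesis .
qed

lemma integral_grad_heat_abs_le:
  fixes f :: "real^'n \<Rightarrow> real"
  assumes t: "0 < t" and f: "integrable lborel f"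
  shows "(LBINT x. \<bar>grad_heat a t f x\<bar>) \<le>
    2 powr (real CARD('n) / 2) * norm a / sqrt t * (LBINT x. \<bar>f x\<bar>)"
proof -
  have "(LBINT x. \<bar>grad_heat_kernel a t x\<bar>) \<le>
      (LBINT x. 2 powr (real CARD('n) / 2) * norm a / sqrt t * heat_kernel (2 * t) (x :: real^'n))"
  proof (rule integral_mono)
    show "integrable lborel (\<lambda>z. 2 powr (real CARD('n) / 2) * norm a / sqrt t * heat_kernel (2 * t) (z :: real^'n))"
      using t by (intro bdd_integrableD(1) bdd_integrable_cmult bdd_integrable_heat_kernel) auto
    show "\<bar>grad_heat_kernel a t z\<bar> \<le> 2 powr (real CARD('n) / 2) * norm a / sqrt t * heat_kernel (2 * t) z" for z
      by (rule grad_heat_kernel_bound[OF t])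
  qed (use t in \<open>auto intro!: integrable_abs bdd_integrableD(1)\<close>)
  also have "\<dots> = 2 powr (real CARD('n) / 2) * norm a / sqrt t" using t by simp
  finally have "(LBINT x. \<bar>grad_heat_kernel a t x\<bar>) * (LBINT x. \<bar>f x\<bar>) \<le>
      2 powr (real CARD('n) / 2) * norm a / sqrt t * (LBINT x. \<bar>f x\<bar>)"
    by (intro mult_right_mono) auto
  then show ?thesis
    using integral_conv_abs_le[of "grad_heat_kernel a t" f] t f by auto
qed

subsection \<open>Regularised mild solutions\<close>

text \<open>The singularity of the gradient kernel at the end of a Duhamel integral; an interval of
  length h contributes the order sqrt h.\<close>

lemma inverse_sqrt_integral:
  fixes \<alpha> \<beta> :: real
  assumes "\<alpha> \<le> \<beta>"
  shows "integrable lborel (\<lambda>s. indicator {\<alpha><..<\<beta>} s * (1 / sqrt (\<beta> - s)))"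
    and "(LBINT s. indicator {\<alpha><..<\<beta>} s * (1 / sqrt (\<beta> - s))) = 2 * sqrt (\<beta> - \<alpha>)"
proof -
  define g :: "real \<Rightarrow> real" where "g x = indicator {0..\<beta> - \<alpha>} x * x powr (- (1 / 2))" for x
  have [measurable]: "g \<in> borel_measurable borel" unfolding g_def[abs_def] by measurable
  have "((\<lambda>x. x powr (- (1 / 2))) has_integral ((\<beta> - \<alpha>) powr (- (1 / 2) + 1) / (- (1 / 2) + 1))) {0..\<beta> - \<alpha>}"
    by (rule has_integral_powr_from_0) (use assms in auto)
  then have "((\<lambda>x. x powr (- (1 / 2))) has_integral (2 * sqrt (\<beta> - \<alpha>))) {0..\<beta> - \<alpha>}"
    using assms by (simp add: powr_half_sqrt mult.commute)
  from nn_integral_has_integral_lebesgue[OF _ this]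
  have nn: "(\<integral>\<^sup>+x. ennreal (g x) \<partial>lborel) = ennreal (2 * sqrt (\<beta> - \<alpha>))"
    by (simp add: g_def)
  have gi: "integrable lborel g"
  proof (rule integrableI_nonneg)
    show "AE x in lborel. 0 \<le> g x" by (simp add: g_def)
  qed (simp_all add: nn)
  have "has_bochner_integral lborel g (2 * sqrt (\<beta> - \<alpha>))"
    using assms by (intro has_bochner_integral_nn_integral nn) (auto simp: g_def)
  then have gv: "(LBINT x. g x) = 2 * sqrt (\<beta> - \<alpha>)" by (rule has_bochner_integral_integral_eq)
  \<comment> \<open>At s = \<beta> both sides are 0, since 0 powr r = 0; the point to discard is s =
    \<alpha>, which the closed interval in \<open>g\<close> includes.\<close>
  have ae: "AE s in lborel. g (\<beta> - s) = indicator {\<alpha><..<\<beta>} s * (1 / sqrt (\<beta> - s))"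
    using AE_lborel_singleton[of \<alpha>]
  proof eventually_elim
    case (elim s)
    then consider "\<alpha> < s" "s < \<beta>" | "s = \<beta>" | "s \<notin> {\<alpha>..\<beta>}" by fastforce
    then show ?case by cases (auto simp: g_def powr_minus_half)
  qed
  show "integrable lborel (\<lambda>s. indicator {\<alpha><..<\<beta>} s * (1 / sqrt (\<beta> - s)))"
    using integrable_reflect[OF gi, of \<beta>] by (subst integrable_cong_AE[OF _ _ ae, symmetric]) auto
  show "(LBINT s. indicator {\<alpha><..<\<beta>} s * (1 / sqrt (\<beta> - s))) = 2 * sqrt (\<beta> - \<alpha>)"
    using integral_reflect[of g \<beta>] gv by (subst integral_cong_AE[OF _ _ ae, symmetric]) auto
qed

text \<open>The solution after modification on null sets, with F cut off outside the range of u: the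
  bound holds at every point and F is globally Lipschitz. Joint measurability is asked of the source
  extended by 0 to nonpositive times, because the solution is jointly measurable for positive times
  only.\<close>

locale bounded_mild_solution =
  fixes a :: "real^'n" and F :: "real \<Rightarrow> real" and u :: "real \<Rightarrow> real^'n \<Rightarrow> real" and M L :: real
  assumes u_integrable: "0 \<le> t \<Longrightarrow> integrable lborel (u t)"
    and u_bound: "0 \<le> t \<Longrightarrow> \<bar>u t x\<bar> \<le> M"
    and F_lipschitz: "\<bar>F r - F s\<bar> \<le> L * \<bar>r - s\<bar>"
    and F_0: "F 0 = 0"
    and source_measurable: "(\<lambda>(s, x). if 0 < s then F (u s x) else 0) \<in> borel_measurable (borel \<Otimes>\<^sub>M borel)"
    and u_continuous: "0 \<le> t \<Longrightarrow> ((\<lambda>s. LBINT x. \<bar>u s x - u t x\<bar>) \<longlongrightarrow> 0) (at t within {0..})"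
    and mild: "0 < t \<Longrightarrow> AE x in lborel.
      u t x = heat t (u 0) x + (LBINT s:{0<..<t}. grad_heat a (t - s) (\<lambda>y. F (u s y)) x)"
begin

definition source :: "real \<Rightarrow> real^'n \<Rightarrow> real" where
  "source s x = (if 0 < s then F (u s x) else 0)"

text \<open>The effect at time T of the source acting during (\<alpha>, \<beta>). For T = \<beta>
  this is the term of the integral equation; for T > \<beta> it is the same term regularised by the
  heat flow, and the kernel stays away from its singularity.\<close>

definition duhamel :: "real \<Rightarrow> real \<Rightarrow> real \<Rightarrow> real^'n \<Rightarrow> real" where
  "duhamel \<alpha> \<beta> T x = (LBINT s. indicator {\<alpha><..<\<beta>} s * grad_heat a (T - s) (source s) x)"

definition grad_const :: real where
  "grad_const = 2 powr (real CARD('n) / 2) * norm a"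

section \<open>Bounds for the source and for Duhamel integrals\<close>

lemma grad_const_nonneg [simp]: "0 \<le> grad_const"
  by (simp add: grad_const_def)

lemma L_nonneg [simp]: "0 \<le> L"
  using F_lipschitz[of 1 0] by simp

lemma M_nonneg [simp]: "0 \<le> M"
  using u_bound[of 0 0] by simp

lemma bdd_integrable_u: "0 \<le> t \<Longrightarrow> bdd_integrable (u t)"
  using u_integrable u_bound by (auto simp: bdd_integrable_def)

lemma u_measurable: "0 \<le> t \<Longrightarrow> u t \<in> borel_measurable borel"
  using u_integrable by fastforce

lemma F_abs_le: "\<bar>F x\<bar> \<le> L * \<bar>x\<bar>"
  using F_lipschitz[of x 0] F_0 by simp

lemma F_continuous: "continuous_on A F"
  by (rule lipschitz_on_continuous_on[of L], rule lipschitz_onI)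
    (auto simp: dist_real_def F_lipschitz)

lemma F_measurable [measurable]: "F \<in> borel_measurable borel"
  by (rule borel_measurable_continuous_onI[OF F_continuous])

lemma source_abs_le: "0 \<le> s \<Longrightarrow> \<bar>source s x\<bar> \<le> L * \<bar>u s x\<bar>"
  by (auto simp: source_def F_abs_le)

lemma source_bound: "\<bar>source s x\<bar> \<le> L * M"
proof (cases "0 < s")
  case True
  then show ?thesis
    using source_abs_le[of s x] mult_left_mono[OF u_bound[of s x], of L] by (simp del: mult_cancel_left)
qed (simp add: source_def)

lemma source_measurable2 [measurable]:
  assumes "f \<in> borel_measurable N" "g \<in> N \<rightarrow>\<^sub>M borel"
  shows "(\<lambda>w. source (f w) (g w)) \<in> borel_measurable N"
  using measurable_compose[OF measurable_Pair[OF assms] source_measurable]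
  by (simp add: source_def)

lemma bdd_integrable_source: "bdd_integrable (source s)"
proof (cases "0 < s")
  case True
  then show ?thesis
    using source_abs_le[of s] by (intro bdd_integrable_dominated[OF bdd_integrable_u[of s], of _ L]) auto
next
  case False
  then have "source s = (\<lambda>_. 0)" by (auto simp: source_def)
  then show ?thesis by (auto simp: bdd_integrable_def intro: exI[of _ 0])
qed

lemma integrable_source [simp]: "integrable lborel (source s)"
  by (rule bdd_integrableD[OF bdd_integrable_source])

lemma integral_source_abs_le:
  assumes "0 \<le> s"
  shows "(LBINT x. \<bar>source s x\<bar>) \<le> L * (LBINT x. \<bar>u s x\<bar>)"
proof -
  have "(LBINT x. \<bar>source s x\<bar>) \<le> (LBINT x. L * \<bar>u s x\<bar>)"
    by (rule integral_mono) (use assms source_abs_le u_integrable in auto)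
  then show ?thesis by simp
qed

lemma grad_heat_source_measurable [measurable]:
  assumes "\<beta> \<le> T"
  shows "(\<lambda>(s, x). indicator {\<alpha><..<\<beta>} s * grad_heat a (T - s) (source s) x) \<in> borel_measurable (borel \<Otimes>\<^sub>M borel)"
proof -
  \<comment> \<open>The Frechet derivative is replaced by its closed formula, valid because T - s >
    0 on the interval; joint measurability in time and space can then be read off.\<close>
  have eq: "(\<lambda>(s, x). indicator {\<alpha><..<\<beta>} s * grad_heat a (T - s) (source s) x) =
    (\<lambda>p. LBINT y. indicator {\<alpha><..<\<beta>} (fst p) * ((- (a \<bullet> (snd p - y)) / (2 * (T - fst p)) *
      ((4 * pi * (T - fst p)) powr (- real CARD('n) / 2) * exp (- (norm (snd p - y))\<^sup>2 / (4 * (T - fst p))))) * source (fst p) y))"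
    using assms by (auto simp: fun_eq_iff conv_def grad_heat_kernel_eq heat_kernel_def split: split_indicator)
  show ?thesis unfolding eq by measurable
qed

lemma grad_heat_source_abs_le:
  assumes "s < T"
  shows "\<bar>grad_heat a (T - s) (source s) x\<bar> \<le> grad_const * (L * M) * (1 / sqrt (T - s))"
  using grad_heat_abs_le[of "T - s" "source s" "L * M" a x] source_bound assms
  by (simp add: grad_const_def mult.commute)

lemma indicator_inverse_sqrt_le:
  fixes \<alpha> \<beta> T s :: real
  assumes "\<beta> \<le> T"
  shows "indicator {\<alpha><..<\<beta>} s * (1 / sqrt (T - s)) \<le> indicator {\<alpha><..<\<beta>} s * (1 / sqrt (\<beta> - s))"
  using assms by (auto split: split_indicator intro!: divide_left_mono)

lemma duhamel_integrand_integrable: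
  assumes "\<alpha> \<le> \<beta>" "\<beta> \<le> T"
  shows "integrable lborel (\<lambda>s. indicator {\<alpha><..<\<beta>} s * grad_heat a (T - s) (source s) x)"
proof (rule Bochner_Integration.integrable_bound)
  show "integrable lborel (\<lambda>s. grad_const * (L * M) * (indicator {\<alpha><..<\<beta>} s * (1 / sqrt (\<beta> - s))))"
    by (intro integrable_mult_right inverse_sqrt_integral assms)
  show "(\<lambda>s. indicator {\<alpha><..<\<beta>} s * grad_heat a (T - s) (source s) x) \<in> borel_measurable lborel"
    using measurable_compose[OF _ grad_heat_source_measurable[OF assms(2), of \<alpha>], of "\<lambda>s. (s, x)" borel]
    by simp
  show "AE s in lborel. norm (indicator {\<alpha><..<\<beta>} s * grad_heat a (T - s) (source s) x)
      \<le> norm (grad_const * (L * M) * (indicator {\<alpha><..<\<beta>} s * (1 / sqrt (\<beta> - s))))"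
  proof (rule AE_I2)
    fix s
    show "norm (indicator {\<alpha><..<\<beta>} s * grad_heat a (T - s) (source s) x)
      \<le> norm (grad_const * (L * M) * (indicator {\<alpha><..<\<beta>} s * (1 / sqrt (\<beta> - s))))"
    proof (cases "s \<in> {\<alpha><..<\<beta>}")
      case True
      then have "\<bar>grad_heat a (T - s) (source s) x\<bar> \<le> grad_const * (L * M) * (1 / sqrt (T - s))"
        using assms by (intro grad_heat_source_abs_le) auto
      also have "\<dots> \<le> grad_const * (L * M) * (1 / sqrt (\<beta> - s))"
        using indicator_inverse_sqrt_le[OF assms(2), of \<alpha> s] True by (intro mult_left_mono) auto
      finally show ?thesis using True by simp
    qed simp
  qed
qed

lemma duhamel_split:
  assumes "\<alpha> \<le> \<beta>" "\<beta> \<le> \<gamma>" "\<gamma> \<le> T"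
  shows "duhamel \<alpha> \<gamma> T x = duhamel \<alpha> \<beta> T x + duhamel \<beta> \<gamma> T x"
proof -
  let ?q = "\<lambda>s. grad_heat a (T - s) (source s) x"
  have "duhamel \<alpha> \<beta> T x + duhamel \<beta> \<gamma> T x =
      (LBINT s. indicator {\<alpha><..<\<beta>} s * ?q s + indicator {\<beta><..<\<gamma>} s * ?q s)"
    unfolding duhamel_def using assms
    by (intro Bochner_Integration.integral_add[symmetric] duhamel_integrand_integrable) auto
  also have "\<dots> = duhamel \<alpha> \<gamma> T x"
    unfolding duhamel_def
  proof (rule integral_cong_AE)
    show "AE s in lborel. indicator {\<alpha><..<\<beta>} s * ?q s + indicator {\<beta><..<\<gamma>} s * ?q s = indicator {\<alpha><..<\<gamma>} s * ?q s"
      using AE_lborel_singleton[of \<beta>]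
      by eventually_elim (use assms in \<open>auto split: split_indicator\<close>)
  qed (use assms in \<open>auto intro!: borel_measurable_integrable borel_measurable_add duhamel_integrand_integrable simp del: borel_measurable_add\<close>)
  finally show ?thesis by simp
qed

text \<open>The L^1 norm in x of the integrand is at most a multiple of 1 / sqrt (\<beta> - s),
  which is integrable in s. The bounded weight \<phi> allows Duhamel integrals to be tested: with a
  heat kernel in \<open>heat_mild\<close>, with the derivative of an entropy in
  \<open>entropy_step\<close>.\<close>

lemma duhamel_prod_integrable:
  assumes \<alpha>: "0 \<le> \<alpha>" "\<alpha> \<le> \<beta>" and T: "\<beta> \<le> T"
    and M1: "\<And>s. 0 \<le> s \<Longrightarrow> s \<le> \<beta> \<Longrightarrow> (LBINT x. \<bar>u s x\<bar>) \<le> M1"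
    and \<phi>: "\<phi> \<in> borel_measurable borel" "\<And>x. \<bar>\<phi> x\<bar> \<le> B"
  shows "integrable (lborel \<Otimes>\<^sub>M lborel) (\<lambda>(s, x). \<phi> x * (indicator {\<alpha><..<\<beta>} s * grad_heat a (T - s) (source s) x))" (is ?int)
    and "(LBINT s. LBINT x. \<bar>indicator {\<alpha><..<\<beta>} s * grad_heat a (T - s) (source s) x\<bar>)
      \<le> grad_const * (L * M1) * (2 * sqrt (\<beta> - \<alpha>))" (is ?bound)
proof -
  let ?q = "\<lambda>s x. indicator {\<alpha><..<\<beta>} s * grad_heat a (T - s) (source s) x"
  have [measurable]: "case_prod ?q \<in> borel_measurable (borel \<Otimes>\<^sub>M borel)"
    by (rule grad_heat_source_measurable[OF T])
  have M1': "0 \<le> M1" using order_trans[OF _ M1[of 0]] \<alpha> by (simp add: Bochner_Integration.integral_nonneg)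
  have qi: "integrable lborel (?q s)" for s
  proof (cases "s \<in> {\<alpha><..<\<beta>}")
    case True
    then show ?thesis using T bdd_integrableD(1)[OF bdd_integrable_grad_heat[of "T - s" "source s" a]] by simp
  qed simp
  have qb: "(LBINT x. \<bar>?q s x\<bar>) \<le> grad_const * (L * M1) * (indicator {\<alpha><..<\<beta>} s * (1 / sqrt (\<beta> - s)))" for s
  proof (cases "s \<in> {\<alpha><..<\<beta>}")
    case True
    then have "(LBINT x. \<bar>?q s x\<bar>) \<le> grad_const * (1 / sqrt (T - s)) * (LBINT x. \<bar>source s x\<bar>)"
      using T integral_grad_heat_abs_le[of "T - s" "source s" a] by (simp add: grad_const_def)
    also have "\<dots> \<le> grad_const * (1 / sqrt (\<beta> - s)) * (L * M1)"
      using indicator_inverse_sqrt_le[OF T, of \<alpha> s] True \<alpha> T M1[of s] M1'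
      by (intro mult_mono mult_left_mono order_trans[OF integral_source_abs_le])
        (auto intro: Bochner_Integration.integral_nonneg)
    finally show ?thesis using True by (simp add: mult_ac)
  qed simp
  have mi: "integrable lborel (\<lambda>s. LBINT x. \<bar>?q s x\<bar>)"
  proof (rule Bochner_Integration.integrable_bound)
    show "integrable lborel (\<lambda>s. grad_const * (L * M1) * (indicator {\<alpha><..<\<beta>} s * (1 / sqrt (\<beta> - s))))"
      by (intro integrable_mult_right inverse_sqrt_integral \<alpha>)
    show "AE s in lborel. norm (LBINT x. \<bar>?q s x\<bar>) \<le>
        norm (grad_const * (L * M1) * (indicator {\<alpha><..<\<beta>} s * (1 / sqrt (\<beta> - s))))"
      unfolding real_norm_def
      by (intro AE_I2 order_trans[OF _ abs_ge_self]) (use qb in \<open>simp only: abs_of_nonneg Bochner_Integration.integral_nonneg abs_ge_zero\<close>)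
  qed simp
  show ?bound
  proof -
    have "(LBINT s. LBINT x. \<bar>?q s x\<bar>) \<le>
        (LBINT s. grad_const * (L * M1) * (indicator {\<alpha><..<\<beta>} s * (1 / sqrt (\<beta> - s))))"
      by (rule integral_mono[OF mi _ qb]) (intro integrable_mult_right inverse_sqrt_integral \<alpha>)
    also have "\<dots> = grad_const * (L * M1) * (2 * sqrt (\<beta> - \<alpha>))"
      by (subst integral_mult_right_zero) (simp only: inverse_sqrt_integral(2)[OF \<alpha>(2)])
    finally show ?thesis .
  qed
  have qint: "integrable (lborel \<Otimes>\<^sub>M lborel) (case_prod ?q)"
    by (rule lborel_pair.Fubini_integrable) (use qi mi in auto)
  show ?int
  proof (rule Bochner_Integration.integrable_bound)
    show "integrable (lborel \<Otimes>\<^sub>M lborel) (\<lambda>p. B * \<bar>case_prod ?q p\<bar>)"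
      by (intro integrable_mult_right integrable_abs qint)
    show "(\<lambda>(s, x). \<phi> x * ?q s x) \<in> borel_measurable (lborel \<Otimes>\<^sub>M lborel)"
      using \<phi>(1) by measurable
    show "AE p in lborel \<Otimes>\<^sub>M lborel. norm (case p of (s, x) \<Rightarrow> \<phi> x * ?q s x) \<le> norm (B * \<bar>case_prod ?q p\<bar>)"
      by (intro AE_I2) (auto simp: abs_mult intro!: mult_right_mono order_trans[OF \<phi>(2) abs_ge_self])
  qed
qed

lemma duhamel_fubini:
  assumes \<alpha>: "0 \<le> \<alpha>" "\<alpha> \<le> \<beta>" and T: "\<beta> \<le> T"
    and M1: "\<And>s. 0 \<le> s \<Longrightarrow> s \<le> \<beta> \<Longrightarrow> (LBINT x. \<bar>u s x\<bar>) \<le> M1"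
    and \<phi>: "\<phi> \<in> borel_measurable borel" "\<And>x. \<bar>\<phi> x\<bar> \<le> B"
  shows "integrable lborel (\<lambda>s. indicator {\<alpha><..<\<beta>} s * (LBINT x. \<phi> x * grad_heat a (T - s) (source s) x))"
    and "(LBINT x. \<phi> x * duhamel \<alpha> \<beta> T x) =
      (LBINT s. indicator {\<alpha><..<\<beta>} s * (LBINT x. \<phi> x * grad_heat a (T - s) (source s) x))"
proof -
  note i = duhamel_prod_integrable(1)[OF assms]
  have eq: "(LBINT x. \<phi> x * (indicator {\<alpha><..<\<beta>} s * grad_heat a (T - s) (source s) x)) =
      indicator {\<alpha><..<\<beta>} s * (LBINT x. \<phi> x * grad_heat a (T - s) (source s) x)" for s
    by (subst integral_mult_right_zero[symmetric]) (simp add: mult.left_commute)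
  show "integrable lborel (\<lambda>s. indicator {\<alpha><..<\<beta>} s * (LBINT x. \<phi> x * grad_heat a (T - s) (source s) x))"
    using lborel_pair.integrable_fst'[OF i] by (simp add: eq)
  show "(LBINT x. \<phi> x * duhamel \<alpha> \<beta> T x) =
      (LBINT s. indicator {\<alpha><..<\<beta>} s * (LBINT x. \<phi> x * grad_heat a (T - s) (source s) x))"
    using lborel_pair.Fubini_integral[OF i] by (simp add: eq duhamel_def)
qed

lemma duhamel_measurable [measurable]:
  assumes "\<beta> \<le> T"
  shows "duhamel \<alpha> \<beta> T \<in> borel_measurable borel"
proof -
  have [measurable]: "(\<lambda>(s, x). indicator {\<alpha><..<\<beta>} s * grad_heat a (T - s) (source s) x) \<in> borel_measurable (borel \<Otimes>\<^sub>M borel)"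
    by (rule grad_heat_source_measurable[OF assms])
  show ?thesis unfolding duhamel_def by measurable
qed

lemma duhamel_L1:
  assumes \<alpha>: "0 \<le> \<alpha>" "\<alpha> \<le> \<beta>" and T: "\<beta> \<le> T"
    and M1: "\<And>s. 0 \<le> s \<Longrightarrow> s \<le> \<beta> \<Longrightarrow> (LBINT x. \<bar>u s x\<bar>) \<le> M1"
  shows "integrable lborel (duhamel \<alpha> \<beta> T)"
    and "(LBINT x. \<bar>duhamel \<alpha> \<beta> T x\<bar>) \<le> grad_const * (L * M1) * (2 * sqrt (\<beta> - \<alpha>))"
proof -
  let ?q = "\<lambda>s x. indicator {\<alpha><..<\<beta>} s * grad_heat a (T - s) (source s) x"
  have i: "integrable (lborel \<Otimes>\<^sub>M lborel) (case_prod ?q)"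
    using duhamel_prod_integrable(1)[OF assms, of "\<lambda>_. 1" 1] by simp
  have ia: "integrable (lborel \<Otimes>\<^sub>M lborel) (\<lambda>(s, x). \<bar>?q s x\<bar>)"
    using integrable_abs[OF i] by (simp only: split_beta')
  show d: "integrable lborel (duhamel \<alpha> \<beta> T)"
    using lborel_pair.integrable_snd[OF i] by (simp add: duhamel_def[abs_def])
  have "(LBINT x. \<bar>duhamel \<alpha> \<beta> T x\<bar>) \<le> (LBINT x. LBINT s. \<bar>?q s x\<bar>)"
  proof (rule integral_mono)
    show "\<bar>duhamel \<alpha> \<beta> T x\<bar> \<le> (LBINT s. \<bar>?q s x\<bar>)" for x
      unfolding duhamel_def by (rule integral_abs_bound)
  qed (use d lborel_pair.integrable_snd[OF ia] in auto)
  also have "\<dots> = (LBINT s. LBINT x. \<bar>?q s x\<bar>)"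
    by (rule lborel_pair.Fubini_integral[OF ia])
  also have "\<dots> \<le> grad_const * (L * M1) * (2 * sqrt (\<beta> - \<alpha>))"
    by (rule duhamel_prod_integrable(2)[OF assms, of "\<lambda>_. 1" 1]) auto
  finally show "(LBINT x. \<bar>duhamel \<alpha> \<beta> T x\<bar>) \<le> grad_const * (L * M1) * (2 * sqrt (\<beta> - \<alpha>))" .
qed

text \<open>Keeping the distance \<epsilon> from the singularity improves the order from the square
  root of \<beta> - \<alpha> to \<beta> - \<alpha>, at the price 1 / sqrt \<epsilon>. Multiplied by
  the L^1 bound, it makes the quadratic remainder of a step of order h^(3/2).\<close>

lemma duhamel_sup:
  assumes \<alpha>: "\<alpha> \<le> \<beta>" and \<epsilon>: "0 < \<epsilon>"
  shows "\<bar>duhamel \<alpha> \<beta> (\<beta> + \<epsilon>) x\<bar> \<le> grad_const * (L * M) / sqrt \<epsilon> * (\<beta> - \<alpha>)"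
proof -
  let ?q = "\<lambda>s. indicator {\<alpha><..<\<beta>} s * grad_heat a (\<beta> + \<epsilon> - s) (source s) x"
  have i: "integrable lborel ?q" using duhamel_integrand_integrable[of \<alpha> \<beta> "\<beta> + \<epsilon>" x] assms by simp
  have "\<bar>duhamel \<alpha> \<beta> (\<beta> + \<epsilon>) x\<bar> \<le> (LBINT s. \<bar>?q s\<bar>)"
    unfolding duhamel_def by (rule integral_abs_bound)
  also have "\<dots> \<le> (LBINT s. grad_const * (L * M) / sqrt \<epsilon> * indicator {\<alpha><..<\<beta>} s)"
  proof (rule integral_mono)
    show "\<bar>?q s\<bar> \<le> grad_const * (L * M) / sqrt \<epsilon> * indicator {\<alpha><..<\<beta>} s" for s
    proof (cases "s \<in> {\<alpha><..<\<beta>}")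
      case True
      then have "\<bar>grad_heat a (\<beta> + \<epsilon> - s) (source s) x\<bar> \<le> grad_const * (L * M) * (1 / sqrt (\<beta> + \<epsilon> - s))"
        using \<epsilon> by (intro grad_heat_source_abs_le) auto
      also have "\<dots> \<le> grad_const * (L * M) * (1 / sqrt \<epsilon>)"
        using True \<epsilon> by (intro mult_left_mono divide_left_mono) auto
      finally show ?thesis using True by simp
    qed simp
  qed (use i \<alpha> in auto)
  also have "\<dots> = grad_const * (L * M) / sqrt \<epsilon> * (\<beta> - \<alpha>)" using \<alpha> by simp
  finally show ?thesis .
qed

text \<open>Continuity on a compact interval. The L^1 norm is in fact nonincreasing, but the proof
  of that goes through estimates that already use this bound.\<close>

lemma L1_norm_bounded: "\<exists>M1\<ge>0. \<forall>s\<in>{0..T}. (LBINT x. \<bar>u s x\<bar>) \<le> M1"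
proof -
  let ?N = "\<lambda>s. LBINT x. \<bar>u s x\<bar>"
  have "continuous_on {0..} ?N"
    unfolding continuous_on_def
  proof
    fix t :: real assume t: "t \<in> {0..}"
    have le: "\<bar>?N s - ?N t\<bar> \<le> (LBINT x. \<bar>u s x - u t x\<bar>)" if "0 \<le> s" for s
    proof -
      have i: "integrable lborel (u s)" "integrable lborel (u t)" using that t u_integrable by auto
      then have "?N s - ?N t = (LBINT x. \<bar>u s x\<bar> - \<bar>u t x\<bar>)" by simp
      also have "\<bar>\<dots>\<bar> \<le> (LBINT x. \<bar>\<bar>u s x\<bar> - \<bar>u t x\<bar>\<bar>)" by (rule integral_abs_bound)
      also have "\<dots> \<le> (LBINT x. \<bar>u s x - u t x\<bar>)"
        by (rule integral_mono) (use i in auto)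
      finally show ?thesis .
    qed
    have "((\<lambda>s. ?N s - ?N t) \<longlongrightarrow> 0) (at t within {0..})"
      by (rule Lim_null_comparison[OF _ u_continuous])
        (use t le in \<open>auto simp: eventually_at_filter\<close>)
    then show "(?N \<longlongrightarrow> ?N t) (at t within {0..})" by (simp add: LIM_zero_iff)
  qed
  then have "compact (?N ` {0..T})"
    by (intro compact_continuous_image) (auto intro: continuous_on_subset)
  then obtain B where "\<forall>y\<in>?N ` {0..T}. norm y \<le> B"
    using compact_imp_bounded bounded_iff by blast
  then have "\<bar>?N s\<bar> \<le> B" if "s \<in> {0..T}" for s using that by auto
  then have "\<forall>s\<in>{0..T}. ?N s \<le> \<bar>B\<bar>" by (meson abs_ge_self order_trans)
  then show ?thesis by (intro exI[of _ "\<bar>B\<bar>"]) auto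
qed

text \<open>The kernel at time 0 is identically 0, by 0 powr r = 0, rather than the identity of
  convolution; hence the guard on t.\<close>

lemma mild_duhamel:
  assumes "0 \<le> t"
  shows "AE x in lborel. 0 < t \<longrightarrow> u t x = heat t (u 0) x + duhamel 0 t t x"
proof (cases "0 < t")
  case True
  have "(LBINT s:{0<..<t}. grad_heat a (t - s) (\<lambda>y. F (u s y)) x) = duhamel 0 t t x" for x
    unfolding duhamel_def set_lebesgue_integral_def
    by (intro Bochner_Integration.integral_cong refl) (auto split: split_indicator simp: source_def[abs_def])
  then show ?thesis using mild[OF True] by simp
qed simp

text \<open>Convolution does not see null sets, so the almost everywhere identity becomes an
  identity at every point, valid at t = 0 as well. The semigroup law moves \<epsilon> into both
  kernels, after an exchange of integrals in the Duhamel term.\<close>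

lemma heat_mild:
  assumes t: "0 \<le> t" and \<epsilon>: "0 < \<epsilon>"
  shows "heat \<epsilon> (u t) x = heat (\<epsilon> + t) (u 0) x + duhamel 0 t (\<epsilon> + t) x"
proof (cases "t = 0")
  case False
  with t have t: "0 < t" by simp
  obtain M1 where M1: "\<And>s. 0 \<le> s \<Longrightarrow> s \<le> t \<Longrightarrow> (LBINT x. \<bar>u s x\<bar>) \<le> M1"
    using L1_norm_bounded[of t] by (metis atLeastAtMost_iff)
  have d: "integrable lborel (duhamel 0 t t)" using duhamel_L1(1)[OF _ _ _ M1, of 0 t] t by simp
  have u0: "integrable lborel (u 0)" by (simp add: u_integrable)
  have i0: "integrable lborel (heat t (u 0))"
    using t u0 bdd_integrable_heat[of t "u 0"] by (auto intro: bdd_integrableD(1))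
  have [measurable]: "u t \<in> borel_measurable borel" "u 0 \<in> borel_measurable borel"
    using t by (auto simp: u_measurable)
  have [measurable]: "duhamel 0 t t \<in> borel_measurable borel" using d by auto
  let ?k = "\<lambda>y. heat_kernel \<epsilon> (x - y)"
  have "heat \<epsilon> (u t) x = heat \<epsilon> (\<lambda>y. heat t (u 0) y + duhamel 0 t t y) x"
    unfolding conv_def[of "heat_kernel \<epsilon>"]
  proof (rule integral_cong_AE)
    show "AE y in lborel. ?k y * u t y = ?k y * (heat t (u 0) y + duhamel 0 t t y)"
      using mild_duhamel[of t] t by auto
  qed auto
  also have "\<dots> = heat \<epsilon> (heat t (u 0)) x + heat \<epsilon> (duhamel 0 t t) x"
    using \<epsilon> d i0 by (intro conv_add) auto
  also have "heat \<epsilon> (heat t (u 0)) x = heat (\<epsilon> + t) (u 0) x"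
    using \<epsilon> t u0 by (simp add: heat_heat)
  also have "heat \<epsilon> (duhamel 0 t t) x = duhamel 0 t (\<epsilon> + t) x"
  proof -
    have "heat \<epsilon> (duhamel 0 t t) x = (LBINT s. indicator {0<..<t} s * (LBINT y. ?k y * grad_heat a (t - s) (source s) y))"
      unfolding conv_def[of "heat_kernel \<epsilon>"]
      by (rule duhamel_fubini(2)[OF _ _ _ M1, where B = "(4 * pi * \<epsilon>) powr (- real CARD('n) / 2)"])
        (use t \<epsilon> heat_kernel_le[OF \<epsilon>] in auto)
    also have "\<dots> = duhamel 0 t (\<epsilon> + t) x"
      unfolding duhamel_def
    proof (intro Bochner_Integration.integral_cong refl)
      fix s
      show "indicator {0<..<t} s * (LBINT y. ?k y * grad_heat a (t - s) (source s) y) =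
          indicator {0<..<t} s * grad_heat a (\<epsilon> + t - s) (source s) x"
        using heat_grad_heat[OF \<epsilon>, of "t - s" "source s" a]
        by (auto split: split_indicator simp: conv_def[of "heat_kernel \<epsilon>"] fun_eq_iff add_diff_eq)
    qed
    finally show ?thesis .
  qed
  finally show ?thesis .
qed (use \<epsilon> in \<open>simp add: duhamel_def\<close>)

text \<open>Compare \<open>heat_mild\<close> at time t + h with regularisation \<epsilon> and at
  time t with regularisation \<epsilon> + h: the contributions of the source up to time t coincide
  and only those from (t, t + h) survive.\<close>

lemma heat_step:
  assumes t: "0 \<le> t" and h: "0 \<le> h" and \<epsilon>: "0 < \<epsilon>"
  shows "heat \<epsilon> (u (t + h)) x = heat (\<epsilon> + h) (u t) x + duhamel t (t + h) (t + h + \<epsilon>) x"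
  using heat_mild[of "t + h" \<epsilon> x] heat_mild[of t "\<epsilon> + h" x] duhamel_split[of 0 t "t + h" "t + h + \<epsilon>" x] assms
  by (simp add: add_ac)

lemma heat_L1_close:
  assumes t: "0 \<le> t" and h: "0 < h"
    and M1: "\<And>s. 0 \<le> s \<Longrightarrow> s \<le> t + h \<Longrightarrow> (LBINT x. \<bar>u s x\<bar>) \<le> M1"
  shows "(LBINT x. \<bar>u (t + h) x - heat h (u t) x\<bar>) \<le> grad_const * (L * M1) * (2 * sqrt h)"
proof -
  have m [measurable]: "u (t + h) \<in> borel_measurable borel" "u t \<in> borel_measurable borel"
    "duhamel t (t + h) (t + h) \<in> borel_measurable borel"
    using t h u_measurable by auto
  have "AE x in lborel. \<bar>u (t + h) x - heat h (u t) x\<bar> = \<bar>duhamel t (t + h) (t + h) x\<bar>"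
    using mild_duhamel[OF add_nonneg_nonneg[OF t less_imp_le[OF h]]]
  proof eventually_elim
    case (elim x)
    then show ?case
      using heat_mild[OF t h, of x] duhamel_split[of 0 t "t + h" "t + h" x] t h
      by (simp add: add.commute)
  qed
  then have "(LBINT x. \<bar>u (t + h) x - heat h (u t) x\<bar>) = (LBINT x. \<bar>duhamel t (t + h) (t + h) x\<bar>)"
    by (intro integral_cong_AE) auto
  also have "\<dots> \<le> grad_const * (L * M1) * (2 * sqrt h)"
    using duhamel_L1(2)[OF t _ _ M1, of "t + h"] h by simp
  finally show ?thesis .
qed

section \<open>Uniform continuity in L^1 and approximation by the heat flow\<close>

lemma L1_dist_triangle:
  assumes "0 \<le> r" "0 \<le> s" "0 \<le> t"
  shows "(LBINT x. \<bar>u r x - u t x\<bar>) \<le> (LBINT x. \<bar>u r x - u s x\<bar>) + (LBINT x. \<bar>u t x - u s x\<bar>)"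
proof -
  have i: "integrable lborel (u r)" "integrable lborel (u s)" "integrable lborel (u t)"
    using assms u_integrable by auto
  have "(LBINT x. \<bar>u r x - u t x\<bar>) \<le> (LBINT x. \<bar>u r x - u s x\<bar> + \<bar>u t x - u s x\<bar>)"
    by (rule integral_mono) (use i in auto)
  then show ?thesis using i by simp
qed

text \<open>Heine-Cantor by sequences: pairs of times that approach each other while their L^1
  distance exceeds \<eta> have a common limit point l, and continuity at l contradicts the triangle
  inequality.\<close>

lemma L1_uniformly_continuous:
  assumes "0 < \<eta>"
  shows "\<exists>\<delta>>0. \<forall>s\<in>{0..T}. \<forall>t\<in>{0..T}. \<bar>s - t\<bar> \<le> \<delta> \<longrightarrow> (LBINT x. \<bar>u s x - u t x\<bar>) \<le> \<eta>"
proof (rule ccontr)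
  define d where "d s t = (LBINT x. \<bar>u s x - u t x\<bar>)" for s t
  assume "\<not> ?thesis"
  then have neg: "\<exists>s t. s \<in> {0..T} \<and> t \<in> {0..T} \<and> \<bar>s - t\<bar> \<le> \<delta> \<and> \<eta> < d s t" if "0 < \<delta>" for \<delta>
    using that unfolding d_def by (meson not_le)
  have "\<exists>s t. s \<in> {0..T} \<and> t \<in> {0..T} \<and> \<bar>s - t\<bar> \<le> 1 / real (Suc n) \<and> \<eta> < d s t" for n
    by (rule neg) simp
  then obtain X Y where XY: "\<And>n. X n \<in> {0..T}" "\<And>n. Y n \<in> {0..T}"
      "\<And>n. \<bar>X n - Y n\<bar> \<le> 1 / real (Suc n)" "\<And>n. \<eta> < d (X n) (Y n)"
    by metis
  obtain l r where l: "l \<in> {0..T}" "strict_mono r" "(X \<circ> r) \<longlonglongrightarrow> l"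
    using compact_Icc[of 0 T] XY(1) unfolding compact_def by metis
  have "(\<lambda>n. X (r n) - Y (r n)) \<longlonglongrightarrow> 0"
  proof (rule Lim_null_comparison)
    show "\<forall>\<^sub>F n in sequentially. norm (X (r n) - Y (r n)) \<le> 1 / real (Suc n)"
    proof (intro always_eventually allI)
      fix n
      have "1 / real (Suc (r n)) \<le> 1 / real (Suc n)"
        using seq_suble[OF l(2), of n] by (intro divide_left_mono) auto
      then show "norm (X (r n) - Y (r n)) \<le> 1 / real (Suc n)" using XY(3)[of "r n"] by simp
    qed
    show "(\<lambda>n. 1 / real (Suc n)) \<longlonglongrightarrow> 0" using LIMSEQ_inverse_real_of_nat by (simp add: divide_inverse)
  qed
  from tendsto_diff[OF l(3) this] have Y: "(\<lambda>n. Y (r n)) \<longlonglongrightarrow> l" by (simp add: comp_def)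
  have lim: "(\<lambda>n. d (Z n) l) \<longlonglongrightarrow> 0" if "Z \<longlonglongrightarrow> l" "\<And>n. Z n \<in> {0..T}" for Z
  proof -
    have "continuous (at l within {0..}) (\<lambda>s. d s l)"
      using u_continuous[of l] l by (simp add: continuous_within d_def)
    then have "((\<lambda>s. d s l) \<circ> Z) \<longlonglongrightarrow> d l l"
      using that unfolding continuous_within_sequentially by auto
    then show ?thesis by (simp add: comp_def d_def)
  qed
  have "(\<lambda>n. d (X (r n)) l + d (Y (r n)) l) \<longlonglongrightarrow> 0 + 0"
    using l(3) Y XY by (intro tendsto_add lim) (auto simp: comp_def)
  then have "\<forall>\<^sub>F n in sequentially. d (X (r n)) l + d (Y (r n)) l < \<eta>"
    using assms by (simp add: order_tendstoD(2))
  then obtain n where "d (X (r n)) l + d (Y (r n)) l < \<eta>"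
    by (auto dest: eventually_happens)
  then show False
    using L1_dist_triangle[of "X (r n)" l "Y (r n)"] XY(1)[of "r n"] XY(2)[of "r n"] XY(4)[of "r n"] l(1)
    unfolding atLeastAtMost_iff d_def by linarith
qed

text \<open>Strong continuity of the heat flow, uniformly along the solution, is obtained from the
  equation itself: \<open>heat \<sigma> (u t)\<close> is close to u (t + \<sigma>), their difference
  being a Duhamel integral of order sqrt \<sigma>, and u (t + \<sigma>) is close to u t by uniform
  continuity.\<close>

lemma heat_L1_approx:
  assumes "0 < \<eta>"
  shows "\<exists>\<delta>>0. \<forall>t\<in>{0..T}. \<forall>\<sigma>\<in>{0<..\<delta>}. (LBINT x. \<bar>u t x - heat \<sigma> (u t) x\<bar>) \<le> \<eta>"
proof -
  obtain M1 where M1: "0 \<le> M1" "\<And>s. 0 \<le> s \<Longrightarrow> s \<le> T + 1 \<Longrightarrow> (LBINT x. \<bar>u s x\<bar>) \<le> M1"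
    using L1_norm_bounded[of "T + 1"] by (metis atLeastAtMost_iff)
  obtain \<delta>1 where \<delta>1: "0 < \<delta>1"
    "\<And>s t. s \<in> {0..T + 1} \<Longrightarrow> t \<in> {0..T + 1} \<Longrightarrow> \<bar>s - t\<bar> \<le> \<delta>1 \<Longrightarrow> (LBINT x. \<bar>u s x - u t x\<bar>) \<le> \<eta> / 2"
    using L1_uniformly_continuous[of "\<eta> / 2" "T + 1"] assms by auto
  define c where "c = grad_const * (L * M1) * 2 + 1"
  have c: "0 < c" using M1 by (simp add: c_def add_nonneg_pos)
  define \<delta> where "\<delta> = min (min \<delta>1 1) ((\<eta> / (2 * c))\<^sup>2)"
  have "(LBINT x. \<bar>u t x - heat \<sigma> (u t) x\<bar>) \<le> \<eta>" if t: "t \<in> {0..T}" and \<sigma>: "\<sigma> \<in> {0<..\<delta>}" for t \<sigma>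
  proof -
    have i: "integrable lborel (u t)" "integrable lborel (u (t + \<sigma>))" "integrable lborel (heat \<sigma> (u t))"
      using t \<sigma> u_integrable bdd_integrableD(1)[OF bdd_integrable_heat[of \<sigma> "u t"]] by auto
    have "(LBINT x. \<bar>u t x - heat \<sigma> (u t) x\<bar>) \<le>
        (LBINT x. \<bar>u t x - u (t + \<sigma>) x\<bar> + \<bar>u (t + \<sigma>) x - heat \<sigma> (u t) x\<bar>)"
      by (rule integral_mono) (use i in auto)
    also have "\<dots> = (LBINT x. \<bar>u t x - u (t + \<sigma>) x\<bar>) + (LBINT x. \<bar>u (t + \<sigma>) x - heat \<sigma> (u t) x\<bar>)"
      using i by simp
    also have "(LBINT x. \<bar>u t x - u (t + \<sigma>) x\<bar>) \<le> \<eta> / 2"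
      using t \<sigma> by (intro \<delta>1) (auto simp: \<delta>_def)
    also have "(LBINT x. \<bar>u (t + \<sigma>) x - heat \<sigma> (u t) x\<bar>) \<le> grad_const * (L * M1) * (2 * sqrt \<sigma>)"
      using t \<sigma> by (intro heat_L1_close M1(2)) (auto simp: \<delta>_def)
    also have "\<dots> \<le> c * sqrt \<sigma>" using \<sigma> by (simp add: c_def algebra_simps)
    also have "sqrt \<sigma> \<le> \<eta> / (2 * c)"
      using \<sigma> assms c by (intro real_le_lsqrt) (auto simp: \<delta>_def)
    also have "\<eta> / 2 + c * (\<eta> / (2 * c)) = \<eta>" using c by simp
    finally show ?thesis using c by (simp add: mult_left_mono)
  qed
  moreover have "0 < \<delta>" using \<delta>1 assms c by (simp add: \<delta>_def)
  ultimately show ?thesis by blast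
qed

end

subsection \<open>Entropies\<close>

text \<open>The values at 0 make \<Phi> (w) and \<Phi>' (w) integrable whenever w is integrable and
  bounded by M. The second derivative is bounded on [-M, M] only, so that powers qualify. Convexity
  enters elsewhere, through the decay of the integral under the heat flow.\<close>

definition entropy :: "real \<Rightarrow> real \<Rightarrow> (real \<Rightarrow> real) \<Rightarrow> (real \<Rightarrow> real) \<Rightarrow> (real \<Rightarrow> real) \<Rightarrow> bool" where
  "entropy M K \<Phi> \<Phi>' \<Phi>'' \<longleftrightarrow>
    (\<forall>x. (\<Phi> has_real_derivative \<Phi>' x) (at x)) \<and>
    (\<forall>x. (\<Phi>' has_real_derivative \<Phi>'' x) (at x)) \<and>
    continuous_on UNIV \<Phi>'' \<and> \<Phi> 0 = 0 \<and> \<Phi>' 0 = 0 \<and>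
    (\<forall>x. \<bar>x\<bar> \<le> M \<longrightarrow> \<bar>\<Phi>'' x\<bar> \<le> K)"

lemma real_derivative_bound:
  fixes f :: "real \<Rightarrow> real"
  assumes "\<And>x. \<bar>x\<bar> \<le> M \<Longrightarrow> (f has_real_derivative f' x) (at x)" "\<And>x. \<bar>x\<bar> \<le> M \<Longrightarrow> \<bar>f' x\<bar> \<le> B"
    and "\<bar>x\<bar> \<le> M" "\<bar>y\<bar> \<le> M"
  shows "\<bar>f x - f y\<bar> \<le> B * \<bar>x - y\<bar>"
proof -
  have "norm (f x - f y) \<le> B * norm (x - y)"
  proof (rule field_differentiable_bound[of "{- M..M}" f f'])
    show "(f has_field_derivative f' z) (at z within {- M..M})" if "z \<in> {- M..M}" for z
      by (rule has_field_derivative_at_within, rule assms(1)) (use that in auto)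
    show "norm (f' z) \<le> B" if "z \<in> {- M..M}" for z
      using assms(2)[of z] that by auto
    show "x \<in> {- M..M}" "y \<in> {- M..M}"
      using assms(3,4) by auto
  qed simp
  then show ?thesis by simp
qed

lemma entropyD:
  assumes "entropy M K \<Phi> \<Phi>' \<Phi>''"
  shows "(\<Phi> has_real_derivative \<Phi>' x) (at x)" "(\<Phi>' has_real_derivative \<Phi>'' x) (at x)"
    "continuous_on A \<Phi>''" "\<Phi> 0 = 0" "\<Phi>' 0 = 0" "\<bar>x\<bar> \<le> M \<Longrightarrow> \<bar>\<Phi>'' x\<bar> \<le> K"
  using assms unfolding entropy_def by (auto intro: continuous_on_subset)

context
  fixes M K \<Phi> \<Phi>' \<Phi>''
  assumes entropy: "entropy M K \<Phi> \<Phi>' \<Phi>''" and M_nonneg: "0 \<le> M"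
begin

lemma entropy_const_nonneg: "0 \<le> K"
  using entropyD(6)[OF entropy, of 0] M_nonneg by simp

lemma entropy_continuous: "continuous_on A \<Phi>" "continuous_on A \<Phi>'"
  using entropyD(1,2)[OF entropy]
  by (auto intro!: continuous_at_imp_continuous_on DERIV_isCont)

lemma entropy_measurable: "\<Phi> \<in> borel_measurable borel" "\<Phi>' \<in> borel_measurable borel" "\<Phi>'' \<in> borel_measurable borel"
  using entropy_continuous entropyD(3)[OF entropy] by (auto intro: borel_measurable_continuous_onI)

lemma entropy_deriv_abs_le: "\<bar>x\<bar> \<le> M \<Longrightarrow> \<bar>\<Phi>' x\<bar> \<le> K * \<bar>x\<bar>"
  using real_derivative_bound[of M \<Phi>' \<Phi>'' K x 0] entropyD[OF entropy] M_nonneg by simp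

lemma entropy_abs_le:
  assumes "\<bar>x\<bar> \<le> M"
  shows "\<bar>\<Phi> x\<bar> \<le> K * M * \<bar>x\<bar>"
proof -
  have "\<bar>\<Phi>' y\<bar> \<le> K * M" if "\<bar>y\<bar> \<le> M" for y
    using entropy_deriv_abs_le[OF that] mult_left_mono[OF that entropy_const_nonneg] by simp
  then show ?thesis
    using real_derivative_bound[of M \<Phi> \<Phi>' "K * M" x 0] entropyD[OF entropy] M_nonneg assms by simp
qed

text \<open>The mean value theorem and the Lipschitz bound for \<Phi>' give the remainder with K in
  place of the sharp K / 2.\<close>

lemma entropy_taylor:
  assumes "\<bar>x\<bar> \<le> M" "\<bar>y\<bar> \<le> M"
  shows "\<Phi> y \<le> \<Phi> x + \<Phi>' x * (y - x) + K * (y - x)\<^sup>2"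
proof -
  have "\<exists>z. \<bar>z - x\<bar> \<le> \<bar>y - x\<bar> \<and> \<bar>z\<bar> \<le> M \<and> \<Phi> y - \<Phi> x = (y - x) * \<Phi>' z"
  proof (cases x y rule: linorder_cases)
    case less
    then obtain z where "x < z" "z < y" "\<Phi> y - \<Phi> x = (y - x) * \<Phi>' z"
      using MVT2[of x y \<Phi> \<Phi>'] entropyD(1)[OF entropy] by blast
    then show ?thesis using assms by (intro exI[of _ z]) auto
  next
    case greater
    then obtain z where "y < z" "z < x" "\<Phi> x - \<Phi> y = (x - y) * \<Phi>' z"
      using MVT2[of y x \<Phi> \<Phi>'] entropyD(1)[OF entropy] by blast
    then show ?thesis using assms by (intro exI[of _ z]) (auto simp: algebra_simps)
  next
    case equal
    then show ?thesis using assms by (intro exI[of _ x]) auto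
  qed
  then obtain z where z: "\<bar>z - x\<bar> \<le> \<bar>y - x\<bar>" "\<bar>z\<bar> \<le> M" "\<Phi> y - \<Phi> x = (y - x) * \<Phi>' z"
    by blast
  have "\<bar>\<Phi>' z - \<Phi>' x\<bar> \<le> K * \<bar>z - x\<bar>"
    using real_derivative_bound[of M \<Phi>' \<Phi>'' K z x] entropyD[OF entropy] z assms by simp
  also have "\<dots> \<le> K * \<bar>y - x\<bar>" using z entropy_const_nonneg by (intro mult_left_mono) auto
  finally have "\<bar>y - x\<bar> * \<bar>\<Phi>' z - \<Phi>' x\<bar> \<le> \<bar>y - x\<bar> * (K * \<bar>y - x\<bar>)"
    by (rule mult_left_mono) simp
  then have "(y - x) * (\<Phi>' z - \<Phi>' x) \<le> K * (y - x)\<^sup>2"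
    by (simp add: power2_eq_square mult.left_commute abs_mult[symmetric] abs_le_iff)
  then show ?thesis using z(3) by (simp add: algebra_simps)
qed

lemma bdd_integrable_entropy:
  assumes "bdd_integrable w" "\<And>x. \<bar>w x\<bar> \<le> M"
  shows "bdd_integrable (\<lambda>x. \<Phi> (w x))" "bdd_integrable (\<lambda>x. \<Phi>' (w x))"
proof -
  have [measurable]: "w \<in> borel_measurable borel" using assms by (rule_tac bdd_integrableD)
  show "bdd_integrable (\<lambda>x. \<Phi> (w x))"
    by (rule bdd_integrable_dominated[OF assms(1), of _ "K * M"])
      (use entropy_measurable entropy_abs_le assms in auto)
  show "bdd_integrable (\<lambda>x. \<Phi>' (w x))"
    by (rule bdd_integrable_dominated[OF assms(1), of _ K])
      (use entropy_measurable entropy_deriv_abs_le assms in auto)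
qed

text \<open>The two integrands add up to the derivative along a of \<Phi>' (\<open>heat s v\<close>)
  times \<open>heat \<sigma> k\<close>, whose integral is 0.\<close>

lemma entropy_heat_by_parts:
  fixes v k :: "real^'n \<Rightarrow> real"
  assumes v: "bdd_integrable v" "\<And>x. \<bar>v x\<bar> \<le> M" and s: "0 < s" "0 < \<sigma>" and k: "bdd_integrable k"
  shows "(LBINT x. \<Phi>' (heat s v x) * grad_heat a \<sigma> k x) =
    - (LBINT x. \<Phi>'' (heat s v x) * grad_heat a s v x * heat \<sigma> k x)"
proof -
  have vi: "integrable lborel v" and ki: "integrable lborel k" using v k by (auto intro: bdd_integrableD)
  have w: "bdd_integrable (heat s v)" "\<And>x. \<bar>heat s v x\<bar> \<le> M"
    using s vi heat_abs_le[OF s(1) vi v(2)] by auto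
  have [measurable]: "heat s v \<in> borel_measurable borel" using w by (auto intro: bdd_integrableD)
  note \<Phi>' = bdd_integrable_entropy(2)[OF w]
  have cont: "continuous_on UNIV (heat s v)" "continuous_on UNIV (heat \<sigma> k)"
    "continuous_on UNIV (grad_heat a s v)" "continuous_on UNIV (grad_heat a \<sigma> k)"
    using s vi ki by (auto intro!: continuous_conv continuous_heat_kernel continuous_grad_heat_kernel)
  have \<Phi>''b: "bdd_integrable (\<lambda>x. \<Phi>'' (heat s v x) * grad_heat a s v x)"
    by (rule bdd_integrable_mult_bounded[OF _ _ entropyD(6)[OF entropy w(2)]])
      (use s vi entropy_measurable in auto)
  have i: "integrable lborel (\<lambda>x. \<Phi>'' (heat s v x) * grad_heat a s v x * heat \<sigma> k x)"
    "integrable lborel (\<lambda>x. \<Phi>' (heat s v x) * grad_heat a \<sigma> k x)"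
    using s ki by (auto intro!: bdd_integrableD(1) bdd_integrable_mult \<Phi>''b \<Phi>')
  have "(LBINT x. \<Phi>'' (heat s v x) * grad_heat a s v x * heat \<sigma> k x + \<Phi>' (heat s v x) * grad_heat a \<sigma> k x) = 0"
  proof (rule integral_directional_derivative_eq_0[where k = "\<lambda>x. \<Phi>' (heat s v x) * heat \<sigma> k x" and a = a])
    show "integrable lborel (\<lambda>x. \<Phi>' (heat s v x) * heat \<sigma> k x)"
      using s ki by (auto intro!: bdd_integrableD(1) bdd_integrable_mult \<Phi>')
    show "continuous_on UNIV (\<lambda>x. \<Phi>'' (heat s v x) * grad_heat a s v x * heat \<sigma> k x + \<Phi>' (heat s v x) * grad_heat a \<sigma> k x)"
      by (intro continuous_intros cont continuous_on_compose2[OF entropyD(3)[OF entropy, of UNIV] cont(1)]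
          continuous_on_compose2[OF entropy_continuous(2)[of UNIV] cont(1)]) auto
    fix x r
    have "((\<lambda>r. heat s v (x + r *\<^sub>R a)) has_real_derivative grad_heat a s v (x + r *\<^sub>R a)) (at r)"
      "((\<lambda>r. heat \<sigma> k (x + r *\<^sub>R a)) has_real_derivative grad_heat a \<sigma> k (x + r *\<^sub>R a)) (at r)"
      using s vi ki by (auto intro!: has_real_derivative_conv heat_kernel_has_real_derivative)
    then show "((\<lambda>r. \<Phi>' (heat s v (x + r *\<^sub>R a)) * heat \<sigma> k (x + r *\<^sub>R a)) has_real_derivative
        \<Phi>'' (heat s v (x + r *\<^sub>R a)) * grad_heat a s v (x + r *\<^sub>R a) * heat \<sigma> k (x + r *\<^sub>R a) +
        \<Phi>' (heat s v (x + r *\<^sub>R a)) * grad_heat a \<sigma> k (x + r *\<^sub>R a)) (at r)"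
      by (rule DERIV_mult'[OF DERIV_chain2[OF entropyD(2)[OF entropy]], THEN DERIV_cong])
        (auto simp: algebra_simps)
  qed (use i in auto)
  then show ?thesis using i by simp
qed

text \<open>The integrand is the derivative along \<open>a\<close> of \<open>H (heat s v)\<close>, where \<open>H' = \<Phi>'' F\<close>.\<close>

lemma entropy_flux_integral_eq_0:
  fixes v :: "real^'n \<Rightarrow> real"
  assumes v: "bdd_integrable v" "\<And>x. \<bar>v x\<bar> \<le> M" and s: "0 < s"
    and F: "continuous_on UNIV F" and F_le: "\<And>x. \<bar>F x\<bar> \<le> L * \<bar>x\<bar>"
  shows "integrable lborel (\<lambda>x. \<Phi>'' (heat s v x) * grad_heat a s v x * F (heat s v x))"
    and "(LBINT x. \<Phi>'' (heat s v x) * grad_heat a s v x * F (heat s v x)) = 0"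
proof -
  have vi: "integrable lborel v" using v by (auto intro: bdd_integrableD)
  have w: "bdd_integrable (heat s v)" "\<And>x. \<bar>heat s v x\<bar> \<le> M"
    using s vi heat_abs_le[OF s(1) vi v(2)] by auto
  have L: "0 \<le> L" using order_trans[OF abs_ge_zero F_le[of 1]] by simp
  have [measurable]: "heat s v \<in> borel_measurable borel" "F \<in> borel_measurable borel"
    using w F by (auto intro: bdd_integrableD borel_measurable_continuous_onI)
  \<comment> \<open>The interval exceeds the range of \<open>heat s v\<close> by 1 on either side,
    so the antiderivative has two-sided derivatives at all values that occur.\<close>
  have "continuous_on {- M - 1..M + 1} (\<lambda>x. \<Phi>'' x * F x)"
    by (intro continuous_intros entropyD(3)[OF entropy] continuous_on_subset[OF F]) auto
  then obtain H where H: "\<And>x. x \<in> {- M - 1..M + 1} \<Longrightarrow>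
      (H has_vector_derivative (\<Phi>'' x * F x)) (at x within {- M - 1..M + 1})"
    using antiderivative_continuous by blast
  have H': "(H has_real_derivative \<Phi>'' x * F x) (at x)" if "\<bar>x\<bar> \<le> M" for x
  proof -
    have "x \<in> interior {- M - 1..M + 1}"
      unfolding interior_atLeastAtMost_real using that by auto
    then have "at x within {- M - 1..M + 1} = at x" by (rule at_within_interior)
    moreover have "x \<in> {- M - 1..M + 1}" using that by auto
    ultimately show ?thesis
      using H[of x] by (simp only: has_real_derivative_iff_has_vector_derivative)
  qed
  have b: "\<bar>\<Phi>'' x * F x\<bar> \<le> K * (L * M)" if "\<bar>x\<bar> \<le> M" for x
    unfolding abs_mult using entropyD(6)[OF entropy that] order_trans[OF F_le[of x] mult_left_mono[OF that L]]
      entropy_const_nonneg by (intro mult_mono) auto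
  have cont: "continuous_on UNIV (heat s v)" "continuous_on UNIV (grad_heat a s v)"
    using s vi by (auto intro!: continuous_conv continuous_heat_kernel continuous_grad_heat_kernel)
  have Fw: "bdd_integrable (\<lambda>x. F (heat s v x))"
    by (rule bdd_integrable_dominated[OF w(1), of _ L]) (use F_le in auto)
  have \<Phi>''b: "bdd_integrable (\<lambda>x. \<Phi>'' (heat s v x) * grad_heat a s v x)"
    by (rule bdd_integrable_mult_bounded[OF _ _ entropyD(6)[OF entropy w(2)]])
      (use s vi entropy_measurable in auto)
  show i: "integrable lborel (\<lambda>x. \<Phi>'' (heat s v x) * grad_heat a s v x * F (heat s v x))"
    by (intro bdd_integrableD(1) bdd_integrable_mult \<Phi>''b Fw)
  have H_cont: "continuous_on {- M..M} H"
    by (intro continuous_at_imp_continuous_on ballI DERIV_isCont[OF H']) auto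
  have Hw_cont: "continuous_on UNIV (\<lambda>x. H (heat s v x) - H 0)"
    by (intro continuous_intros continuous_on_compose2[OF H_cont cont(1)]) (use w(2) in \<open>auto simp: abs_le_iff minus_le_iff\<close>)
  show "(LBINT x. \<Phi>'' (heat s v x) * grad_heat a s v x * F (heat s v x)) = 0"
  proof (rule integral_directional_derivative_eq_0[where k = "\<lambda>x. H (heat s v x) - H 0" and a = a])
    \<comment> \<open>Subtracting H 0 makes the composition vanish with \<open>heat s v\<close>; it
      is then dominated by a multiple of an integrable function.\<close>
    have "bdd_integrable (\<lambda>x. H (heat s v x) - H 0)"
    proof (rule bdd_integrable_dominated[OF w(1)])
      show "\<bar>H (heat s v x) - H 0\<bar> \<le> K * (L * M) * \<bar>heat s v x\<bar>" for x
        using real_derivative_bound[OF H' b w(2)[of x], of 0] M_nonneg by simp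
      show "(\<lambda>x. H (heat s v x) - H 0) \<in> borel_measurable borel"
        by (rule borel_measurable_continuous_onI[OF Hw_cont])
    qed
    then show "integrable lborel (\<lambda>x. H (heat s v x) - H 0)" by (rule bdd_integrableD)
    show "continuous_on UNIV (\<lambda>x. \<Phi>'' (heat s v x) * grad_heat a s v x * F (heat s v x))"
      by (intro continuous_intros cont continuous_on_compose2[OF entropyD(3)[OF entropy, of UNIV] cont(1)]
          continuous_on_compose2[OF F cont(1)]) auto
    fix x r
    have "((\<lambda>r. heat s v (x + r *\<^sub>R a)) has_real_derivative grad_heat a s v (x + r *\<^sub>R a)) (at r)"
      using s vi by (auto intro!: has_real_derivative_conv heat_kernel_has_real_derivative)
    from DERIV_chain2[OF H'[OF w(2)] this]
    show "((\<lambda>r. H (heat s v (x + r *\<^sub>R a)) - H 0) has_real_derivative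
        \<Phi>'' (heat s v (x + r *\<^sub>R a)) * grad_heat a s v (x + r *\<^sub>R a) * F (heat s v (x + r *\<^sub>R a))) (at r)"
      by (auto intro!: derivative_eq_intros)
  qed (use i in auto)
qed

text \<open>After integration by parts, F (\<open>heat s v\<close>) may be subtracted from
  \<open>heat \<sigma> k\<close>, since its contribution is 0. Young's inequality with weight
  \<kappa> splits the product of the difference and the gradient: the squared difference, at most
  \<kappa>^2 in integral, carries 1 / \<kappa>, and the squared gradient carries the small factor
  \<kappa>.\<close>

lemma entropy_production_le:
  fixes v k :: "real^'n \<Rightarrow> real"
  assumes v: "bdd_integrable v" "\<And>x. \<bar>v x\<bar> \<le> M" and s: "0 < s" "0 < \<sigma>" and k: "bdd_integrable k"
    and F: "continuous_on UNIV F" and F_le: "\<And>x. \<bar>F x\<bar> \<le> L * \<bar>x\<bar>"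
    and \<kappa>: "0 < \<kappa>" and close: "(LBINT x. (heat \<sigma> k x - F (heat s v x))\<^sup>2) \<le> \<kappa>\<^sup>2"
  shows "(LBINT x. \<Phi>' (heat s v x) * grad_heat a \<sigma> k x) \<le>
    K * \<kappa> / 2 * ((LBINT x. (grad_heat a s v x)\<^sup>2) + 1)"
proof -
  have vi: "integrable lborel v" and ki: "integrable lborel k" using v k by (auto intro: bdd_integrableD)
  have w: "bdd_integrable (heat s v)" "\<And>x. \<bar>heat s v x\<bar> \<le> M"
    using s vi heat_abs_le[OF s(1) vi v(2)] by auto
  have [measurable]: "heat s v \<in> borel_measurable borel" "F \<in> borel_measurable borel"
    using w F by (auto intro: bdd_integrableD borel_measurable_continuous_onI)
  have Fw: "bdd_integrable (\<lambda>x. F (heat s v x))"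
    by (rule bdd_integrable_dominated[OF w(1), of _ L]) (use F_le in auto)
  define e where "e x = heat \<sigma> k x - F (heat s v x)" for x
  define d where "d = grad_heat a s v"
  have e: "bdd_integrable e" unfolding e_def by (intro bdd_integrable_diff Fw bdd_integrable_heat s ki)
  have d: "bdd_integrable d" using s vi by (auto simp: d_def)
  have \<Phi>''b: "bdd_integrable (\<lambda>x. \<Phi>'' (heat s v x) * d x)"
    by (rule bdd_integrable_mult_bounded[OF d _ entropyD(6)[OF entropy w(2)]])
      (use entropy_measurable in auto)
  have i: "integrable lborel (\<lambda>x. \<Phi>'' (heat s v x) * d x * heat \<sigma> k x)"
      "integrable lborel (\<lambda>x. \<Phi>'' (heat s v x) * d x * e x)"
    using s ki e by (auto intro!: bdd_integrableD(1) bdd_integrable_mult \<Phi>''b)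
  have sq: "integrable lborel (\<lambda>x. (d x)\<^sup>2)" "integrable lborel (\<lambda>x. (e x)\<^sup>2)"
    by (intro bdd_integrableD(1) bdd_integrable_power d e; simp)+
  note z = entropy_flux_integral_eq_0[OF v s(1) F F_le, of a]
  have "(LBINT x. \<Phi>' (heat s v x) * grad_heat a \<sigma> k x) =
      - (LBINT x. \<Phi>'' (heat s v x) * d x * heat \<sigma> k x)"
    unfolding d_def by (rule entropy_heat_by_parts[OF v s k])
  also have "\<dots> = - (LBINT x. \<Phi>'' (heat s v x) * d x * e x)"
    using z i by (simp add: e_def right_diff_distrib d_def)
  also have "\<dots> = (LBINT x. - (\<Phi>'' (heat s v x) * d x * e x))" by simp
  also have "\<dots> \<le> (LBINT x. K * \<kappa> / 2 * (d x)\<^sup>2 + K / (2 * \<kappa>) * (e x)\<^sup>2)"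
  proof (rule integral_mono)
    fix x
    have "- (\<Phi>'' (heat s v x) * d x * e x) \<le> \<bar>\<Phi>'' (heat s v x)\<bar> * (\<bar>d x\<bar> * \<bar>e x\<bar>)"
      by (metis abs_ge_minus_self abs_mult mult.assoc)
    also have "\<dots> \<le> K * (\<bar>d x\<bar> * \<bar>e x\<bar>)"
      using entropyD(6)[OF entropy w(2)] by (intro mult_right_mono) auto
    also have "\<bar>d x\<bar> * \<bar>e x\<bar> \<le> \<kappa> / 2 * (d x)\<^sup>2 + 1 / (2 * \<kappa>) * (e x)\<^sup>2"
    proof -
      have "0 \<le> (\<kappa> * \<bar>d x\<bar> - \<bar>e x\<bar>)\<^sup>2 / (2 * \<kappa>)" using \<kappa> by simp
      also have "\<dots> = \<kappa> / 2 * (d x)\<^sup>2 + 1 / (2 * \<kappa>) * (e x)\<^sup>2 - \<bar>d x\<bar> * \<bar>e x\<bar>"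
        using \<kappa> by (simp add: power2_diff power_mult_distrib add_divide_distrib diff_divide_distrib) (simp add: power2_eq_square)
      finally show ?thesis by simp
    qed
    finally show "- (\<Phi>'' (heat s v x) * d x * e x) \<le> K * \<kappa> / 2 * (d x)\<^sup>2 + K / (2 * \<kappa>) * (e x)\<^sup>2"
      using entropy_const_nonneg by (simp add: mult_left_mono distrib_left)
  qed (use i sq in auto)
  also have "\<dots> = K * \<kappa> / 2 * (LBINT x. (d x)\<^sup>2) + K / (2 * \<kappa>) * (LBINT x. (e x)\<^sup>2)"
    using sq by simp
  also have "\<dots> \<le> K * \<kappa> / 2 * (LBINT x. (d x)\<^sup>2) + K / (2 * \<kappa>) * \<kappa>\<^sup>2"
    using close \<kappa> entropy_const_nonneg unfolding e_def by (intro add_left_mono mult_left_mono) auto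
  also have "\<dots> = K * \<kappa> / 2 * ((LBINT x. (d x)\<^sup>2) + 1)"
    using \<kappa> by (simp add: power2_eq_square distrib_left)
  finally show ?thesis by (simp add: d_def)
qed

end

text \<open>Jensen bounds the left side by the heat average of squared differences of F (f), and the
  Lipschitz bound passes to differences of f. The resulting double integral is twice the defect of f
  for time \<sigma> / 2, hence twice the inner product of f with f - \<open>heat \<sigma> f\<close>,
  where the bound M leaves an L^1 norm.\<close>

lemma heat_lipschitz_close:
  fixes f :: "real^'n \<Rightarrow> real"
  assumes f: "bdd_integrable f" "\<And>x. \<bar>f x\<bar> \<le> M" and \<sigma>: "0 < \<sigma>"
    and F: "\<And>r s. \<bar>F r - F s\<bar> \<le> L * \<bar>r - s\<bar>" and v: "bdd_integrable (\<lambda>x. F (f x))"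
  shows "(LBINT x. (heat \<sigma> (\<lambda>y. F (f y)) x - F (f x))\<^sup>2) \<le> L\<^sup>2 * (2 * M * (LBINT x. \<bar>f x - heat \<sigma> f x\<bar>))"
proof -
  define v where "v y = F (f y)" for y
  have vb: "bdd_integrable v" using v by (simp add: v_def[abs_def])
  have fi: "integrable lborel f" and vi: "integrable lborel v" using f vb by (auto intro: bdd_integrableD)
  have [measurable]: "f \<in> borel_measurable borel" "v \<in> borel_measurable borel" using fi vi by auto
  have \<sigma>2: "0 < \<sigma> / 2" using \<sigma> by simp
  have pt: "(heat \<sigma> v x - v x)\<^sup>2 \<le> L\<^sup>2 * heat \<sigma> (\<lambda>y. (f y - f x)\<^sup>2) x" for x
  proof -
    let ?k = "\<lambda>y. heat_kernel \<sigma> (x - y)"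
    have k: "integrable lborel ?k"
      using bdd_integrable_reflect[OF bdd_integrable_heat_kernel[OF \<sigma>], of x] by (rule bdd_integrableD)
    have ik: "integrable lborel (\<lambda>y. ?k y * (g y - g x)\<^sup>2)" if g: "bdd_integrable g" for g
    proof -
      have [measurable]: "g \<in> borel_measurable borel" using g by (rule bdd_integrableD)
      obtain B where B: "\<And>y. \<bar>g y\<bar> \<le> B" using g by (rule bdd_integrable_bound) auto
      have "\<bar>g y - g x\<bar> \<le> 2 * B" for y using B[of y] B[of x] by simp
      then have "(g y - g x)\<^sup>2 \<le> (2 * B)\<^sup>2" for y
        using power_mono[of "\<bar>g y - g x\<bar>" "2 * B" 2] by simp
      then show ?thesis
        using integrable_mult_bounded[OF k, of "\<lambda>y. (g y - g x)\<^sup>2" "(2 * B)\<^sup>2"] by (simp add: mult.commute)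
    qed
    have "(heat \<sigma> v x - v x)\<^sup>2 = (heat \<sigma> v x)\<^sup>2 - 2 * v x * heat \<sigma> v x + (v x)\<^sup>2"
      by (simp add: power2_diff algebra_simps)
    also have "\<dots> \<le> heat \<sigma> (\<lambda>y. (v y - v x)\<^sup>2) x"
      unfolding heat_square_diff[OF \<sigma> vb] using heat_jensen_square[OF \<sigma> vb, of x] by simp
    also have "\<dots> \<le> (LBINT y. L\<^sup>2 * (?k y * (f y - f x)\<^sup>2))"
      unfolding conv_def
    proof (rule integral_mono)
      fix y
      have "(v y - v x)\<^sup>2 \<le> L\<^sup>2 * (f y - f x)\<^sup>2"
        using power_mono[OF F[of "f y" "f x"], of 2] by (simp add: v_def power_mult_distrib)
      then show "?k y * (v y - v x)\<^sup>2 \<le> L\<^sup>2 * (?k y * (f y - f x)\<^sup>2)"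
        using mult_left_mono[of "(v y - v x)\<^sup>2" "L\<^sup>2 * (f y - f x)\<^sup>2" "?k y"] by (simp add: mult.left_commute)
    qed (use ik[OF vb] ik[OF f(1)] in auto)
    finally show ?thesis by (simp add: conv_def)
  qed
  have i1: "integrable lborel (\<lambda>x. f x * heat \<sigma> f x)" "integrable lborel (\<lambda>x. (f x)\<^sup>2)"
      "integrable lborel (\<lambda>x. \<bar>f x - heat \<sigma> f x\<bar>)" "integrable lborel (\<lambda>x. f x * (f x - heat \<sigma> f x))"
      "integrable lborel (\<lambda>x. (heat \<sigma> v x - v x)\<^sup>2)"
    using f \<sigma> fi vi vb
    by (intro bdd_integrableD(1) bdd_integrable_mult bdd_integrable_abs bdd_integrable_diff
        bdd_integrable_power bdd_integrable_heat; simp)+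
  have "(LBINT x. (heat \<sigma> v x - v x)\<^sup>2) \<le> (LBINT x. L\<^sup>2 * heat \<sigma> (\<lambda>y. (f y - f x)\<^sup>2) x)"
    by (rule integral_mono) (use i1 pt integral_heat_square_diff(1)[OF \<sigma>2 f(1)] in auto)
  also have "\<dots> = L\<^sup>2 * (2 * (LBINT x. f x * (f x - heat \<sigma> f x)))"
    using integral_heat_square_diff(2)[OF \<sigma>2 f(1)] heat_defect_eq[OF \<sigma>2 f(1)] i1
    by (simp add: right_diff_distrib power2_eq_square)
  also have "(LBINT x. f x * (f x - heat \<sigma> f x)) \<le> (LBINT x. M * \<bar>f x - heat \<sigma> f x\<bar>)"
  proof (rule integral_mono)
    fix x
    have "f x * (f x - heat \<sigma> f x) \<le> \<bar>f x\<bar> * \<bar>f x - heat \<sigma> f x\<bar>" by (simp flip: abs_mult)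
    also have "\<dots> \<le> M * \<bar>f x - heat \<sigma> f x\<bar>" using f(2) by (intro mult_right_mono) auto
    finally show "f x * (f x - heat \<sigma> f x) \<le> M * \<bar>f x - heat \<sigma> f x\<bar>" .
  qed (use i1 in auto)
  finally show ?thesis by (simp add: v_def[abs_def] mult.assoc mult_left_mono)
qed

subsection \<open>Entropy dissipation\<close>

lemma entropy_square: "entropy M 2 (\<lambda>x. x\<^sup>2) (\<lambda>x. 2 * x) (\<lambda>_. 2)"
  unfolding entropy_def by (auto intro!: derivative_eq_intros)

context bounded_mild_solution
begin

text \<open>The source is separated from its smoothing (A), and from F of the regularised solution
  at the start of the step (B). Both are small in L^2 because the L^1 distances are small and all
  functions are bounded by M. The threshold is uniform in t, so it serves every step of a
  grid.\<close>

lemma source_close: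
  assumes "0 < \<kappa>"
  shows "\<exists>\<delta>>0. \<forall>t s \<rho> \<sigma>. 0 \<le> t \<and> t \<le> s \<and> s \<le> t + \<delta> \<and> s \<le> T \<and> 0 < s \<and> 0 < \<rho> \<and> \<rho> \<le> \<delta> \<and> 0 < \<sigma> \<and> \<sigma> \<le> \<delta> \<longrightarrow>
    (LBINT x. (heat \<sigma> (source s) x - F (heat \<rho> (u t) x))\<^sup>2) \<le> \<kappa>\<^sup>2"
proof -
  \<comment> \<open>The squares of A and B contribute 2 and 4 times
    \<open>L\<^sup>2 * M * \<eta>\<close>; the square of the sum doubles this to 12. The added 1
    keeps the denominator positive.\<close>
  define \<eta> where "\<eta> = \<kappa>\<^sup>2 / (12 * L\<^sup>2 * M + 1)"
  have den: "0 < 12 * L\<^sup>2 * M + 1" by (simp add: add_nonneg_pos)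
  have \<eta>: "0 < \<eta>" "12 * L\<^sup>2 * M * \<eta> \<le> \<kappa>\<^sup>2"
    using assms den by (auto simp: \<eta>_def divide_simps mult.commute intro!: mult_left_mono)
  obtain \<delta>1 where \<delta>1: "0 < \<delta>1"
    "\<And>t \<sigma>. t \<in> {0..T} \<Longrightarrow> \<sigma> \<in> {0<..\<delta>1} \<Longrightarrow> (LBINT x. \<bar>u t x - heat \<sigma> (u t) x\<bar>) \<le> \<eta>"
    using heat_L1_approx[OF \<eta>(1), of T] by blast
  obtain \<delta>2 where \<delta>2: "0 < \<delta>2"
    "\<And>s t. s \<in> {0..T} \<Longrightarrow> t \<in> {0..T} \<Longrightarrow> \<bar>s - t\<bar> \<le> \<delta>2 \<Longrightarrow> (LBINT x. \<bar>u s x - u t x\<bar>) \<le> \<eta>"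
    using L1_uniformly_continuous[OF \<eta>(1), of T] by blast
  have "(LBINT x. (heat \<sigma> (source s) x - F (heat \<rho> (u t) x))\<^sup>2) \<le> \<kappa>\<^sup>2"
    if t: "0 \<le> t" "t \<le> s" "s \<le> t + min \<delta>1 \<delta>2" "s \<le> T" "0 < s"
      and \<rho>: "0 < \<rho>" "\<rho> \<le> min \<delta>1 \<delta>2" and \<sigma>: "0 < \<sigma>" "\<sigma> \<le> min \<delta>1 \<delta>2" for t s \<rho> \<sigma>
  proof -
    define w where "w = heat \<rho> (u t)"
    have ui: "integrable lborel (u t)" "integrable lborel (u s)" using t u_integrable by auto
    have ub: "bdd_integrable (u t)" "bdd_integrable (u s)" using t bdd_integrable_u by auto
    have w: "bdd_integrable w" "\<And>x. \<bar>w x\<bar> \<le> M"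
      using \<rho> ui t heat_abs_le[OF \<rho>(1) ui(1) u_bound[OF t(1)]] by (auto simp: w_def)
    have [measurable]: "w \<in> borel_measurable borel" using w by (auto intro: bdd_integrableD)
    have Fw: "bdd_integrable (\<lambda>x. F (w x))"
      by (rule bdd_integrable_dominated[OF w(1), of _ L]) (use F_abs_le in auto)
    have src: "source s = (\<lambda>y. F (u s y))" using t by (auto simp: source_def)
    define A where "A x = heat \<sigma> (source s) x - source s x" for x
    define B where "B x = source s x - F (w x)" for x
    have AB: "bdd_integrable A" "bdd_integrable B"
      unfolding A_def B_def using \<sigma> by (auto intro!: bdd_integrable_diff bdd_integrable_source Fw)
    have AB2: "integrable lborel (\<lambda>x. (A x)\<^sup>2)" "integrable lborel (\<lambda>x. (B x)\<^sup>2)" "integrable lborel (\<lambda>x. (A x + B x)\<^sup>2)"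
      by (intro bdd_integrableD(1) bdd_integrable_power AB bdd_integrable_add; simp)+
    have "(LBINT x. (A x)\<^sup>2) \<le> L\<^sup>2 * (2 * M * (LBINT x. \<bar>u s x - heat \<sigma> (u s) x\<bar>))"
      unfolding A_def src
      by (rule heat_lipschitz_close) (use ub t u_bound \<sigma> F_lipschitz bdd_integrable_source[of s] in \<open>auto simp: src\<close>)
    also have "\<dots> \<le> L\<^sup>2 * (2 * M * \<eta>)"
      using t \<sigma> by (intro mult_left_mono \<delta>1(2)) auto
    finally have A: "(LBINT x. (A x)\<^sup>2) \<le> L\<^sup>2 * (2 * M * \<eta>)" .
    have tri: "(LBINT x. \<bar>u s x - w x\<bar>) \<le> \<eta> + \<eta>"
    proof -
      have wi: "integrable lborel w" using w by (auto intro: bdd_integrableD)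
      have "(LBINT x. \<bar>u s x - w x\<bar>) \<le> (LBINT x. \<bar>u s x - u t x\<bar> + \<bar>u t x - w x\<bar>)"
        by (rule integral_mono) (use ui wi in auto)
      also have "\<dots> = (LBINT x. \<bar>u s x - u t x\<bar>) + (LBINT x. \<bar>u t x - w x\<bar>)"
        using ui wi by simp
      also have "\<dots> \<le> \<eta> + \<eta>"
        unfolding w_def using t \<rho> by (intro add_mono \<delta>1(2) \<delta>2(2)) auto
      finally show ?thesis .
    qed
    have "(LBINT x. (B x)\<^sup>2) \<le> (LBINT x. L\<^sup>2 * (2 * M * \<bar>u s x - w x\<bar>))"
    proof (rule integral_mono)
      fix x
      have "(B x)\<^sup>2 \<le> (L * \<bar>u s x - w x\<bar>)\<^sup>2"
        unfolding B_def src using power_mono[OF F_lipschitz[of "u s x" "w x"], of 2] by simp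
      also have "\<dots> = L\<^sup>2 * (\<bar>u s x - w x\<bar> * \<bar>u s x - w x\<bar>)"
        by (simp only: power_mult_distrib) (simp add: power2_eq_square)
      also have "\<dots> \<le> L\<^sup>2 * (2 * M * \<bar>u s x - w x\<bar>)"
        using u_bound[of s x] w(2)[of x] t by (intro mult_left_mono mult_right_mono) auto
      finally show "(B x)\<^sup>2 \<le> L\<^sup>2 * (2 * M * \<bar>u s x - w x\<bar>)" .
    qed (use AB2 ui w in \<open>auto dest: bdd_integrableD\<close>)
    also have "\<dots> = L\<^sup>2 * (2 * M * (LBINT x. \<bar>u s x - w x\<bar>))" by simp
    also have "\<dots> \<le> L\<^sup>2 * (2 * M * (\<eta> + \<eta>))"
      using tri by (intro mult_left_mono) auto
    finally have B: "(LBINT x. (B x)\<^sup>2) \<le> L\<^sup>2 * (2 * M * (\<eta> + \<eta>))" .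
    have "(LBINT x. (heat \<sigma> (source s) x - F (w x))\<^sup>2) = (LBINT x. (A x + B x)\<^sup>2)"
      by (simp add: A_def B_def)
    also have "\<dots> \<le> (LBINT x. 2 * (A x)\<^sup>2 + 2 * (B x)\<^sup>2)"
    proof (rule integral_mono)
      show "(A x + B x)\<^sup>2 \<le> 2 * (A x)\<^sup>2 + 2 * (B x)\<^sup>2" for x
        using zero_le_power2[of "A x - B x"] by (simp add: power2_sum power2_diff)
    qed (use AB2 in auto)
    also have "\<dots> = 2 * (LBINT x. (A x)\<^sup>2) + 2 * (LBINT x. (B x)\<^sup>2)" using AB2 by simp
    also have "\<dots> \<le> 2 * (L\<^sup>2 * (2 * M * \<eta>)) + 2 * (L\<^sup>2 * (2 * M * (\<eta> + \<eta>)))"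
      by (intro add_mono mult_left_mono A B) auto
    also have "\<dots> = 12 * L\<^sup>2 * M * \<eta>" by (simp add: algebra_simps)
    also have "\<dots> \<le> \<kappa>\<^sup>2" by (rule \<eta>(2))
    finally show ?thesis by (simp add: w_def)
  qed
  then show ?thesis using \<delta>1(1) \<delta>2(1) by (intro exI[of _ "min \<delta>1 \<delta>2"]) auto
qed

definition dissipation_const :: real where
  "dissipation_const = 2 ^ (CARD('n) + 1) * (norm a)\<^sup>2"

lemma dissipation_const_nonneg [simp]: "0 \<le> dissipation_const"
  by (simp add: dissipation_const_def)

text \<open>Product of the supremum bound and the L^1 bound for the regularised Duhamel integral
  over a step of length h, divided by h sqrt h.\<close>

definition remainder_const :: "real \<Rightarrow> real \<Rightarrow> real" where
  "remainder_const \<epsilon> M1 = grad_const * (L * M) / sqrt \<epsilon> * (grad_const * (L * M1) * 2)"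

text \<open>Taylor expansion at the heat flow \<open>w\<close>, with the regularised Duhamel
  integral \<open>r\<close> as increment. The quadratic term is the supremum of |r| times its L^1
  norm. In the linear term Fubini puts the time integral outside, and
  \<open>entropy_production_le\<close> applies for each s with the same comparison function
  \<open>w\<close>; h times the squared gradient is then bounded by the defect.\<close>

lemma entropy_step:
  assumes ent: "entropy M K \<Phi> \<Phi>' \<Phi>''"
    and t: "0 \<le> t" and h: "0 < h" and \<epsilon>: "0 < \<epsilon>" and \<kappa>: "0 < \<kappa>"
    and M1: "\<And>s. 0 \<le> s \<Longrightarrow> s \<le> t + h \<Longrightarrow> (LBINT x. \<bar>u s x\<bar>) \<le> M1"
    and close: "\<And>s. t < s \<Longrightarrow> s < t + h \<Longrightarrow>
      (LBINT x. (heat (t + h + \<epsilon> - s) (source s) x - F (heat (h + \<epsilon>) (u t) x))\<^sup>2) \<le> \<kappa>\<^sup>2"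
  shows "(LBINT x. \<Phi> (heat \<epsilon> (u (t + h)) x)) \<le> (LBINT x. \<Phi> (heat h (heat \<epsilon> (u t)) x))
    + (K * \<kappa> / 2 * (dissipation_const * heat_defect h (heat \<epsilon> (u t)) + h) + K * remainder_const \<epsilon> M1 * (h * sqrt h))"
proof -
  define v where "v = heat \<epsilon> (u t)"
  define w where "w = heat h v"
  define r where "r = duhamel t (t + h) (t + h + \<epsilon>)"
  have th: "0 \<le> t + h" using t h by simp
  have ui: "integrable lborel (u t)" "integrable lborel (u (t + h))" using t th u_integrable by auto
  have v: "bdd_integrable v" "\<And>x. \<bar>v x\<bar> \<le> M"
    using \<epsilon> ui heat_abs_le[OF \<epsilon> ui(1) u_bound[OF t]] by (auto simp: v_def)
  have vi: "integrable lborel v" using v by (auto intro: bdd_integrableD)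
  have w: "bdd_integrable w" "\<And>x. \<bar>w x\<bar> \<le> M"
    using h vi heat_abs_le[OF h vi v(2)] by (auto simp: w_def)
  have w_eq: "w = heat (h + \<epsilon>) (u t)"
    unfolding w_def v_def by (rule heat_heat[OF h \<epsilon> ui(1)])
  have z_eq: "heat \<epsilon> (u (t + h)) x = w x + r x" for x
    using heat_step[OF t less_imp_le[OF h] \<epsilon>, of x] by (simp add: w_eq r_def add.commute)
  have z: "bdd_integrable (heat \<epsilon> (u (t + h)))" "\<And>x. \<bar>heat \<epsilon> (u (t + h)) x\<bar> \<le> M"
    using \<epsilon> ui heat_abs_le[OF \<epsilon> ui(2) u_bound[OF th]] by auto
  have r: "bdd_integrable r"
    using bdd_integrable_diff[OF z(1) w(1)] by (simp add: z_eq)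
  have M1': "0 \<le> M1" using order_trans[OF _ M1[of 0]] th by (simp add: Bochner_Integration.integral_nonneg)
  have K: "0 \<le> K" by (rule entropy_const_nonneg[OF ent M_nonneg])
  note meas = entropy_measurable[OF ent M_nonneg]
  have [measurable]: "w \<in> borel_measurable borel" using w by (auto intro: bdd_integrableD)
  have \<Phi>'w: "bdd_integrable (\<lambda>x. \<Phi>' (w x))" and \<Phi>w: "bdd_integrable (\<lambda>x. \<Phi> (w x))"
    using bdd_integrable_entropy[OF ent M_nonneg w] by auto
  have i: "integrable lborel (\<lambda>x. \<Phi> (w x))" "integrable lborel (\<lambda>x. \<Phi>' (w x) * r x)" "integrable lborel (\<lambda>x. (r x)\<^sup>2)"
    "integrable lborel (\<lambda>x. \<bar>r x\<bar>)"
    using \<Phi>'w \<Phi>w r by (auto intro!: bdd_integrableD(1))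
  have "(LBINT x. \<Phi> (heat \<epsilon> (u (t + h)) x)) \<le> (LBINT x. \<Phi> (w x) + \<Phi>' (w x) * r x + K * (r x)\<^sup>2)"
  proof (rule integral_mono)
    show "\<Phi> (heat \<epsilon> (u (t + h)) x) \<le> \<Phi> (w x) + \<Phi>' (w x) * r x + K * (r x)\<^sup>2" for x
      using entropy_taylor[OF ent M_nonneg w(2)[of x] z(2)[of x]] by (simp add: z_eq)
    show "integrable lborel (\<lambda>x. \<Phi> (heat \<epsilon> (u (t + h)) x))"
      by (intro bdd_integrableD(1) bdd_integrable_entropy[OF ent M_nonneg z])
  qed (use i in auto)
  also have "\<dots> = (LBINT x. \<Phi> (w x)) + (LBINT x. \<Phi>' (w x) * r x) + K * (LBINT x. (r x)\<^sup>2)"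
    using i by simp
  also have "(LBINT x. (r x)\<^sup>2) \<le> remainder_const \<epsilon> M1 * (h * sqrt h)"
  proof -
    have rb: "\<bar>r x\<bar> \<le> grad_const * (L * M) / sqrt \<epsilon> * h" for x
      using duhamel_sup[of t "t + h" \<epsilon> x] h \<epsilon> by (simp add: r_def)
    have "(LBINT x. (r x)\<^sup>2) \<le> (LBINT x. grad_const * (L * M) / sqrt \<epsilon> * h * \<bar>r x\<bar>)"
    proof (rule integral_mono)
      show "(r x)\<^sup>2 \<le> grad_const * (L * M) / sqrt \<epsilon> * h * \<bar>r x\<bar>" for x
        using mult_right_mono[OF rb[of x], of "\<bar>r x\<bar>"] by (simp add: power2_eq_square flip: abs_mult)
    qed (use i in auto)
    also have "\<dots> = grad_const * (L * M) / sqrt \<epsilon> * h * (LBINT x. \<bar>r x\<bar>)" by simp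
    also have "\<dots> \<le> grad_const * (L * M) / sqrt \<epsilon> * h * (grad_const * (L * M1) * (2 * sqrt h))"
      using duhamel_L1(2)[OF t _ _ M1, of "t + h" "t + h + \<epsilon>"] h \<epsilon>
      by (intro mult_left_mono) (auto simp: r_def)
    finally show ?thesis by (simp add: remainder_const_def mult_ac)
  qed
  also have "(LBINT x. \<Phi>' (w x) * r x) \<le> K * \<kappa> / 2 * (dissipation_const * heat_defect h v + h)"
  proof -
    define G where "G = (LBINT x. (grad_heat a h v x)\<^sup>2)"
    let ?I = "\<lambda>s. LBINT x. \<Phi>' (w x) * grad_heat a (t + h + \<epsilon> - s) (source s) x"
    obtain B where B: "\<And>x. \<bar>\<Phi>' (w x)\<bar> \<le> B" using \<Phi>'w by (rule bdd_integrable_bound) auto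
    have m: "(\<lambda>x. \<Phi>' (w x)) \<in> borel_measurable borel" using \<Phi>'w by (rule bdd_integrableD)
    have T: "t \<le> t + h" "t + h \<le> t + h + \<epsilon>" using h \<epsilon> by auto
    note fub = duhamel_fubini[OF t T M1 m B]
    have "(LBINT x. \<Phi>' (w x) * r x) = (LBINT s. indicator {t<..<t + h} s * ?I s)"
      unfolding r_def by (rule fub(2))
    also have "\<dots> \<le> (LBINT s. K * \<kappa> / 2 * (G + 1) * indicator {t<..<t + h} s)"
    proof (rule integral_mono)
      show "integrable lborel (\<lambda>s. indicator {t<..<t + h} s * ?I s)" by (rule fub(1))
      show "integrable lborel (\<lambda>s. K * \<kappa> / 2 * (G + 1) * indicator {t<..<t + h} s)" using h by simp
      show "indicator {t<..<t + h} s * ?I s \<le> K * \<kappa> / 2 * (G + 1) * indicator {t<..<t + h} s" for s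
      proof (cases "s \<in> {t<..<t + h}")
        case True
        have "?I s \<le> K * \<kappa> / 2 * (G + 1)"
          unfolding G_def w_def
        proof (rule entropy_production_le[OF ent M_nonneg v h])
          show "(LBINT x. (heat (t + h + \<epsilon> - s) (source s) x - F (heat h v x))\<^sup>2) \<le> \<kappa>\<^sup>2"
            using close[of s] True unfolding w_eq[symmetric] w_def by auto
        qed (use True \<epsilon> \<kappa> F_continuous F_abs_le bdd_integrable_source in auto)
        then show ?thesis using True by simp
      qed simp
    qed
    also have "\<dots> = K * \<kappa> / 2 * (h * G + h)" using h by (simp add: algebra_simps)
    also have "\<dots> \<le> K * \<kappa> / 2 * (dissipation_const * heat_defect h v + h)"
      using K \<kappa> grad_heat_defect[OF h v(1), of a]
      by (intro mult_left_mono add_right_mono) (auto simp: G_def dissipation_const_def)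
    finally show ?thesis .
  qed
  finally show ?thesis using K by (simp add: v_def w_def mult_left_mono mult.assoc)
qed

lemma integral_entropy_le:
  assumes ent: "entropy M K \<Phi> \<Phi>' \<Phi>''" and w: "bdd_integrable w" "\<And>x. \<bar>w x\<bar> \<le> M"
  shows "(LBINT x. \<Phi> (w x)) \<le> K * M * (LBINT x. \<bar>w x\<bar>)"
proof -
  have "(LBINT x. \<Phi> (w x)) \<le> (LBINT x. K * M * \<bar>w x\<bar>)"
  proof (rule integral_mono)
    show "\<Phi> (w x) \<le> K * M * \<bar>w x\<bar>" for x
      using entropy_abs_le[OF ent M_nonneg w(2)[of x]] by simp
    show "integrable lborel (\<lambda>x. \<Phi> (w x))"
      by (intro bdd_integrableD(1) bdd_integrable_entropy[OF ent M_nonneg w])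
  qed (use w in \<open>auto dest: bdd_integrableD\<close>)
  then show ?thesis by simp
qed

text \<open>The step inequalities on the uniform grid with n steps. Of the errors only sign and sum
  are kept; with the sign, any partial sum is bounded by the total.\<close>

definition grid_dissipative :: "(real \<Rightarrow> real) \<Rightarrow> real \<Rightarrow> real \<Rightarrow> real \<Rightarrow> real \<Rightarrow> nat \<Rightarrow> bool" where
  "grid_dissipative \<Phi> t0 t1 \<eta> \<epsilon> n \<longleftrightarrow> (\<exists>e. (\<forall>i. 0 \<le> e i) \<and> sum e {..<n} \<le> \<eta> \<and>
    (\<forall>i<n. (LBINT x. \<Phi> (heat \<epsilon> (u (t0 + real (Suc i) * ((t1 - t0) / real n))) x)) \<le>
      (LBINT x. \<Phi> (heat ((t1 - t0) / real n) (heat \<epsilon> (u (t0 + real i * ((t1 - t0) / real n)))) x)) + e i))"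

text \<open>Summed over a fine time grid, the errors of \<open>entropy_step\<close> are small: the quadratic entropy
  bounds the sum of the defects, and \<open>\<kappa>\<close> is chosen before \<open>\<epsilon>\<close> and \<open>\<epsilon>\<close> before \<open>n\<close>.\<close>

lemma entropy_steps:
  assumes ent: "entropy M K \<Phi> \<Phi>' \<Phi>''" and t: "0 \<le> t0" "t0 < t1" and \<eta>: "0 < \<eta>"
  shows "\<exists>\<delta>>0. \<forall>\<epsilon>\<in>{0<..\<delta>}. \<exists>N>0. \<forall>n\<ge>N. grid_dissipative \<Phi> t0 t1 \<eta> \<epsilon> n"
proof -
  define \<tau> where "\<tau> = t1 - t0"
  have \<tau>: "0 < \<tau>" using t by (simp add: \<tau>_def)
  obtain M1 where M1: "0 \<le> M1" "\<And>s. 0 \<le> s \<Longrightarrow> s \<le> t1 \<Longrightarrow> (LBINT x. \<bar>u s x\<bar>) \<le> M1"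
    using L1_norm_bounded[of t1] by (metis atLeastAtMost_iff)
  have K: "0 \<le> K" by (rule entropy_const_nonneg[OF ent M_nonneg])
  define Ca where "Ca = dissipation_const"
  have Ca: "0 \<le> Ca" by (simp add: Ca_def)
  \<comment> \<open>The bracket is the bound for the sum of the defects reached in
    \<open>sumD\<close>, and the last \<open>\<tau>\<close> is the sum of the step lengths. Hence K
    \<kappa> Q / 2 bounds the total error of first kind.\<close>
  define Q where "Q = Ca * (4 * M * M1 + 2 * \<tau> + 1) + \<tau>"
  have Q: "0 \<le> Q" using Ca M1 \<tau> by (simp add: Q_def)
  \<comment> \<open>The bound 1 / (2 Ca + 1) allows the defect to be absorbed in
    \<open>D_le\<close>, the last one puts the total error of first kind below \<eta> / 2; adding 1
    avoids vanishing denominators.\<close>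
  define \<kappa> where "\<kappa> = min (min 1 (1 / (2 * Ca + 1))) (\<eta> / (K * Q + 1))"
  have \<kappa>: "0 < \<kappa>" "\<kappa> \<le> 1" "\<kappa> * Ca \<le> 1 / 2" "K * \<kappa> * Q \<le> \<eta>"
  proof -
    show "0 < \<kappa>" using Ca K Q \<eta> by (simp add: \<kappa>_def add_nonneg_pos)
    show "\<kappa> \<le> 1" by (simp add: \<kappa>_def)
    have "\<kappa> * Ca \<le> 1 / (2 * Ca + 1) * Ca" by (rule mult_right_mono) (use Ca in \<open>auto simp: \<kappa>_def\<close>)
    also have "\<dots> \<le> 1 / 2" using Ca by (simp add: divide_simps)
    finally show "\<kappa> * Ca \<le> 1 / 2" .
    have KQ: "0 < K * Q + 1" using K Q by (simp add: add_nonneg_pos)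
    have "\<kappa> * (K * Q) \<le> \<eta> / (K * Q + 1) * (K * Q)" by (rule mult_right_mono) (use K Q in \<open>auto simp: \<kappa>_def\<close>)
    also have "\<dots> \<le> \<eta>" using KQ \<eta> by (simp add: divide_simps algebra_simps)
    finally show "K * \<kappa> * Q \<le> \<eta>" by (simp add: mult_ac)
  qed
  obtain \<delta> where \<delta>: "0 < \<delta>" "\<And>t s \<rho> \<sigma>. 0 \<le> t \<Longrightarrow> t \<le> s \<Longrightarrow> s \<le> t + \<delta> \<Longrightarrow> s \<le> t1 \<Longrightarrow> 0 < s \<Longrightarrow> 0 < \<rho> \<Longrightarrow>
      \<rho> \<le> \<delta> \<Longrightarrow> 0 < \<sigma> \<Longrightarrow> \<sigma> \<le> \<delta> \<Longrightarrow> (LBINT x. (heat \<sigma> (source s) x - F (heat \<rho> (u t) x))\<^sup>2) \<le> \<kappa>\<^sup>2"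
    using source_close[OF \<kappa>(1), of t1] by blast
  show ?thesis
  proof (intro exI[of _ "\<delta> / 2"] conjI ballI)
    show "0 < \<delta> / 2" using \<delta> by simp
    fix \<epsilon> assume \<epsilon>': "\<epsilon> \<in> {0<..\<delta> / 2}"
    then have \<epsilon>: "0 < \<epsilon>" by simp
    define R where "R = remainder_const \<epsilon> M1"
    have R: "0 \<le> R" using \<epsilon> M1 by (simp add: R_def remainder_const_def)
    define c where "c = (K + 1) * (R * \<tau> + 1)"
    \<comment> \<open>A threshold for sqrt h, fixed after \<epsilon> because R contains 1 / sqrt
      \<epsilon>. The errors of order h^(3/2) add up to a multiple of R \<tau> sqrt h.\<close>
    define y where "y = min 1 (\<eta> / 2) / (8 * c)"
    have c: "0 < c" using K R \<tau> unfolding c_def by (intro mult_pos_pos add_nonneg_pos) auto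
    have y: "0 < y" using c \<eta> by (simp add: y_def)
    have y1: "8 * (c * y) = min 1 (\<eta> / 2)" using c by (simp add: y_def)
    have big: "R * \<tau> \<le> c" "K * (R * \<tau>) \<le> c"
      using K R \<tau> by (auto simp: c_def algebra_simps)
    have y2: "8 * (R * \<tau> * y) \<le> 1" "8 * (K * (R * \<tau>) * y) \<le> \<eta> / 2"
      using mult_right_mono[OF big(1), of y] mult_right_mono[OF big(2), of y] y1 y by linarith+
    define m where "m = min (\<delta> / 2) (y\<^sup>2)"
    have m: "0 < m" using \<delta>(1) y by (simp add: m_def)
    define N where "N = Suc (nat \<lceil>\<tau> / m\<rceil>)"
    show "\<exists>N>0. \<forall>n\<ge>N. grid_dissipative \<Phi> t0 t1 \<eta> \<epsilon> n"
    proof (intro exI[of _ N] conjI allI impI)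
      show "0 < N" by (simp add: N_def)
      fix n assume n: "N \<le> n"
      have n0: "0 < n" using n by (simp add: N_def)
      define h where "h = \<tau> / real n"
      have h: "0 < h" using \<tau> n0 by (simp add: h_def)
      have "\<tau> / m \<le> real n" using n unfolding N_def by linarith
      then have "h \<le> m"
        using n0 m by (simp add: h_def pos_divide_le_eq mult.commute)
      then have h_le: "h \<le> min (\<delta> / 2) (y\<^sup>2)" by (simp add: m_def)
      have nh: "real n * h = \<tau>" using n0 by (simp add: h_def)
      have sh: "sqrt h \<le> y" using h_le y by (intro real_le_lsqrt) auto
      define T where "T i = t0 + real i * h" for i
      have T0: "0 \<le> T i" for i using t h by (simp add: T_def)
      have TS: "T (Suc i) = T i + h" for i by (simp add: T_def algebra_simps)
      have T1: "T i + h \<le> t1" if "i < n" for i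
      proof -
        have "real (Suc i) * h \<le> real n * h" using that h by (intro mult_right_mono) auto
        then show ?thesis using nh by (simp add: T_def \<tau>_def algebra_simps)
      qed
      define v where "v i = heat \<epsilon> (u (T i))" for i
      define D where "D i = heat_defect h (v i)" for i
      have ui: "integrable lborel (u (T i))" for i using T0 u_integrable by auto
      have v: "bdd_integrable (v i)" "\<And>x. \<bar>v i x\<bar> \<le> M" for i
        using \<epsilon> ui heat_abs_le[OF \<epsilon> ui u_bound[OF T0]] by (auto simp: v_def)
      have D: "0 \<le> D i" for i unfolding D_def by (rule heat_defect_nonneg[OF h v(1)])
      have step: "(LBINT x. \<Psi> (v (Suc i) x)) \<le> (LBINT x. \<Psi> (heat h (v i) x))
          + (C * \<kappa> / 2 * (Ca * D i + h) + C * R * (h * sqrt h))"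
        if "entropy M C \<Psi> \<Psi>' \<Psi>''" "i < n" for \<Psi> \<Psi>' \<Psi>'' C i
        unfolding D_def v_def TS Ca_def R_def
      proof (rule entropy_step[OF that(1) T0 h \<epsilon> \<kappa>(1)])
        show "(LBINT x. \<bar>u s x\<bar>) \<le> M1" if "0 \<le> s" "s \<le> T i + h" for s
          using that T1[OF \<open>i < n\<close>] by (intro M1) auto
        show "(LBINT x. (heat (T i + h + \<epsilon> - s) (source s) x - F (heat (h + \<epsilon>) (u (T i)) x))\<^sup>2) \<le> \<kappa>\<^sup>2"
          if "T i < s" "s < T i + h" for s
          using that T0[of i] T1[OF \<open>i < n\<close>] h h_le \<epsilon>' by (intro \<delta>(2)) auto
      qed
      \<comment> \<open>The step inequality for the quadratic entropy bounds the defect by a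
        telescoping difference, but its error contains the defect again; since \<kappa> Ca \<le>
        1/2, half of it is absorbed on the left.\<close>
      have D_le: "D i \<le> 2 * ((LBINT x. (v i x)\<^sup>2) - (LBINT x. (v (Suc i) x)\<^sup>2)) + (2 * \<kappa> * h + 4 * R * (h * sqrt h))"
        if "i < n" for i
      proof -
        have "(LBINT x. (v (Suc i) x)\<^sup>2) \<le> (LBINT x. (heat h (v i) x)\<^sup>2)
          + (\<kappa> * (Ca * D i + h) + 2 * R * (h * sqrt h))"
          using step[OF entropy_square that] by simp
        also have "(LBINT x. (heat h (v i) x)\<^sup>2) = (LBINT x. (v i x)\<^sup>2) - D i"
          by (simp add: D_def heat_defect_def)
        finally have "D i - \<kappa> * Ca * D i \<le> (LBINT x. (v i x)\<^sup>2) - (LBINT x. (v (Suc i) x)\<^sup>2) + (\<kappa> * h + 2 * R * (h * sqrt h))"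
          by (simp add: algebra_simps)
        moreover have "\<kappa> * Ca * D i \<le> 1 / 2 * D i" by (rule mult_right_mono[OF \<kappa>(3) D])
        moreover have "d \<le> 2 * X + 2 * Y" if "d - p \<le> X + Y" "p \<le> 1 / 2 * d" for d p X Y :: real
          using that by linarith
        ultimately have "D i \<le> 2 * ((LBINT x. (v i x)\<^sup>2) - (LBINT x. (v (Suc i) x)\<^sup>2)) + 2 * (\<kappa> * h + 2 * R * (h * sqrt h))"
          by blast
        then show ?thesis by (simp add: distrib_left mult.assoc)
      qed
      have sumD: "(\<Sum>i<n. D i) \<le> 4 * M * M1 + 2 * \<tau> + 1"
      proof -
        have "(\<Sum>i<n. D i) \<le> (\<Sum>i<n. 2 * ((LBINT x. (v i x)\<^sup>2) - (LBINT x. (v (Suc i) x)\<^sup>2)) + (2 * \<kappa> * h + 4 * R * (h * sqrt h)))"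
          by (rule sum_mono) (use D_le in auto)
        also have "\<dots> = 2 * ((LBINT x. (v 0 x)\<^sup>2) - (LBINT x. (v n x)\<^sup>2)) + real n * (2 * \<kappa> * h + 4 * R * (h * sqrt h))"
          unfolding sum.distrib sum_distrib_left[symmetric]
            sum_lessThan_telescope'[of "\<lambda>i. LBINT x. (v i x)\<^sup>2" n] by (simp add: distrib_left)
        also have "real n * (2 * \<kappa> * h + 4 * R * (h * sqrt h)) = (real n * h) * (2 * \<kappa> + 4 * R * sqrt h)"
          by (simp add: algebra_simps)
        also have "\<dots> = 2 * \<tau> * \<kappa> + 4 * (R * \<tau> * sqrt h)" unfolding nh by (simp add: algebra_simps)
        also have "2 * ((LBINT x. (v 0 x)\<^sup>2) - (LBINT x. (v n x)\<^sup>2)) \<le> 4 * M * M1"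
        proof -
          have "(LBINT x. (v 0 x)\<^sup>2) \<le> 2 * M * (LBINT x. \<bar>v 0 x\<bar>)"
            by (rule integral_entropy_le[OF entropy_square v])
          also have "(LBINT x. \<bar>v 0 x\<bar>) \<le> M1"
            unfolding v_def using integral_heat_abs_le[OF \<epsilon> ui[of 0]] M1(2)[of "T 0"] T0[of 0] t
            by (auto simp: T_def)
          finally have "(LBINT x. (v 0 x)\<^sup>2) \<le> 2 * M * M1" by (simp add: mult_left_mono)
          moreover have "0 \<le> (LBINT x. (v n x)\<^sup>2)" by (rule Bochner_Integration.integral_nonneg) simp
          moreover have "2 * (p - q) \<le> 2 * r" if "p \<le> r" "0 \<le> q" for p q r :: real
            using that by simp
          ultimately have "2 * ((LBINT x. (v 0 x)\<^sup>2) - (LBINT x. (v n x)\<^sup>2)) \<le> 2 * (2 * M * M1)"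
            by blast
          then show ?thesis by simp
        qed
        also have "2 * \<tau> * \<kappa> \<le> 2 * \<tau>" using \<tau> \<kappa> by simp
        also have "4 * (R * \<tau> * sqrt h) \<le> 1"
          using mult_left_mono[OF sh, of "R * \<tau>"] y2(1) R \<tau> by simp
        finally show ?thesis by simp
      qed
      define e where "e i = K * \<kappa> / 2 * (Ca * D i + h) + K * R * (h * sqrt h)" for i
      have "sum e {..<n} = K * \<kappa> / 2 * (Ca * (\<Sum>i<n. D i) + real n * h) + K * R * sqrt h * (real n * h)"
      proof -
        have "e i = K * \<kappa> / 2 * Ca * D i + (K * \<kappa> / 2 * h + K * R * (h * sqrt h))" for i
          by (simp add: e_def distrib_left mult.assoc add_divide_distrib)
        then have "sum e {..<n} = (\<Sum>i<n. K * \<kappa> / 2 * Ca * D i + (K * \<kappa> / 2 * h + K * R * (h * sqrt h)))"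
          by (intro sum.cong refl)
        also have "\<dots> = K * \<kappa> / 2 * Ca * (\<Sum>i<n. D i) + real n * (K * \<kappa> / 2 * h + K * R * (h * sqrt h))"
          unfolding sum.distrib sum_distrib_left[symmetric] by (simp add: distrib_left)
        also have "\<dots> = K * \<kappa> / 2 * (Ca * (\<Sum>i<n. D i) + real n * h) + K * R * sqrt h * (real n * h)"
          by (simp add: algebra_simps add_divide_distrib)
        finally show ?thesis .
      qed
      also have "\<dots> = K * \<kappa> / 2 * (Ca * (\<Sum>i<n. D i) + \<tau>) + K * (R * \<tau>) * sqrt h"
        unfolding nh by (simp add: mult_ac)
      also have "\<dots> \<le> K * \<kappa> / 2 * Q + K * (R * \<tau>) * y"
        using K \<kappa> R \<tau> Ca sumD sh unfolding Q_def
        by (intro add_mono mult_left_mono add_right_mono) auto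
      also have "\<dots> \<le> \<eta> / 2 + \<eta> / 2"
      proof (rule add_mono)
        show "K * \<kappa> / 2 * Q \<le> \<eta> / 2" using \<kappa>(4) by simp
        have "0 \<le> K * (R * \<tau>) * y" using K R \<tau> y by simp
        then show "K * (R * \<tau>) * y \<le> \<eta> / 2" using y2(2) by linarith
      qed
      finally have se: "sum e {..<n} \<le> \<eta>" by simp
      have e0: "0 \<le> e i" for i using K \<kappa> Ca D h R by (simp add: e_def)
      have es: "(LBINT x. \<Phi> (v (Suc i) x)) \<le> (LBINT x. \<Phi> (heat h (v i) x)) + e i" if "i < n" for i
        unfolding e_def by (rule step[OF ent that])
      show "grid_dissipative \<Phi> t0 t1 \<eta> \<epsilon> n"
        using se e0 es unfolding grid_dissipative_def v_def T_def h_def \<tau>_def by (intro exI[of _ e]) auto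
    qed
  qed
qed

end

subsection \<open>Smoothing estimates\<close>

lemma entropy_power:
  assumes p: "2 \<le> p"
  shows "entropy M (real p * real (p - 1) * \<bar>M\<bar> ^ (p - 2)) (\<lambda>x. x ^ p)
    (\<lambda>x. real p * x ^ (p - 1)) (\<lambda>x. real p * real (p - 1) * x ^ (p - 2))"
  unfolding entropy_def
proof (intro conjI allI impI)
  show "((\<lambda>x. x ^ p) has_real_derivative real p * x ^ (p - 1)) (at x)" for x :: real
    using DERIV_pow[of p x] by simp
  show "((\<lambda>x. real p * x ^ (p - 1)) has_real_derivative real p * real (p - 1) * x ^ (p - 2)) (at x)" for x :: real
    using DERIV_cmult[OF DERIV_pow[of "p - 1" x], of "real p"] by (simp add: mult.assoc numeral_2_eq_2)
  show "\<bar>real p * real (p - 1) * x ^ (p - 2)\<bar> \<le> real p * real (p - 1) * \<bar>M\<bar> ^ (p - 2)" if "\<bar>x\<bar> \<le> M" for x :: real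
    using that by (simp add: abs_mult power_abs) (intro mult_left_mono power_mono; simp)
qed (use p in \<open>auto intro!: continuous_intros\<close>)

text \<open>Shifted by d to vanish at 0, as an entropy must. Its second derivative reaches 1 / d,
  which is harmless: d tends to 0 only after the time grid has been refined.\<close>

definition abs_approx :: "real \<Rightarrow> real \<Rightarrow> real" where
  "abs_approx d x = sqrt (x\<^sup>2 + d\<^sup>2) - d"

lemma entropy_abs_approx:
  assumes d: "0 < d"
  shows "entropy M (1 / d) (abs_approx d) (\<lambda>x. x / sqrt (x\<^sup>2 + d\<^sup>2)) (\<lambda>x. d\<^sup>2 / sqrt (x\<^sup>2 + d\<^sup>2) ^ 3)"
  unfolding entropy_def
proof (intro conjI allI impI)
  have pos: "0 < x\<^sup>2 + d\<^sup>2" for x using d by (simp add: add_nonneg_pos)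
  have q: "0 < sqrt (x\<^sup>2 + d\<^sup>2)" "(sqrt (x\<^sup>2 + d\<^sup>2))\<^sup>2 = x\<^sup>2 + d\<^sup>2" for x
    using pos[of x] by auto
  have dq: "((\<lambda>x. sqrt (x\<^sup>2 + d\<^sup>2)) has_real_derivative x / sqrt (x\<^sup>2 + d\<^sup>2)) (at x)" for x
  proof -
    have "((\<lambda>x. x\<^sup>2 + d\<^sup>2) has_real_derivative 2 * x) (at x)"
      by (auto intro!: derivative_eq_intros)
    from DERIV_chain2[OF DERIV_real_sqrt[OF pos] this] show ?thesis
      by (rule DERIV_cong) (simp add: inverse_eq_divide)
  qed
  show "(abs_approx d has_real_derivative x / sqrt (x\<^sup>2 + d\<^sup>2)) (at x)" for x
    unfolding abs_approx_def[abs_def] using DERIV_diff[OF dq DERIV_const[of d]] by simp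
  show "((\<lambda>x. x / sqrt (x\<^sup>2 + d\<^sup>2)) has_real_derivative d\<^sup>2 / sqrt (x\<^sup>2 + d\<^sup>2) ^ 3) (at x)" for x
  proof -
    define r where "r = sqrt (x\<^sup>2 + d\<^sup>2)"
    have r: "0 < r" "r * r = x * x + d * d" using q[of x] by (auto simp: r_def power2_eq_square)
    have "((\<lambda>x. x / sqrt (x\<^sup>2 + d\<^sup>2)) has_real_derivative (1 * r - x * (x / r)) / (r * r)) (at x)"
      unfolding r_def by (rule DERIV_divide[OF DERIV_ident dq]) (use d in simp)
    moreover have "(1 * r - x * (x / r)) / (r * r) = d\<^sup>2 / r ^ 3"
    proof -
      have "(1 * r - x * (x / r)) / (r * r) = (r * r - x * x) / (r * r * r)"
        using r(1) by (simp add: divide_simps)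
      then show ?thesis by (simp add: r(2) power2_eq_square power3_eq_cube)
    qed
    ultimately show ?thesis by (simp add: r_def)
  qed
  show "continuous_on UNIV (\<lambda>x. d\<^sup>2 / sqrt (x\<^sup>2 + d\<^sup>2) ^ 3)"
    using q(1) by (auto intro!: continuous_intros simp: less_imp_neq[THEN not_sym])
  show "\<bar>d\<^sup>2 / sqrt (x\<^sup>2 + d\<^sup>2) ^ 3\<bar> \<le> 1 / d" for x
  proof -
    have "d \<le> sqrt (x\<^sup>2 + d\<^sup>2)" using d by (intro real_le_rsqrt) auto
    then have "d ^ 3 \<le> sqrt (x\<^sup>2 + d\<^sup>2) ^ 3" using d by (intro power_mono) auto
    then show ?thesis using d q(1)[of x] by (simp add: divide_simps power2_eq_square power3_eq_cube)
  qed
qed (use d in \<open>auto simp: abs_approx_def\<close>)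

lemma abs_approx_bounds:
  assumes "0 < d"
  shows "0 \<le> abs_approx d x" "abs_approx d x \<le> \<bar>x\<bar>" "\<bar>x\<bar> - d \<le> abs_approx d x"
proof -
  show "0 \<le> abs_approx d x" unfolding abs_approx_def using assms by (simp add: real_le_rsqrt)
  have "sqrt (x\<^sup>2 + d\<^sup>2) \<le> \<bar>x\<bar> + d"
    using assms by (intro real_le_lsqrt) (auto simp: power2_sum)
  then show "abs_approx d x \<le> \<bar>x\<bar>" by (simp add: abs_approx_def)
  have "\<bar>x\<bar> \<le> sqrt (x\<^sup>2 + d\<^sup>2)" by (rule real_le_rsqrt) simp
  then show "\<bar>x\<bar> - d \<le> abs_approx d x" by (simp add: abs_approx_def)
qed

text \<open>Cauchy-Schwarz for the plane vectors (x, d) and (y, d).\<close>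

lemma abs_approx_tangent:
  assumes "0 < d"
  shows "abs_approx d x + x / sqrt (x\<^sup>2 + d\<^sup>2) * (y - x) \<le> abs_approx d y"
proof -
  define r where "r = sqrt (x\<^sup>2 + d\<^sup>2)"
  define s where "s = sqrt (y\<^sup>2 + d\<^sup>2)"
  have r: "0 < r" "r\<^sup>2 = x\<^sup>2 + d\<^sup>2" and s: "0 < s" "s\<^sup>2 = y\<^sup>2 + d\<^sup>2"
    using assms by (auto simp: r_def s_def add_nonneg_pos)
  have "(x * y + d\<^sup>2)\<^sup>2 \<le> (r * s)\<^sup>2"
  proof -
    have "(r * s)\<^sup>2 - (x * y + d\<^sup>2)\<^sup>2 = d\<^sup>2 * (x - y)\<^sup>2"
      unfolding power_mult_distrib r(2) s(2) by (simp add: power2_eq_square algebra_simps)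
    then show ?thesis by (metis diff_ge_0_iff_ge zero_le_mult_iff zero_le_power2)
  qed
  then have "x * y + d\<^sup>2 \<le> r * s"
    by (rule power2_le_imp_le) (use r s in simp)
  then have "r + x / r * (y - x) \<le> s"
    using r by (simp add: field_simps power2_eq_square)
  then show ?thesis by (simp add: abs_approx_def r_def s_def)
qed

lemma integral_heat_power_le:
  assumes h: "0 < h" and f: "bdd_integrable f"
  shows "(LBINT x. \<bar>heat h f x\<bar> ^ (2 ^ k)) \<le> (LBINT x. \<bar>f x\<bar> ^ (2 ^ k))"
proof -
  have fi: "integrable lborel f" using f by (rule bdd_integrableD)
  have i: "integrable lborel (\<lambda>x. \<bar>f x\<bar> ^ (2 ^ k))" "integrable lborel (\<lambda>x. \<bar>heat h f x\<bar> ^ (2 ^ k))"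
    by (intro bdd_integrableD(1) bdd_integrable_power bdd_integrable_abs f bdd_integrable_heat h fi; simp)+
  have "(LBINT x. \<bar>heat h f x\<bar> ^ (2 ^ k)) \<le> (LBINT x. heat h (\<lambda>y. \<bar>f y\<bar> ^ (2 ^ k)) x)"
    by (rule integral_mono[OF i(2) _ heat_jensen_power[OF h f]]) (use h i in \<open>auto intro!: bdd_integrableD(1)\<close>)
  also have "\<dots> = (LBINT x. \<bar>f x\<bar> ^ (2 ^ k))" by (rule integral_heat[OF h i(1)])
  finally show ?thesis .
qed

text \<open>Jensen with exponent 2^k, then squaring: the left side is at most the squared L^2 norm
  of the heat flow of |f|^(2^k), and what this norm loses is by definition a defect. Nash's
  inequality can thus be applied to |f|^(2^k).\<close>

lemma integral_heat_power_Suc_le: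
  assumes h: "0 < h" and f: "bdd_integrable f"
  shows "(LBINT x. heat h f x ^ (2 ^ Suc k)) \<le>
    (LBINT x. f x ^ (2 ^ Suc k)) - heat_defect h (\<lambda>x. \<bar>f x\<bar> ^ (2 ^ k))"
proof -
  have fi: "integrable lborel f" using f by (rule bdd_integrableD)
  let ?g = "\<lambda>x. \<bar>f x\<bar> ^ (2 ^ k)"
  have g: "bdd_integrable ?g" using f by auto
  have gi: "integrable lborel ?g" using g by (rule bdd_integrableD)
  have sq: "y ^ (2 ^ Suc k) = (\<bar>y\<bar> ^ (2 ^ k))\<^sup>2" for y :: real
    unfolding power_Suc power_even_eq by (metis power_even_abs power_even_eq even_numeral power2_abs power_abs)
  have "(LBINT x. heat h f x ^ (2 ^ Suc k)) \<le> (LBINT x. (heat h ?g x)\<^sup>2)"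
    unfolding sq
  proof (rule integral_mono)
    show "(\<bar>heat h f x\<bar> ^ (2 ^ k))\<^sup>2 \<le> (heat h ?g x)\<^sup>2" for x
      by (rule power_mono[OF heat_jensen_power[OF h f]]) simp
    show "integrable lborel (\<lambda>x. (\<bar>heat h f x\<bar> ^ (2 ^ k))\<^sup>2)" "integrable lborel (\<lambda>x. (heat h ?g x)\<^sup>2)"
      by (intro bdd_integrableD(1) bdd_integrable_power bdd_integrable_abs bdd_integrable_heat h fi gi; simp)+
  qed
  then show ?thesis unfolding sq by (simp add: heat_defect_def)
qed

text \<open>The power 2^(N + 1) is the number \<open>q\<close> of time blocks in
  \<open>power_integral_smoothing\<close>, the numerator comes from 4 pi and half a time step, and
  the leading 2 is the sum of a geometric series.\<close>

definition smoothing_const :: "nat \<Rightarrow> real" where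
  "smoothing_const N = 2 * (2 * pi / 2 ^ (N + 1)) powr (- real N / 2)"

lemma smoothing_const_pos: "0 < smoothing_const N"
  by (simp add: smoothing_const_def)

context bounded_mild_solution
begin

text \<open>On [-M, M] the entropy has Lipschitz constant K M, so L^1 convergence of the
  regularisation suffices.\<close>

lemma entropy_heat_approx:
  assumes ent: "entropy M K \<Phi> \<Phi>' \<Phi>''" and t: "0 \<le> t" and \<eta>: "0 < \<eta>"
  shows "\<exists>\<delta>>0. \<forall>\<epsilon>\<in>{0<..\<delta>}. (LBINT x. \<Phi> (u t x)) \<le> (LBINT x. \<Phi> (heat \<epsilon> (u t) x)) + \<eta>"
proof -
  have K: "0 \<le> K" by (rule entropy_const_nonneg[OF ent M_nonneg])
  have den: "0 < K * M + 1" using K by (simp add: add_nonneg_pos)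
  obtain \<delta> where \<delta>: "0 < \<delta>"
    "\<And>\<sigma>. \<sigma> \<in> {0<..\<delta>} \<Longrightarrow> (LBINT x. \<bar>u t x - heat \<sigma> (u t) x\<bar>) \<le> \<eta> / (K * M + 1)"
    using heat_L1_approx[of "\<eta> / (K * M + 1)" t] \<eta> den t by auto
  have "(LBINT x. \<Phi> (u t x)) \<le> (LBINT x. \<Phi> (heat \<epsilon> (u t) x)) + \<eta>" if \<epsilon>: "\<epsilon> \<in> {0<..\<delta>}" for \<epsilon>
  proof -
    define w where "w = heat \<epsilon> (u t)"
    have ui: "integrable lborel (u t)" using t u_integrable by auto
    have ub: "bdd_integrable (u t)" "\<And>x. \<bar>u t x\<bar> \<le> M" using t bdd_integrable_u u_bound by auto
    have w: "bdd_integrable w" "\<And>x. \<bar>w x\<bar> \<le> M"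
      using \<epsilon> ui heat_abs_le[OF _ ui ub(2)] by (auto simp: w_def)
    have i: "integrable lborel (\<lambda>x. \<Phi> (u t x))" "integrable lborel (\<lambda>x. \<Phi> (w x))" "integrable lborel (\<lambda>x. \<bar>u t x - w x\<bar>)"
      using bdd_integrable_entropy(1)[OF ent M_nonneg ub] bdd_integrable_entropy(1)[OF ent M_nonneg w] ub w
      by (auto intro!: bdd_integrableD(1))
    have lip: "\<Phi> x \<le> \<Phi> y + K * M * \<bar>x - y\<bar>" if "\<bar>x\<bar> \<le> M" "\<bar>y\<bar> \<le> M" for x y
    proof -
      have "\<bar>\<Phi>' z\<bar> \<le> K * M" if "\<bar>z\<bar> \<le> M" for z
        using entropy_deriv_abs_le[OF ent M_nonneg that] mult_left_mono[OF that K] by simp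
      then show ?thesis
        using real_derivative_bound[of M \<Phi> \<Phi>' "K * M" x y] entropyD(1)[OF ent] that by simp
    qed
    have "(LBINT x. \<Phi> (u t x)) \<le> (LBINT x. \<Phi> (w x) + K * M * \<bar>u t x - w x\<bar>)"
      by (rule integral_mono) (use i lip[OF ub(2) w(2)] in auto)
    also have "\<dots> = (LBINT x. \<Phi> (w x)) + K * M * (LBINT x. \<bar>u t x - w x\<bar>)" using i by simp
    also have "K * M * (LBINT x. \<bar>u t x - w x\<bar>) \<le> K * M * (\<eta> / (K * M + 1))"
      unfolding w_def using K \<epsilon> by (intro mult_left_mono \<delta>(2)) auto
    also have "\<dots> \<le> \<eta>" using den \<eta> K by (simp add: divide_simps algebra_simps)
    finally show ?thesis by (simp add: w_def)
  qed
  then show ?thesis using \<delta>(1) by blast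
qed

text \<open>\<open>D\<close> is a lower bound for the decrease of the entropy under the heat flow; it is zero when only
  monotonicity is wanted.\<close>

lemma entropy_grid:
  assumes ent: "entropy M K \<Phi> \<Phi>' \<Phi>''" and t: "0 \<le> t0" "t0 < t1" and \<eta>: "0 < \<eta>" and k: "0 < (k :: nat)"
    and dec: "\<And>h v. 0 < h \<Longrightarrow> bdd_integrable v \<Longrightarrow> (\<And>x. \<bar>v x\<bar> \<le> M) \<Longrightarrow>
      (LBINT x. \<Phi> (heat h v x)) \<le> (LBINT x. \<Phi> (v x)) - D h v"
    and D: "\<And>h v. 0 < h \<Longrightarrow> bdd_integrable v \<Longrightarrow> 0 \<le> D h v"
  obtains \<epsilon> N h v where "0 < \<epsilon>" "0 < N" "h = (t1 - t0) / real (k * N)"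
    "\<And>i. v i = heat \<epsilon> (u (t0 + real i * h))"
    "(LBINT x. \<Phi> (u t1 x)) + (\<Sum>i<k * N. D h (v i)) \<le> (LBINT x. \<Phi> (u t0 x)) + \<eta>"
    "\<And>i. i < k * N \<Longrightarrow> (LBINT x. \<Phi> (u t1 x)) \<le> (LBINT x. \<Phi> (v i x)) + \<eta>"
proof -
  have \<eta>2: "0 < \<eta> / 2" using \<eta> by simp
  obtain \<delta>1 where \<delta>1: "0 < \<delta>1" "\<forall>\<epsilon>\<in>{0<..\<delta>1}. \<exists>N>0. \<forall>n\<ge>N. grid_dissipative \<Phi> t0 t1 (\<eta> / 2) \<epsilon> n"
    using entropy_steps[OF ent t \<eta>2] by blast
  obtain \<delta>2 where \<delta>2: "0 < \<delta>2" "\<forall>\<epsilon>\<in>{0<..\<delta>2}. (LBINT x. \<Phi> (u t1 x)) \<le> (LBINT x. \<Phi> (heat \<epsilon> (u t1) x)) + \<eta> / 2"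
    using entropy_heat_approx[OF ent _ \<eta>2, of t1] t by auto
  define \<epsilon> where "\<epsilon> = min \<delta>1 \<delta>2"
  have \<epsilon>: "0 < \<epsilon>" "\<epsilon> \<in> {0<..\<delta>1}" "\<epsilon> \<in> {0<..\<delta>2}" using \<delta>1(1) \<delta>2(1) by (auto simp: \<epsilon>_def)
  obtain N where N: "0 < N" "\<forall>n\<ge>N. grid_dissipative \<Phi> t0 t1 (\<eta> / 2) \<epsilon> n"
    using \<delta>1(2) \<epsilon>(2) by blast
  \<comment> \<open>A multiple of k, so that N grid steps make up exactly one k-th of the time
    interval. These N steps are the heat steps of Nash's inequality in
    \<open>power_integral_nash\<close>.\<close>
  define n where "n = k * N"
  have n: "0 < n" "N \<le> n" using k N(1) by (auto simp: n_def)
  define h where "h = (t1 - t0) / real n"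
  have h: "0 < h" using n t by (simp add: h_def)
  define v where "v i = heat \<epsilon> (u (t0 + real i * h))" for i
  define E where "E i = (LBINT x. \<Phi> (v i x))" for i
  obtain e where e: "\<And>i. 0 \<le> e i" "sum e {..<n} \<le> \<eta> / 2"
      "\<And>i. i < n \<Longrightarrow> E (Suc i) \<le> (LBINT x. \<Phi> (heat h (v i) x)) + e i"
    using N(2) n(2) unfolding grid_dissipative_def E_def v_def h_def by blast
  have T: "0 \<le> t0 + real i * h" for i using t h by simp
  have v: "bdd_integrable (v i)" "\<And>x. \<bar>v i x\<bar> \<le> M" for i
    using \<epsilon>(1) u_integrable[OF T] heat_abs_le[OF \<epsilon>(1) u_integrable[OF T] u_bound[OF T]] by (auto simp: v_def)
  have step: "E (Suc i) + D h (v i) \<le> E i + e i" if "i < n" for i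
    using e(3)[OF that] dec[OF h v(1)[of i] v(2)[of i]] by (simp add: E_def)
  have Dn: "0 \<le> D h (v i)" for i by (rule D[OF h v(1)])
  have down: "E (i + j) \<le> E i + (\<Sum>l=i..<i + j. e l)" if "i + j \<le> n" for i j
    using that
  proof (induction j)
    case (Suc j)
    then show ?case using step[of "i + j"] Dn[of "i + j"] by simp
  qed simp
  have total: "E j + (\<Sum>i<j. D h (v i)) \<le> E 0 + (\<Sum>i<j. e i)" if "j \<le> n" for j
    using that
  proof (induction j)
    case (Suc j)
    then show ?case using step[of j] by simp
  qed simp
  have tn: "t0 + real n * h = t1" using n by (simp add: h_def)
  have En: "(LBINT x. \<Phi> (u t1 x)) \<le> E n + \<eta> / 2"
    using \<delta>2(2) \<epsilon>(3) unfolding E_def v_def tn by blast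
  \<comment> \<open>At the initial time the regularisation is removed by decay under the heat flow,
    at the final time by approximation.\<close>
  have E0: "E 0 \<le> (LBINT x. \<Phi> (u t0 x))"
    using dec[OF \<epsilon>(1) bdd_integrable_u[OF t(1)] u_bound[OF t(1)]] D[OF \<epsilon>(1) bdd_integrable_u[OF t(1)]]
    by (simp add: E_def v_def)
  show ?thesis
  proof (rule that[of \<epsilon> N h v])
    show "(LBINT x. \<Phi> (u t1 x)) + (\<Sum>i<k * N. D h (v i)) \<le> (LBINT x. \<Phi> (u t0 x)) + \<eta>"
      using total[of n] En E0 e(2) by (simp add: n_def)
    show "(LBINT x. \<Phi> (u t1 x)) \<le> (LBINT x. \<Phi> (v i x)) + \<eta>" if "i < k * N" for i
    proof -
      have "(\<Sum>l=i..<n. e l) \<le> sum e {..<n}"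
        by (rule sum_mono2) (use e(1) in auto)
      then show ?thesis using down[of i "n - i"] that En e(2) by (simp add: n_def E_def)
    qed
  qed (use \<epsilon> N h_def n_def v_def in auto)
qed

lemma entropy_nonincreasing:
  assumes ent: "entropy M K \<Phi> \<Phi>' \<Phi>''" and t: "0 \<le> t0" "t0 \<le> t1"
    and dec: "\<And>h (v :: real^'n \<Rightarrow> real). 0 < h \<Longrightarrow> bdd_integrable v \<Longrightarrow> (\<And>x. \<bar>v x\<bar> \<le> M) \<Longrightarrow>
      (LBINT x. \<Phi> (heat h v x)) \<le> (LBINT x. \<Phi> (v x))"
  shows "(LBINT x. \<Phi> (u t1 x)) \<le> (LBINT x. \<Phi> (u t0 x))"
proof (cases "t0 = t1")
  case False
  show ?thesis
  proof (rule field_le_epsilon)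
    fix \<eta> :: real assume \<eta>: "0 < \<eta>"
    have t': "t0 < t1" using False t by simp
    show "(LBINT x. \<Phi> (u t1 x)) \<le> (LBINT x. \<Phi> (u t0 x)) + \<eta>"
    proof (rule entropy_grid[OF ent t(1) t' \<eta>, of 1 "\<lambda>_ _. 0"])
      fix h :: real and v :: "real^'n \<Rightarrow> real"
      assume "0 < h" "bdd_integrable v" "\<And>x. \<bar>v x\<bar> \<le> M"
      from dec[OF this] show "(LBINT x. \<Phi> (heat h v x)) \<le> (LBINT x. \<Phi> (v x)) - 0"
        by simp
    qed simp_all
  qed
qed simp

lemma L1_nonincreasing:
  assumes t: "0 \<le> t0" "t0 \<le> t1"
  shows "(LBINT x. \<bar>u t1 x\<bar>) \<le> (LBINT x. \<bar>u t0 x\<bar>)"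
proof -
  define d where "d n = 1 / real (Suc n)" for n
  have d: "0 < d n" for n by (simp add: d_def)
  have d0: "d \<longlonglongrightarrow> 0" unfolding d_def[abs_def] using LIMSEQ_inverse_real_of_nat by (simp add: divide_inverse)
  have le: "(LBINT x. abs_approx (d n) (u t1 x)) \<le> (LBINT x. abs_approx (d n) (u t0 x))" for n
  proof (rule entropy_nonincreasing[OF entropy_abs_approx[OF d] t])
    fix h :: real and v :: "real^'n \<Rightarrow> real" assume h: "0 < h" and v: "bdd_integrable v" "\<And>x. \<bar>v x\<bar> \<le> M"
    have vi: "integrable lborel v" using v by (auto intro: bdd_integrableD)
    note b = bdd_integrable_entropy(1)[OF entropy_abs_approx[OF d] M_nonneg]
    have i: "integrable lborel (\<lambda>x. abs_approx (d n) (v x))"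
      by (intro bdd_integrableD(1) b v)
    have "(LBINT x. abs_approx (d n) (heat h v x)) \<le> (LBINT x. heat h (\<lambda>y. abs_approx (d n) (v y)) x)"
    proof (rule integral_mono)
      show "integrable lborel (\<lambda>x. abs_approx (d n) (heat h v x))"
        by (intro bdd_integrableD(1) b bdd_integrable_heat h vi heat_abs_le[OF h vi v(2)])
      show "abs_approx (d n) (heat h v x) \<le> heat h (\<lambda>y. abs_approx (d n) (v y)) x" for x
        by (rule heat_jensen[OF h vi i abs_approx_tangent[OF d]])
    qed (use h i in \<open>auto intro!: bdd_integrableD(1)\<close>)
    then show "(LBINT x. abs_approx (d n) (heat h v x)) \<le> (LBINT x. abs_approx (d n) (v x))"
      by (simp add: integral_heat[OF h i])
  qed
  have lim: "(\<lambda>n. LBINT x. abs_approx (d n) (u t x)) \<longlonglongrightarrow> (LBINT x. \<bar>u t x\<bar>)" if t: "0 \<le> t" for t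
  proof (rule integral_dominated_convergence[where w = "\<lambda>x. \<bar>u t x\<bar>"])
    have [measurable]: "u t \<in> borel_measurable borel" by (rule u_measurable[OF t])
    show "(\<lambda>x. \<bar>u t x\<bar>) \<in> borel_measurable lborel" by simp
    show "(\<lambda>x. abs_approx (d n) (u t x)) \<in> borel_measurable lborel" for n
      unfolding abs_approx_def by simp
    show "integrable lborel (\<lambda>x. \<bar>u t x\<bar>)" using u_integrable[OF t] by simp
    show "AE x in lborel. (\<lambda>n. abs_approx (d n) (u t x)) \<longlonglongrightarrow> \<bar>u t x\<bar>"
    proof (intro AE_I2)
      fix x
      show "(\<lambda>n. abs_approx (d n) (u t x)) \<longlonglongrightarrow> \<bar>u t x\<bar>"
      proof (rule tendsto_sandwich)
        show "(\<lambda>n. \<bar>u t x\<bar> - d n) \<longlonglongrightarrow> \<bar>u t x\<bar>" using tendsto_diff[OF tendsto_const d0] by simp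
      qed (use abs_approx_bounds[OF d] in auto)
    qed
    show "AE x in lborel. norm (abs_approx (d n) (u t x)) \<le> \<bar>u t x\<bar>" for n
      using abs_approx_bounds[OF d] by simp
  qed
  show ?thesis
    by (rule LIMSEQ_le[OF lim lim]) (use t le in auto)
qed

section \<open>Smoothing from exponent 2^k to 2^(k+1), and Moser iteration\<close>

definition power_integral :: "nat \<Rightarrow> real \<Rightarrow> real" where
  "power_integral k t = (LBINT x. \<bar>u t x\<bar> ^ (2 ^ k))"

lemma power_integral_nonneg: "0 \<le> power_integral k t"
  unfolding power_integral_def by (rule Bochner_Integration.integral_nonneg) simp

lemma power_integral_Suc: "power_integral (Suc k) t = (LBINT x. u t x ^ (2 ^ Suc k))"
  unfolding power_integral_def by (simp add: power_even_abs)

lemma heat_defect_power_nonneg: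
  "0 < h \<Longrightarrow> bdd_integrable v \<Longrightarrow> 0 \<le> heat_defect h (\<lambda>x. \<bar>v x\<bar> ^ (2 ^ k))"
  by (rule heat_defect_nonneg) auto

lemma power_integral_nonincreasing:
  assumes t: "0 \<le> t0" "t0 \<le> t1"
  shows "power_integral k t1 \<le> power_integral k t0"
proof (cases k)
  case 0
  then show ?thesis using L1_nonincreasing[OF t] by (simp add: power_integral_def)
next
  case (Suc j)
  have p: "2 \<le> (2 :: nat) ^ Suc j" by simp
  show ?thesis
    unfolding Suc power_integral_Suc
  proof (rule entropy_nonincreasing[OF entropy_power[OF p] t])
    fix h :: real and v :: "real^'n \<Rightarrow> real" assume "0 < h" "bdd_integrable v"
    then show "(LBINT x. heat h v x ^ (2 ^ Suc j)) \<le> (LBINT x. v x ^ (2 ^ Suc j))"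
      using integral_heat_power_Suc_le[of h v j] heat_defect_power_nonneg[of h v j] by linarith
  qed
qed

text \<open>Nash's inequality at each of the q N grid times bounds the defect there from below by
  the final value of the power integral, up to the L^1 term and \<eta>. The sum of the defects is
  bounded from above by the decrease of the entropy; after division by N the final value has gained
  the factor q.\<close>

lemma power_integral_nash:
  assumes t: "0 \<le> t0" "t0 < t1" and q: "0 < (q :: nat)"
    and A: "\<And>s. t0 \<le> s \<Longrightarrow> s \<le> t1 \<Longrightarrow> power_integral k s \<le> A"
  shows "(real q + 1) * power_integral (Suc k) t1 \<le> power_integral (Suc k) t0 +
    real q * ((4 * pi * ((t1 - t0) / real q)) powr (- real CARD('n) / 2) * A\<^sup>2)"
proof (rule field_le_epsilon)
  fix \<eta>' :: real assume \<eta>': "0 < \<eta>'"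
  \<comment> \<open>The error enters once through the total decrease and q times through the lower
    bounds.\<close>
  define \<eta> where "\<eta> = \<eta>' / (real q + 1)"
  have \<eta>: "0 < \<eta>" "(real q + 1) * \<eta> = \<eta>'" using \<eta>' by (auto simp: \<eta>_def add_pos_pos)
  define c where "c = (4 * pi * ((t1 - t0) / real q)) powr (- real CARD('n) / 2) * A\<^sup>2"
  have p: "2 \<le> (2 :: nat) ^ Suc k" by simp
  obtain \<epsilon> N h v where g: "0 < \<epsilon>" "0 < N" "h = (t1 - t0) / real (q * N)"
    "\<And>i. v i = heat \<epsilon> (u (t0 + real i * h))"
    "power_integral (Suc k) t1 + (\<Sum>i<q * N. heat_defect h (\<lambda>x. \<bar>v i x\<bar> ^ (2 ^ k))) \<le> power_integral (Suc k) t0 + \<eta>"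
    "\<And>i. i < q * N \<Longrightarrow> power_integral (Suc k) t1 \<le> (LBINT x. v i x ^ (2 ^ Suc k)) + \<eta>"
  proof (rule entropy_grid[OF entropy_power[OF p] t \<eta>(1) q])
    fix h' :: real and v' :: "real^'n \<Rightarrow> real" assume hv: "0 < h'" "bdd_integrable v'"
    show "(LBINT x. heat h' v' x ^ (2 ^ Suc k)) \<le>
        (LBINT x. v' x ^ (2 ^ Suc k)) - heat_defect h' (\<lambda>x. \<bar>v' x\<bar> ^ (2 ^ k))"
      by (rule integral_heat_power_Suc_le[OF hv])
    show "0 \<le> heat_defect h' (\<lambda>x. \<bar>v' x\<bar> ^ (2 ^ k))"
      by (rule heat_defect_power_nonneg[OF hv])
  next
    fix \<epsilon> h :: real and N :: nat and v
    assume "0 < \<epsilon>" "0 < N" "h = (t1 - t0) / real (q * N)" "\<And>i. v i = heat \<epsilon> (u (t0 + real i * h))"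
      "(LBINT x. u t1 x ^ (2 ^ Suc k)) + (\<Sum>i<q * N. heat_defect h (\<lambda>x. \<bar>v i x\<bar> ^ (2 ^ k)))
        \<le> (LBINT x. u t0 x ^ (2 ^ Suc k)) + \<eta>"
      "\<And>i. i < q * N \<Longrightarrow> (LBINT x. u t1 x ^ (2 ^ Suc k)) \<le> (LBINT x. v i x ^ (2 ^ Suc k)) + \<eta>"
    then show thesis
      by (intro that[of \<epsilon> N h v]) (simp_all only: power_integral_Suc)
  qed
  have h: "0 < h" "real N * h = (t1 - t0) / real q" using g(2,3) q t by auto
  define D where "D i = heat_defect h (\<lambda>x. \<bar>v i x\<bar> ^ (2 ^ k))" for i
  have low: "power_integral (Suc k) t1 - \<eta> - c \<le> real N * D i" if i: "i < q * N" for i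
  proof -
    define s where "s = t0 + real i * h"
    have "real i \<le> real (q * N)" using i by (simp only: of_nat_le_iff less_imp_le)
    then have "real i * h \<le> real (q * N) * h" using h by (intro mult_right_mono) auto
    also have "\<dots> = t1 - t0" using g(2,3) q by simp
    finally have s: "t0 \<le> s" "s \<le> t1" "0 \<le> s" using h t by (auto simp: s_def)
    have us: "bdd_integrable (u s)" "integrable lborel (u s)" using s bdd_integrable_u u_integrable by auto
    have v: "bdd_integrable (v i)" unfolding g(4) s_def[symmetric] using g(1) us by auto
    have vk: "bdd_integrable (\<lambda>x. \<bar>v i x\<bar> ^ (2 ^ k))" using v by auto
    have "(LBINT x. \<bar>v i x\<bar> ^ (2 ^ k)) \<le> power_integral k s"
      unfolding g(4) s_def[symmetric] power_integral_def by (rule integral_heat_power_le[OF g(1) us(1)])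
    also have "\<dots> \<le> A" by (rule A[OF s(1,2)])
    finally have "(LBINT x. \<bar>v i x\<bar> ^ (2 ^ k))\<^sup>2 \<le> A\<^sup>2"
      by (rule power_mono) (simp add: Bochner_Integration.integral_nonneg)
    then have "(LBINT x. \<bar>\<bar>v i x\<bar> ^ (2 ^ k)\<bar>)\<^sup>2 \<le> A\<^sup>2" by simp
    \<comment> \<open>N heat steps cover the time (t1 - t0) / q for every N, so the coefficient of
      the L^1 term does not depend on the grid.\<close>
    then have "(LBINT x. (\<bar>v i x\<bar> ^ (2 ^ k))\<^sup>2) \<le> c + real N * D i"
      using nash_inequality[OF h(1) g(2) vk] unfolding h(2) c_def D_def
      by (meson add_right_mono mult_left_mono order_trans powr_ge_zero)
    moreover have "(\<bar>y\<bar> ^ (2 ^ k))\<^sup>2 = y ^ (2 ^ Suc k)" for y :: real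
      unfolding power_Suc power_even_eq by (metis power_even_abs power_even_eq even_numeral power2_abs power_abs)
    ultimately show ?thesis using g(6)[OF i] by simp
  qed
  have "real (q * N) * (power_integral (Suc k) t1 - \<eta> - c) = (\<Sum>i<q * N. power_integral (Suc k) t1 - \<eta> - c)"
    by simp
  also have "\<dots> \<le> (\<Sum>i<q * N. real N * D i)" by (rule sum_mono) (use low in auto)
  also have "\<dots> = real N * (\<Sum>i<q * N. D i)" by (simp add: sum_distrib_left)
  finally have "real N * (real q * (power_integral (Suc k) t1 - \<eta> - c)) \<le> real N * (\<Sum>i<q * N. D i)"
    by (simp add: mult_ac)
  then have "real q * (power_integral (Suc k) t1 - \<eta> - c) \<le> (\<Sum>i<q * N. D i)"
    using g(2) by simp
  then have "power_integral (Suc k) t1 + real q * (power_integral (Suc k) t1 - \<eta> - c) \<le> power_integral (Suc k) t0 + \<eta>"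
    using g(5) by (simp add: D_def)
  then show "(real q + 1) * power_integral (Suc k) t1 \<le> power_integral (Suc k) t0 + real q * ((4 * pi * ((t1 - t0) / real q)) powr (- real CARD('n) / 2) * A\<^sup>2) + \<eta>'"
    unfolding c_def[symmetric] \<eta>(2)[symmetric] by (simp add: algebra_simps)
qed

text \<open>Halving the time step turns the previous estimate into \<open>f \<tau> \<le> f (\<tau> / 2) / 2 + b\<close> for
  \<open>f \<tau> = \<tau>\<^bsup>n/2\<^esup> \<integral>u(t0 + \<tau>)\<^sup>2\<^sup>m\<close>, which can be iterated because \<open>f\<close> is bounded near 0.\<close>

lemma power_integral_smoothing:
  assumes t: "0 \<le> t0" "t0 < t1"
  shows "power_integral (Suc k) t1 \<le>
    smoothing_const CARD('n) * (t1 - t0) powr (- real CARD('n) / 2) * (power_integral k t0)\<^sup>2"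
proof -
  define N where "N = real CARD('n) / 2"
  \<comment> \<open>Large enough that q + 1 is at least 2 times 2^(N/2): one factor compensates the
    weight \<tau>^(N/2) when \<tau> is halved, the other gives the contraction factor 1/2.\<close>
  define q where "q = (2 :: nat) ^ (CARD('n) + 1)"
  have q: "0 < q" by (simp add: q_def)
  define A where "A = power_integral k t0"
  define B where "B = (2 * pi / real q) powr (- N) * A\<^sup>2"
  have B: "0 \<le> B" by (simp add: B_def)
  define f where "f \<tau> = \<tau> powr N * power_integral (Suc k) (t0 + \<tau>)" for \<tau>
  have f0: "0 \<le> f \<tau>" for \<tau> by (simp add: f_def power_integral_nonneg)
  have q2: "2 * 2 powr N \<le> real q + 1"
  proof -
    have "2 powr N \<le> 2 powr real CARD('n)" unfolding N_def by (intro powr_mono) auto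
    then show ?thesis by (simp add: q_def powr_realpow)
  qed
  have half: "f \<tau> \<le> f (\<tau> / 2) / 2 + B" if \<tau>: "0 < \<tau>" for \<tau>
  proof -
    have "(real q + 1) * power_integral (Suc k) (t0 + \<tau>) \<le> power_integral (Suc k) (t0 + \<tau> / 2) +
        real q * ((4 * pi * ((t0 + \<tau> - (t0 + \<tau> / 2)) / real q)) powr (- real CARD('n) / 2) * A\<^sup>2)"
      unfolding A_def by (rule power_integral_nash) (use t \<tau> q in \<open>auto intro!: power_integral_nonincreasing\<close>)
    also have "4 * pi * ((t0 + \<tau> - (t0 + \<tau> / 2)) / real q) = 2 * pi / real q * \<tau>" by simp
    also have "(2 * pi / real q * \<tau>) powr (- real CARD('n) / 2) = (2 * pi / real q) powr (- N) * \<tau> powr (- N)"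
      using \<tau> q by (subst powr_mult) (auto simp: N_def)
    finally have "\<tau> powr N * ((real q + 1) * power_integral (Suc k) (t0 + \<tau>)) \<le>
        \<tau> powr N * (power_integral (Suc k) (t0 + \<tau> / 2) + real q * ((2 * pi / real q) powr (- N) * \<tau> powr (- N) * A\<^sup>2))"
      by (rule mult_left_mono) simp
    also have "\<dots> = \<tau> powr N * power_integral (Suc k) (t0 + \<tau> / 2) + real q * B * (\<tau> powr N * \<tau> powr (- N))"
      by (simp add: B_def algebra_simps)
    also have "\<tau> powr N * \<tau> powr (- N) = 1" using \<tau> by (simp flip: powr_add)
    also have "\<tau> powr N = 2 powr N * (\<tau> / 2) powr N" using \<tau> by (simp flip: powr_mult)
    finally have "(real q + 1) * f \<tau> \<le> 2 powr N * f (\<tau> / 2) + real q * B"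
      using \<tau> by (simp add: f_def mult_ac powr_divide)
    also have "\<dots> \<le> (real q + 1) * (f (\<tau> / 2) / 2) + (real q + 1) * B"
      using mult_right_mono[OF q2 f0[of "\<tau> / 2"]] B by (intro add_mono mult_right_mono) auto
    finally have "(real q + 1) * f \<tau> \<le> (real q + 1) * (f (\<tau> / 2) / 2 + B)" by (simp only: distrib_left)
    then show ?thesis by (rule mult_left_le_imp_le) simp
  qed
  define \<tau> where "\<tau> = t1 - t0"
  have \<tau>: "0 < \<tau>" using t by (simp add: \<tau>_def)
  \<comment> \<open>A bound for f at all times in the iteration. It depends on the solution, but is
    divided by 2^j and disappears in the limit.\<close>
  define S where "S = \<tau> powr N * power_integral (Suc k) t0"
  have fS: "f (\<tau> / 2 ^ j) \<le> S" for j
    unfolding f_def S_def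
  proof (rule mult_mono)
    have "\<tau> / 2 ^ j \<le> \<tau>" using \<tau> by (simp add: divide_le_eq mult_le_cancel_left1)
    then show "(\<tau> / 2 ^ j) powr N \<le> \<tau> powr N" using \<tau> by (intro powr_mono2) (auto simp: N_def)
    show "power_integral (Suc k) (t0 + \<tau> / 2 ^ j) \<le> power_integral (Suc k) t0"
      using \<tau> t by (intro power_integral_nonincreasing) auto
  qed (auto simp: power_integral_nonneg)
  have iter: "f \<tau> \<le> f (\<tau> / 2 ^ j) / 2 ^ j + 2 * B" for j
  proof -
    \<comment> \<open>The coefficient of B is the partial sum of the geometric series 1 + 1/2 + 1/4
      + ... with j terms.\<close>
    have "f \<tau> \<le> f (\<tau> / 2 ^ j) / 2 ^ j + (2 - 2 / 2 ^ j) * B"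
    proof (induction j)
      case (Suc j)
      have "f (\<tau> / 2 ^ j) / 2 ^ j \<le> (f (\<tau> / 2 ^ j / 2) / 2 + B) / 2 ^ j"
        using half[of "\<tau> / 2 ^ j"] \<tau> by (intro divide_right_mono) auto
      then have "f (\<tau> / 2 ^ j) / 2 ^ j \<le> f (\<tau> / 2 ^ Suc j) / 2 ^ Suc j + B / 2 ^ j"
        by (simp add: add_divide_distrib mult.commute)
      with Suc show ?case by (simp add: algebra_simps)
    qed simp
    also have "(2 - 2 / 2 ^ j) * B \<le> 2 * B" using B by (intro mult_right_mono) auto
    finally show ?thesis by simp
  qed
  have "(\<lambda>j. S * (1 / 2) ^ j + 2 * B) \<longlonglongrightarrow> S * 0 + 2 * B"
    by (intro tendsto_intros LIMSEQ_power_zero) simp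
  moreover have "f \<tau> \<le> S * (1 / 2) ^ j + 2 * B" for j
  proof -
    have "f (\<tau> / 2 ^ j) / 2 ^ j \<le> S / 2 ^ j" by (rule divide_right_mono[OF fS]) simp
    also have "S / 2 ^ j = S * (1 / 2) ^ j" by (simp only: power_one_over times_divide_eq_right mult_1_right)
    finally show ?thesis using iter[of j] by linarith
  qed
  ultimately have "f \<tau> \<le> 2 * B" by (intro LIMSEQ_le_const[of _ "2 * B"]) auto
  then have "\<tau> powr (- N) * f \<tau> \<le> \<tau> powr (- N) * (2 * B)" by (rule mult_left_mono) simp
  moreover have "\<tau> powr (- N) * f \<tau> = (\<tau> powr (- N) * \<tau> powr N) * power_integral (Suc k) t1"
    by (simp add: f_def \<tau>_def)
  moreover have "\<tau> powr (- N) * \<tau> powr N = 1" using \<tau> by (simp flip: powr_add)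
  ultimately have "power_integral (Suc k) t1 \<le> \<tau> powr (- N) * (2 * B)" by simp
  also have "\<dots> = smoothing_const CARD('n) * (t1 - t0) powr (- real CARD('n) / 2) * (power_integral k t0)\<^sup>2"
    by (simp add: B_def A_def \<tau>_def N_def q_def smoothing_const_def mult_ac)
  finally show ?thesis .
qed

text \<open>Moser iteration along the times \<open>t (1 - 2\<^bsup>-k\<^esup>)\<close>; with the factor \<open>b q\<^bsup>k + 2\<^esup>\<close> the recursion
  becomes a pure squaring.\<close>

lemma power_integral_bound:
  fixes k :: nat
  assumes t: "0 < t"
  defines "b \<equiv> smoothing_const CARD('n) * t powr (- real CARD('n) / 2)"
  shows "b * power_integral k t \<le> (b * 2 ^ CARD('n) * (LBINT x. \<bar>u 0 x\<bar>)) ^ (2 ^ k)"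
proof -
  define N where "N = real CARD('n) / 2"
  define q where "q = 2 powr N"
  have q: "1 \<le> q" "q\<^sup>2 = 2 ^ CARD('n)"
    by (auto simp: q_def N_def ge_one_powr_ge_zero power2_eq_square powr_realpow simp flip: powr_add)
  have b: "0 < b" using t smoothing_const_pos by (simp add: b_def)
  define U where "U = (LBINT x. \<bar>u 0 x\<bar>)"
  define s where "s k = t * (1 - (1 / 2) ^ k)" for k :: nat
  have s: "0 \<le> s k" "s k \<le> t" "s k < s (Suc k)" "s (Suc k) - s k = t * (1 / 2) ^ Suc k" for k
    using t by (auto simp: s_def power_le_one algebra_simps mult_left_le)
  have it: "b * q ^ (k + 2) * power_integral k (s k) \<le> (b * q\<^sup>2 * U) ^ (2 ^ k)" for k
  proof (induction k)
    case 0
    then show ?case by (simp add: s_def power_integral_def U_def power2_eq_square)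
  next
    case (Suc k)
    have e: "(s (Suc k) - s k) powr (- real CARD('n) / 2) = t powr (- real CARD('n) / 2) * q ^ Suc k"
    proof -
      have "(1 / 2) powr (- N) = q" by (simp add: q_def powr_minus powr_divide)
      moreover have "((1 / 2) ^ Suc k) powr (- N) = ((1 / 2) powr (- N)) ^ Suc k"
        by (subst powr_power, simp, subst powr_realpow[symmetric], simp, subst powr_powr, rule refl)
      ultimately have "((1 / 2) ^ Suc k) powr (- N) = q ^ Suc k" by (simp only:)
      then show ?thesis unfolding s(4) using t by (subst powr_mult) (auto simp: N_def)
    qed
    have "power_integral (Suc k) (s (Suc k)) \<le> b * q ^ Suc k * (power_integral k (s k))\<^sup>2"
      using power_integral_smoothing[OF s(1) s(3), of k k] unfolding e b_def by (simp add: mult_ac)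
    then have "b * q ^ (Suc k + 2) * power_integral (Suc k) (s (Suc k)) \<le>
        b * q ^ (Suc k + 2) * (b * q ^ Suc k * (power_integral k (s k))\<^sup>2)"
      using b q by (intro mult_left_mono) auto
    \<comment> \<open>The shrinking time interval contributes \<open>q ^ Suc k\<close>. The
      exponents of q balance, (k + 3) + (k + 1) = 2 (k + 2), which is what fixes the weight.\<close>
    also have "\<dots> = (b * q ^ (k + 2) * power_integral k (s k))\<^sup>2"
      by (simp add: power_mult_distrib power2_eq_square power_add)
    also have "\<dots> \<le> ((b * q\<^sup>2 * U) ^ (2 ^ k))\<^sup>2"
      using b q by (intro power_mono Suc.IH) (auto simp: power_integral_nonneg)
    also have "\<dots> = (b * q\<^sup>2 * U) ^ (2 ^ Suc k)" unfolding power_Suc power_even_eq ..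
    finally show ?case .
  qed
  have "b * power_integral k t \<le> b * q ^ (k + 2) * power_integral k (s k)"
  proof (rule mult_mono)
    show "b \<le> b * q ^ (k + 2)" using b one_le_power[OF q(1), of "k + 2"] by (simp add: mult_le_cancel_left1)
    show "power_integral k t \<le> power_integral k (s k)" by (rule power_integral_nonincreasing[OF s(1,2)])
  qed (use b q in \<open>auto simp: power_integral_nonneg\<close>)
  also note it
  finally show ?thesis by (simp add: q(2) U_def)
qed

text \<open>Markov's inequality with exponent 2^k bounds the measure of the set where |u| \<ge>
  \<mu> by (\<Lambda> / \<mu>)^(2^k) / b. For \<mu> > \<Lambda> this tends to 0 as k grows, and
  countably many \<mu> decreasing to \<Lambda> suffice.\<close>

lemma sup_bound:
  assumes t: "0 < t"
  shows "AE x in lborel. \<bar>u t x\<bar> \<le>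
    smoothing_const CARD('n) * 2 ^ CARD('n) * t powr (- real CARD('n) / 2) * (LBINT x. \<bar>u 0 x\<bar>)"
proof -
  define b where "b = smoothing_const CARD('n) * t powr (- real CARD('n) / 2)"
  define \<Lambda> where "\<Lambda> = b * 2 ^ CARD('n) * (LBINT x. \<bar>u 0 x\<bar>)"
  have b: "0 < b" using t smoothing_const_pos by (simp add: b_def)
  have \<Lambda>: "0 \<le> \<Lambda>" using b by (simp add: \<Lambda>_def Bochner_Integration.integral_nonneg)
  have ub: "bdd_integrable (u t)" using t bdd_integrable_u by auto
  have [measurable]: "u t \<in> borel_measurable borel" using t u_measurable by auto
  have AE: "AE x in lborel. \<bar>u t x\<bar> < \<mu>" if \<mu>: "\<Lambda> < \<mu>" for \<mu>
  proof -
    have \<mu>0: "0 < \<mu>" using \<mu> \<Lambda> by simp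
    have "emeasure lborel {x. \<mu> \<le> \<bar>u t x\<bar>} \<le> ennreal (1 / b * (\<Lambda> / \<mu>) ^ (2 ^ k))" for k
    proof -
      have i: "integrable lborel (\<lambda>x. \<bar>u t x\<bar> ^ (2 ^ k))"
        using ub by (auto intro!: bdd_integrableD(1))
      have "emeasure lborel {x. \<mu> \<le> \<bar>u t x\<bar>} \<le> emeasure lborel {x \<in> space lborel. \<mu> ^ (2 ^ k) \<le> \<bar>u t x\<bar> ^ (2 ^ k)}"
        by (rule emeasure_mono) (use \<mu>0 in \<open>auto intro: power_mono\<close>)
      also have "\<dots> \<le> ennreal (1 / \<mu> ^ (2 ^ k) * (LBINT x. \<bar>u t x\<bar> ^ (2 ^ k)))"
        by (rule integral_Markov_inequality[OF i]) (use \<mu>0 in auto)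
      also have "\<dots> \<le> ennreal (1 / b * (\<Lambda> / \<mu>) ^ (2 ^ k))"
      proof (rule ennreal_leI)
        have "b * power_integral k t \<le> \<Lambda> ^ (2 ^ k)"
          unfolding \<Lambda>_def b_def by (rule power_integral_bound[OF t])
        then have "power_integral k t \<le> 1 / b * \<Lambda> ^ (2 ^ k)"
          using b by (simp add: pos_le_divide_eq mult.commute)
        then show "1 / \<mu> ^ (2 ^ k) * (LBINT x. \<bar>u t x\<bar> ^ (2 ^ k)) \<le> 1 / b * (\<Lambda> / \<mu>) ^ (2 ^ k)"
          using \<mu>0 divide_right_mono[of "power_integral k t" "1 / b * \<Lambda> ^ (2 ^ k)" "\<mu> ^ (2 ^ k)"]
          by (simp add: power_integral_def power_divide)
      qed
      finally show ?thesis .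
    qed
    moreover have "(\<lambda>k. ennreal (1 / b * (\<Lambda> / \<mu>) ^ (2 ^ k))) \<longlonglongrightarrow> ennreal (1 / b * 0)"
    proof (intro tendsto_intros tendsto_ennrealI)
      have "(\<lambda>n. (\<Lambda> / \<mu>) ^ n) \<longlonglongrightarrow> 0" using \<mu> \<mu>0 \<Lambda> by (intro LIMSEQ_power_zero) auto
      moreover have "filterlim (\<lambda>k. (2 :: nat) ^ k) sequentially sequentially"
        by (rule filterlim_subseq) (auto simp: strict_mono_def)
      ultimately show "(\<lambda>k. (\<Lambda> / \<mu>) ^ (2 ^ k)) \<longlonglongrightarrow> 0" by (rule filterlim_compose)
    qed
    ultimately have "emeasure lborel {x. \<mu> \<le> \<bar>u t x\<bar>} \<le> ennreal (1 / b * 0)"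
      by (intro LIMSEQ_le_const) auto
    then have "emeasure lborel {x. \<mu> \<le> \<bar>u t x\<bar>} = 0" by simp
    then show ?thesis
      by (intro AE_I[of _ _ "{x. \<mu> \<le> \<bar>u t x\<bar>}"]) (auto simp: not_less)
  qed
  have "AE x in lborel. \<forall>n. \<bar>u t x\<bar> < \<Lambda> + 1 / real (Suc n)"
    unfolding AE_all_countable by (intro allI AE) simp
  then have "AE x in lborel. \<bar>u t x\<bar> \<le> \<Lambda>"
  proof eventually_elim
    case (elim x)
    show ?case
    proof (rule field_le_epsilon)
      fix e :: real assume "0 < e"
      then obtain n where "1 / real (Suc n) < e" using nat_approx_posE by blast
      then show "\<bar>u t x\<bar> \<le> \<Lambda> + e" using elim[rule_format, of n] by simp
    qed
  qed
  then show ?thesis by (simp add: \<Lambda>_def b_def mult_ac)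
qed

end

subsection \<open>Reduction to bounded solutions with a Lipschitz nonlinearity\<close>

lemma Lp_norm_1: "f \<in> borel_measurable M \<Longrightarrow> Lp_norm 1 M f = (\<integral>\<^sup>+x. ennreal \<bar>f x\<bar> \<partial>M)"
  by (auto simp: Lp_norm_def Let_def powr_one' less_top[symmetric])

lemma Lp_1_integrable:
  assumes "f \<in> Lp 1 M"
  shows "integrable M f" and "Lp_norm 1 M f = ennreal (\<integral>x. \<bar>f x\<bar> \<partial>M)"
proof -
  have f: "f \<in> borel_measurable M" "Lp_norm 1 M f < \<infinity>" using assms by (auto simp: Lp_def)
  then show i: "integrable M f" by (simp add: integrable_iff_bounded Lp_norm_1)
  show "Lp_norm 1 M f = ennreal (\<integral>x. \<bar>f x\<bar> \<partial>M)"
    unfolding Lp_norm_1[OF f(1)] using i by (intro nn_integral_eq_integral) auto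
qed

text \<open>Used twice: applied to u it turns the essential bound into a bound at every point, and
  composed with F it turns a C^1 function into a globally Lipschitz one, both without change on the
  essential range of u.\<close>

definition clamp_real :: "real \<Rightarrow> real \<Rightarrow> real" where
  "clamp_real M x = max (- M) (min M x)"

lemma clamp_real_measurable [measurable]: "clamp_real M \<in> borel_measurable borel"
  unfolding clamp_real_def[abs_def] by measurable

lemma clamp_real_props:
  assumes "0 \<le> M"
  shows "\<bar>clamp_real M x\<bar> \<le> M" "\<bar>x\<bar> \<le> M \<Longrightarrow> clamp_real M x = x"
    "\<bar>clamp_real M x - clamp_real M y\<bar> \<le> \<bar>x - y\<bar>" "clamp_real M 0 = 0" "\<bar>clamp_real M x\<bar> \<le> \<bar>x\<bar>"
  using assms by (auto simp: clamp_real_def)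

lemma C1_lipschitz_clamp:
  assumes F: "F C1_differentiable_on UNIV" and M: "0 \<le> M"
  shows "\<exists>L. \<forall>r s. \<bar>F (clamp_real M r) - F (clamp_real M s)\<bar> \<le> L * \<bar>r - s\<bar>" "continuous_on UNIV F"
proof -
  obtain D where D: "\<And>x. (F has_vector_derivative D x) (at x)" "continuous_on UNIV D"
    using F by (auto simp: C1_differentiable_on_def)
  have D': "(F has_real_derivative D x) (at x)" for x
    using D(1) by (simp add: has_real_derivative_iff_has_vector_derivative)
  show "continuous_on UNIV F"
    by (intro continuous_at_imp_continuous_on ballI DERIV_isCont[OF D'])
  have "compact (D ` {- M..M})"
    by (intro compact_continuous_image continuous_on_subset[OF D(2)]) auto
  then obtain L where "\<forall>y\<in>D ` {- M..M}. norm y \<le> L" using compact_imp_bounded bounded_iff by blast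
  then have L: "\<bar>D x\<bar> \<le> L" if "\<bar>x\<bar> \<le> M" for x using that by (auto simp: abs_le_iff)
  have L0: "0 \<le> L" using L[of 0] M by simp
  have "\<bar>F (clamp_real M r) - F (clamp_real M s)\<bar> \<le> L * \<bar>r - s\<bar>" for r s
  proof -
    have "\<bar>F (clamp_real M r) - F (clamp_real M s)\<bar> \<le> L * \<bar>clamp_real M r - clamp_real M s\<bar>"
      by (rule real_derivative_bound[OF D' L]) (use clamp_real_props[OF M] in auto)
    also have "\<dots> \<le> L * \<bar>r - s\<bar>" by (rule mult_left_mono[OF clamp_real_props(3)[OF M] L0])
    finally show ?thesis .
  qed
  then show "\<exists>L. \<forall>r s. \<bar>F (clamp_real M r) - F (clamp_real M s)\<bar> \<le> L * \<bar>r - s\<bar>" by blast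
qed

text \<open>By Fubini, a null set of space-time meets almost every time slice in a null set.
  Individual times are not covered yet.\<close>

lemma Lp_infinity_space_time:
  fixes u :: "real \<Rightarrow> real^'n \<Rightarrow> real"
  assumes "(\<lambda>(x, t). u t x) \<in> Lp \<infinity> (restrict_space lborel (UNIV \<times> {0<..}))"
  shows "(\<lambda>(s, x). if 0 < s then u s x else 0) \<in> borel_measurable (borel \<Otimes>\<^sub>M borel)"
    and "\<exists>M\<ge>0. AE s in lborel. 0 < s \<longrightarrow> (AE x in lborel. \<bar>u s x\<bar> \<le> M)"
proof -
  let ?\<Omega> = "UNIV \<times> {0<..} :: ((real^'n) \<times> real) set"
  let ?R = "restrict_space lborel ?\<Omega>"
  let ?w = "\<lambda>(x, t). u t x"
  have \<Omega>: "?\<Omega> \<in> sets lborel" by (simp add: borel_open open_Times)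
  have w: "?w \<in> borel_measurable ?R" and e: "esssup ?R (\<lambda>p. ennreal \<bar>?w p\<bar>) < \<infinity>"
    using assms by (auto simp: Lp_def Lp_norm_def)
  define W where "W p = indicator ?\<Omega> p * ?w p" for p
  have W [measurable]: "W \<in> borel_measurable borel"
    using w \<Omega> by (subst (asm) borel_measurable_restrict_space_iff) (auto simp: W_def[abs_def])
  have "(\<lambda>p. W (snd p, fst p)) \<in> borel_measurable (borel \<Otimes>\<^sub>M borel)"
    by (rule measurable_compose[OF _ W]) simp
  also have "(\<lambda>p. W (snd p, fst p)) = (\<lambda>(s, x). if 0 < s then u s x else 0)"
    by (auto simp: W_def)
  finally show "(\<lambda>(s, x). if 0 < s then u s x else 0) \<in> borel_measurable (borel \<Otimes>\<^sub>M borel)" .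
  define M where "M = enn2real (esssup ?R (\<lambda>p. ennreal \<bar>?w p\<bar>))"
  have M: "0 \<le> M" "ennreal M = esssup ?R (\<lambda>p. ennreal \<bar>?w p\<bar>)" using e by (auto simp: M_def)
  have "AE p in ?R. ennreal \<bar>?w p\<bar> \<le> ennreal M" unfolding M(2) by (rule esssup_AE)
  then have "AE p in lborel. p \<in> ?\<Omega> \<longrightarrow> ennreal \<bar>?w p\<bar> \<le> ennreal M"
    using \<Omega> by (subst (asm) AE_restrict_space_iff) auto
  then have "AE p in lborel \<Otimes>\<^sub>M lborel. \<bar>W p\<bar> \<le> M"
    unfolding lborel_prod by eventually_elim (use M(1) in \<open>auto simp: W_def indicator_def\<close>)
  then have "AE x in lborel. AE s in lborel. \<bar>W (x, s)\<bar> \<le> M"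
    by (rule lborel_pair.AE_pair)
  moreover have "{p \<in> space (lborel \<Otimes>\<^sub>M lborel). \<bar>W (fst p, snd p)\<bar> \<le> M} \<in> sets (lborel \<Otimes>\<^sub>M lborel)"
    unfolding lborel_prod by simp measurable
  ultimately have "AE s in lborel. AE x in lborel. \<bar>W (x, s)\<bar> \<le> M"
    by (subst (asm) lborel_pair.AE_commute)
  then have "AE s in lborel. 0 < s \<longrightarrow> (AE x in lborel. \<bar>u s x\<bar> \<le> M)"
    by eventually_elim (auto simp: W_def)
  then show "\<exists>M\<ge>0. AE s in lborel. 0 < s \<longrightarrow> (AE x in lborel. \<bar>u s x\<bar> \<le> M)" using M(1) by blast
qed

text \<open>Times at which the bound holds occur arbitrarily close to t, since a time interval of
  positive length is not null; and the part of |u t| above M is at most the L^1 distance to such a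
  slice.\<close>

lemma L1_continuous_AE_bound:
  fixes u :: "real \<Rightarrow> real^'n \<Rightarrow> real"
  assumes i: "\<And>t. 0 \<le> t \<Longrightarrow> integrable lborel (u t)"
    and c: "\<And>t. 0 \<le> t \<Longrightarrow> ((\<lambda>s. LBINT x. \<bar>u s x - u t x\<bar>) \<longlongrightarrow> 0) (at t within {0..})"
    and M: "AE s in lborel. 0 < s \<longrightarrow> (AE x in lborel. \<bar>u s x\<bar> \<le> M)"
    and t: "0 \<le> t"
  shows "AE x in lborel. \<bar>u t x\<bar> \<le> M"
proof -
  have [measurable]: "u t \<in> borel_measurable borel" using i[OF t] by auto
  define g where "g x = max 0 (\<bar>u t x\<bar> - M)" for x
  have [measurable]: "g \<in> borel_measurable borel" unfolding g_def[abs_def] by measurable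
  have small: "(\<integral>\<^sup>+x. ennreal (g x) \<partial>lborel) \<le> ennreal \<eta>" if \<eta>: "0 < \<eta>" for \<eta>
  proof -
    have "\<forall>\<^sub>F s in at t within {0..}. (LBINT x. \<bar>u s x - u t x\<bar>) < \<eta>"
      using order_tendstoD(2)[OF c[OF t] \<eta>] .
    then obtain d where d: "0 < d" "\<And>s. 0 \<le> s \<Longrightarrow> s \<noteq> t \<Longrightarrow> dist s t < d \<Longrightarrow> (LBINT x. \<bar>u s x - u t x\<bar>) < \<eta>"
      unfolding eventually_at by auto
    have "\<exists>s\<in>{t<..<t + d}. AE x in lborel. \<bar>u s x\<bar> \<le> M"
    proof (rule ccontr)
      assume neg: "\<not> ?thesis"
      have "AE s in lborel. s \<notin> {t<..<t + d}"
        using M by eventually_elim (use neg t in auto)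
      then have "emeasure lborel {t<..<t + d} = 0"
        by (subst (asm) AE_iff_null_sets[symmetric]) auto
      then show False using d by simp
    qed
    then obtain s where s: "t < s" "s < t + d" "AE x in lborel. \<bar>u s x\<bar> \<le> M" by auto
    have s_int: "integrable lborel (u s)" using i s t by simp
    have "(\<integral>\<^sup>+x. ennreal (g x) \<partial>lborel) \<le> (\<integral>\<^sup>+x. ennreal \<bar>u s x - u t x\<bar> \<partial>lborel)"
      by (rule nn_integral_mono_AE) (use s(3) in \<open>eventually_elim, auto simp: g_def intro!: ennreal_leI\<close>)
    also have "\<dots> = ennreal (LBINT x. \<bar>u s x - u t x\<bar>)"
      using s_int i[OF t] by (intro nn_integral_eq_integral) auto
    also have "\<dots> \<le> ennreal \<eta>"
      using d(2)[of s] s t by (intro ennreal_leI) (auto simp: dist_real_def)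
    finally show ?thesis .
  qed
  have "(\<integral>\<^sup>+x. ennreal (g x) \<partial>lborel) \<le> 0"
    by (rule ennreal_le_epsilon) (use small in auto)
  then have "AE x in lborel. ennreal (g x) = 0" by (subst (asm) le_zero_eq, subst (asm) nn_integral_0_iff_AE) auto
  then show ?thesis by eventually_elim (auto simp: g_def max_def split: if_splits)
qed

text \<open>The clamped solution differs from u on a null set at each time, which neither the
  convolutions nor the norms see, and F composed with the clamp takes the same values along it. It
  therefore satisfies the locale, whose estimates transfer back.\<close>

lemma convection_diffusion_bounds:
  fixes a :: "real^'n" and u :: "real \<Rightarrow> real^'n \<Rightarrow> real"
  assumes F: "F C1_differentiable_on UNIV" "F 0 = 0" and u0: "u0 \<in> Lp 1 lborel"
    and sol: "convection_diffusion_solution a F u0 u" and t: "0 < t"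
  shows "AE x in lborel. \<bar>u t x\<bar> \<le>
      smoothing_const CARD('n) * 2 ^ CARD('n) * t powr (- real CARD('n) / 2) * (LBINT x. \<bar>u0 x\<bar>)"
    and "(LBINT x. \<bar>u t x\<bar>) \<le> (LBINT x. \<bar>u0 x\<bar>)"
proof -
  have cont: "continuous_L1 u" and Linf: "(\<lambda>(x, t). u t x) \<in> Lp \<infinity> (restrict_space lborel (UNIV \<times> {0<..}))"
    and init: "AE x in lborel. u 0 x = u0 x"
    and mild: "\<And>t. 0 < t \<Longrightarrow> AE x in lborel. u t x = conv (heat_kernel t) u0 x +
          (LBINT s:{0<..<t}. conv (grad_heat_kernel a (t - s)) (\<lambda>y. F (u s y)) x)"
    using sol by (auto simp: convection_diffusion_solution_def)
  have ui: "integrable lborel (u t)" if "0 \<le> t" for t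
    by (rule Lp_1_integrable(1)) (use cont that in \<open>auto simp: continuous_L1_def\<close>)
  have um [measurable]: "u t \<in> borel_measurable borel" if "0 \<le> t" for t using ui[OF that] by auto
  have u0m [measurable]: "u0 \<in> borel_measurable borel" using u0 by (auto simp: Lp_def)
  have uc: "((\<lambda>s. LBINT x. \<bar>u s x - u t x\<bar>) \<longlongrightarrow> 0) (at t within {0..})" if t: "0 \<le> t" for t
  proof -
    have "((\<lambda>s. Lp_norm 1 lborel (\<lambda>x. u s x - u t x)) \<longlongrightarrow> 0) (at t within {0..})"
      using cont t by (simp add: continuous_L1_def)
    moreover have "\<forall>\<^sub>F s in at t within {0..}. Lp_norm 1 lborel (\<lambda>x. u s x - u t x) = ennreal (LBINT x. \<bar>u s x - u t x\<bar>)"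
      unfolding eventually_at_filter
    proof (intro always_eventually allI impI)
      fix s :: real assume "s \<in> {0..}"
      then have d: "integrable lborel (\<lambda>x. u s x - u t x)" using ui t by auto
      then have "Lp_norm 1 lborel (\<lambda>x. u s x - u t x) = (\<integral>\<^sup>+x. ennreal \<bar>u s x - u t x\<bar> \<partial>lborel)"
        by (intro Lp_norm_1) auto
      also have "\<dots> = ennreal (LBINT x. \<bar>u s x - u t x\<bar>)"
        using d by (intro nn_integral_eq_integral) auto
      finally show "Lp_norm 1 lborel (\<lambda>x. u s x - u t x) = ennreal (LBINT x. \<bar>u s x - u t x\<bar>)" .
    qed
    ultimately have "((\<lambda>s. ennreal (LBINT x. \<bar>u s x - u t x\<bar>)) \<longlongrightarrow> ennreal 0) (at t within {0..})"
      by (simp add: tendsto_cong)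
    then show ?thesis by (subst (asm) tendsto_ennreal_iff) (auto intro: always_eventually)
  qed
  obtain M where M: "0 \<le> M" "AE s in lborel. 0 < s \<longrightarrow> (AE x in lborel. \<bar>u s x\<bar> \<le> M)"
    using Lp_infinity_space_time(2)[OF Linf] by blast
  have uM: "AE x in lborel. \<bar>u t x\<bar> \<le> M" if "0 \<le> t" for t
    by (rule L1_continuous_AE_bound[OF ui uc M(2) that])
  note clamp = clamp_real_props[OF M(1)]
  define v where "v t x = clamp_real M (u t x)" for t x
  define f where "f r = F (clamp_real M r)" for r
  have vu: "AE x in lborel. v t x = u t x" if "0 \<le> t" for t
    using uM[OF that] by eventually_elim (simp add: v_def clamp(2))
  have vm [measurable]: "v t \<in> borel_measurable borel" if "0 \<le> t" for t
    unfolding v_def[abs_def] using um[OF that] by measurable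
  obtain L where L: "\<And>r s. \<bar>f r - f s\<bar> \<le> L * \<bar>r - s\<bar>"
    using C1_lipschitz_clamp(1)[OF F(1) M(1)] unfolding f_def by blast
  have Fm [measurable]: "F \<in> borel_measurable borel"
    by (rule borel_measurable_continuous_onI[OF C1_lipschitz_clamp(2)[OF F(1) M(1)]])
  have fm [measurable]: "f \<in> borel_measurable borel" unfolding f_def[abs_def] by measurable
  have fF: "AE x in lborel. f (v t x) = F (u t x)" if "0 \<le> t" for t
    using uM[OF that] by eventually_elim (simp add: f_def v_def clamp)
  interpret bounded_mild_solution a f v M L
  proof
    show "integrable lborel (v t)" if "0 \<le> t" for t
      by (subst integrable_cong_AE[OF _ _ vu[OF that]]) (use that ui um vm in auto)
    show "\<bar>v t x\<bar> \<le> M" for t x by (simp add: v_def clamp)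
    show "\<bar>f r - f s\<bar> \<le> L * \<bar>r - s\<bar>" for r s by (rule L)
    show "f 0 = 0" by (simp add: f_def clamp F)
    show "(\<lambda>(s, x). if 0 < s then f (v s x) else 0) \<in> borel_measurable (borel \<Otimes>\<^sub>M borel)"
    proof -
      have "(\<lambda>p. f (clamp_real M (case p of (s, x) \<Rightarrow> if 0 < s then u s x else 0))) \<in> borel_measurable (borel \<Otimes>\<^sub>M borel)"
        using Lp_infinity_space_time(1)[OF Linf] by measurable
      also have "(\<lambda>p. f (clamp_real M (case p of (s, x) \<Rightarrow> if 0 < s then u s x else 0))) =
          (\<lambda>(s, x). if 0 < s then f (v s x) else 0)"
        by (auto simp: fun_eq_iff v_def clamp f_def F)
      finally show ?thesis .
    qed
    show "((\<lambda>s. LBINT x. \<bar>v s x - v t x\<bar>) \<longlongrightarrow> 0) (at t within {0..})" if t: "0 \<le> t" for t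
    proof -
      have "\<forall>\<^sub>F s in at t within {0..}. (LBINT x. \<bar>v s x - v t x\<bar>) = (LBINT x. \<bar>u s x - u t x\<bar>)"
        unfolding eventually_at_filter
      proof (intro always_eventually allI impI)
        fix s :: real assume s: "s \<in> {0..}"
        then have [measurable]: "u s \<in> borel_measurable borel" "v s \<in> borel_measurable borel"
          "u t \<in> borel_measurable borel" "v t \<in> borel_measurable borel" using t um vm by auto
        have "AE x in lborel. \<bar>v s x - v t x\<bar> = \<bar>u s x - u t x\<bar>"
          using vu[of s] vu[OF t] s by auto
        then show "(LBINT x. \<bar>v s x - v t x\<bar>) = (LBINT x. \<bar>u s x - u t x\<bar>)"
          by (intro integral_cong_AE) auto
      qed
      then show ?thesis using uc[OF t] by (subst tendsto_cong)
    qed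
    show "AE x in lborel. v t x = heat t (v 0) x + (LBINT s:{0<..<t}. grad_heat a (t - s) (\<lambda>y. f (v s y)) x)"
      if t: "0 < t" for t
    proof -
      have [measurable]: "v 0 \<in> borel_measurable borel" by (rule vm) simp
      have "AE y in lborel. v 0 y = u0 y" using vu[of 0] init by auto
      then have 1: "heat t (v 0) x = heat t u0 x" for x
        unfolding conv_def by (intro integral_cong_AE) (auto elim!: eventually_mono)
      have 2: "grad_heat a (t - s) (\<lambda>y. f (v s y)) x = grad_heat a (t - s) (\<lambda>y. F (u s y)) x"
        if s: "s \<in> {0<..<t}" for s x
      proof -
        have [measurable]: "u s \<in> borel_measurable borel" "v s \<in> borel_measurable borel"
          "grad_heat_kernel a (t - s) \<in> borel_measurable borel" using s um vm by auto
        show ?thesis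
          unfolding conv_def using fF[of s] s by (intro integral_cong_AE) (auto elim!: eventually_mono)
      qed
      have 3: "(LBINT s:{0<..<t}. grad_heat a (t - s) (\<lambda>y. f (v s y)) x) =
          (LBINT s:{0<..<t}. grad_heat a (t - s) (\<lambda>y. F (u s y)) x)" for x
        by (rule set_lebesgue_integral_cong) (auto simp: 2)
      show ?thesis unfolding 1 3 using vu[OF less_imp_le[OF t]] mild[OF t] by auto
    qed
  qed
  have t0: "0 \<le> t" using t by simp
  have [measurable]: "u t \<in> borel_measurable borel" "v t \<in> borel_measurable borel" "v 0 \<in> borel_measurable borel"
    using t0 um vm by auto
  have U: "(LBINT x. \<bar>v 0 x\<bar>) = (LBINT x. \<bar>u0 x\<bar>)"
    by (rule integral_cong_AE) (use vu[of 0] init in auto)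
  have V: "(LBINT x. \<bar>v t x\<bar>) = (LBINT x. \<bar>u t x\<bar>)"
    by (rule integral_cong_AE) (use vu[OF t0] in auto)
  show "AE x in lborel. \<bar>u t x\<bar> \<le>
      smoothing_const CARD('n) * 2 ^ CARD('n) * t powr (- real CARD('n) / 2) * (LBINT x. \<bar>u0 x\<bar>)"
    using sup_bound[OF t] vu[OF t0] unfolding U by eventually_elim simp
  show "(LBINT x. \<bar>u t x\<bar>) \<le> (LBINT x. \<bar>u0 x\<bar>)"
    using L1_nonincreasing[of 0 t] t0 unfolding U V by simp
qed

text \<open>Almost everywhere |f|^r \<le> S^(r-1) |f|; integrate and take the r-th root.\<close>

lemma Lp_norm_interpolation:
  fixes f :: "'a \<Rightarrow> real"
  assumes f: "integrable M f" and S: "0 \<le> S" "AE x in M. \<bar>f x\<bar> \<le> S"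
    and U: "(\<integral>x. \<bar>f x\<bar> \<partial>M) \<le> U" and r: "1 \<le> r"
  shows "Lp_norm (ennreal r) M f \<le> ennreal (S powr (1 - 1 / r) * U powr (1 / r))"
proof -
  have [measurable]: "f \<in> borel_measurable M" using f by auto
  have U0: "0 \<le> U" using U by (rule order_trans[rotated]) (simp add: Bochner_Integration.integral_nonneg)
  let ?I = "\<integral>\<^sup>+x. ennreal (\<bar>f x\<bar> powr r) \<partial>M"
  have "?I \<le> (\<integral>\<^sup>+x. ennreal (S powr (r - 1)) * ennreal \<bar>f x\<bar> \<partial>M)"
  proof (rule nn_integral_mono_AE)
    show "AE x in M. ennreal (\<bar>f x\<bar> powr r) \<le> ennreal (S powr (r - 1)) * ennreal \<bar>f x\<bar>"
      using S(2)
    proof eventually_elim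
      case (elim x)
      have "\<bar>f x\<bar> powr r \<le> S powr (r - 1) * \<bar>f x\<bar>"
      proof (cases "f x = 0")
        case False
        have "\<bar>f x\<bar> powr r = \<bar>f x\<bar> powr (r - 1) * \<bar>f x\<bar> powr 1"
          unfolding powr_add[symmetric] by simp
        also have "\<dots> \<le> S powr (r - 1) * \<bar>f x\<bar>"
          using elim r False by (auto intro!: mult_right_mono powr_mono2)
        finally show ?thesis .
      qed simp
      then show ?case by (simp add: ennreal_leI flip: ennreal_mult)
    qed
  qed
  also have "\<dots> = ennreal (S powr (r - 1)) * ennreal (\<integral>x. \<bar>f x\<bar> \<partial>M)"
    using f by (simp add: nn_integral_cmult nn_integral_eq_integral)
  also have "\<dots> \<le> ennreal (S powr (r - 1) * U)"
    using U U0 by (simp add: ennreal_leI mult_left_mono Bochner_Integration.integral_nonneg flip: ennreal_mult)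
  finally have I: "?I \<le> ennreal (S powr (r - 1) * U)" .
  then have fin: "?I \<noteq> \<infinity>" by (metis ennreal_less_top infinity_ennreal_def leD)
  have "enn2real ?I \<le> S powr (r - 1) * U"
    using I U0 by (intro enn2real_leI) auto
  then have "enn2real ?I powr (1 / r) \<le> (S powr (r - 1) * U) powr (1 / r)"
    using r by (intro powr_mono2) auto
  also have "\<dots> = S powr (1 - 1 / r) * U powr (1 / r)"
    using r U0 by (simp add: powr_mult powr_powr diff_divide_distrib)
  finally show ?thesis
    using fin r by (simp add: Lp_norm_def Let_def ennreal_leI)
qed

text \<open>The constant found here depends on N alone and serves every p. The exponent is uniform
  in p because \<open>enn2real (1 / p)\<close> is 0 for p = \<infinity>.\<close>

theorem theorem4p2:
  fixes p :: ennreal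
  assumes "1 \<le> p"
  shows "\<exists>C::real. C > 0 \<and>
    (\<forall>(a :: real ^ 'n) (F :: real \<Rightarrow> real) (u0 :: real ^ 'n \<Rightarrow> real) (u :: real \<Rightarrow> real ^ 'n \<Rightarrow> real).
       F C1_differentiable_on UNIV \<and> F 0 = 0 \<and>
       u0 \<in> Lp 1 lborel \<and> u0 \<in> Lp \<infinity> lborel \<and>
       convection_diffusion_solution a F u0 u \<longrightarrow>
       (\<forall>t>0. Lp_norm p lborel (u t) \<le>
          ennreal C * Lp_norm 1 lborel u0 *
          ennreal (t powr (- (real CARD('n) / 2) * (1 - enn2real (1 / p))))))"
proof -
  define B where "B = smoothing_const CARD('n) * 2 ^ CARD('n)"
  \<comment> \<open>Interpolation produces B^(1 - 1/r), which lies below the maximum of 1 and B for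
    every r \<ge> 1.\<close>
  define C where "C = max 1 B"
  have B: "0 < B" using smoothing_const_pos by (simp add: B_def)
  have C: "1 \<le> C" "B \<le> C" "0 < C" by (auto simp: C_def)
  have "Lp_norm p lborel (u t) \<le> ennreal C * Lp_norm 1 lborel u0 *
      ennreal (t powr (- (real CARD('n) / 2) * (1 - enn2real (1 / p))))"
    if F: "F C1_differentiable_on UNIV" "F 0 = 0" and u0: "u0 \<in> Lp 1 lborel"
      and sol: "convection_diffusion_solution a F u0 u" and t: "0 < t"
    for a :: "real ^ 'n" and F and u0 :: "real ^ 'n \<Rightarrow> real" and u t
  proof -
    define U where "U = (LBINT x. \<bar>u0 x\<bar>)"
    define e where "e = - (real CARD('n) / 2)"
    define S where "S = B * t powr e * U"
    have U: "0 \<le> U" by (simp add: U_def Bochner_Integration.integral_nonneg)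
    have S: "0 \<le> S" using B U by (simp add: S_def)
    have sup: "AE x in lborel. \<bar>u t x\<bar> \<le> S"
      using convection_diffusion_bounds(1)[OF F u0 sol t] by (simp add: S_def B_def U_def e_def)
    have L1: "(LBINT x. \<bar>u t x\<bar>) \<le> U"
      using convection_diffusion_bounds(2)[OF F u0 sol t] by (simp add: U_def)
    have ui: "integrable lborel (u t)"
      by (rule Lp_1_integrable(1)) (use sol t in \<open>auto simp: convection_diffusion_solution_def continuous_L1_def\<close>)
    have N: "Lp_norm 1 lborel u0 = ennreal U" unfolding U_def by (rule Lp_1_integrable(2)[OF u0])
    show ?thesis
    proof (cases p)
      case (real r)
      have r: "1 \<le> r" using assms real by simp
      have pr: "enn2real (1 / p) = 1 / r" using real r by (simp add: divide_ennreal flip: ennreal_1)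
      have "Lp_norm p lborel (u t) \<le> ennreal (S powr (1 - 1 / r) * U powr (1 / r))"
        unfolding real(2) by (rule Lp_norm_interpolation[OF ui S sup L1 r])
      also have "\<dots> \<le> ennreal (C * U * t powr (e * (1 - 1 / r)))"
      proof (rule ennreal_leI)
        have "S powr (1 - 1 / r) * U powr (1 / r) =
            B powr (1 - 1 / r) * t powr (e * (1 - 1 / r)) * (U powr (1 - 1 / r) * U powr (1 / r))"
          using B U by (simp add: S_def powr_mult powr_powr)
        also have "U powr (1 - 1 / r) * U powr (1 / r) = U"
          unfolding powr_add[symmetric] using U by simp
        also have "B powr (1 - 1 / r) \<le> C"
        proof -
          have "B powr (1 - 1 / r) \<le> C powr (1 - 1 / r)" using B C r by (intro powr_mono2) auto
          also have "\<dots> \<le> C powr 1" using C r by (intro powr_mono) auto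
          finally show ?thesis using C by simp
        qed
        finally show "S powr (1 - 1 / r) * U powr (1 / r) \<le> C * U * t powr (e * (1 - 1 / r))"
          using U by (simp add: mult_right_mono mult_ac)
      qed
      finally show ?thesis using C U by (simp add: N pr e_def ennreal_mult)
    next
      case top
      have "Lp_norm p lborel (u t) \<le> ennreal S"
        unfolding Lp_norm_def using top ui sup by (auto intro!: esssup_I elim!: eventually_mono intro: ennreal_leI)
      also have "\<dots> \<le> ennreal (C * U * t powr e)"
        using B C U by (intro ennreal_leI) (simp add: S_def mult_ac mult_right_mono)
      finally show ?thesis using C U by (simp add: N top e_def ennreal_mult)
    qed
  qed
  then show ?thesis using C(3) by (intro exI[of _ C]) blast
qed

end
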